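(* Let $U\subset\mathbb{C}^n$ be a bounded connected domain. (1) If $f:U\to[-\infty,\infty)$, $f\not\equiv-\infty$, is strictly plurisubharmonic on average, then $f\in L^1(U,\mathrm{loc})$ and $f$ is strictly plurisubharmonic in distribution. (2) Conversely, if $T\in\mathcal{D}'(U)$ is strictly plurisubharmonic, then there exists $f\in L^1(U,\mathrm{loc})$ strictly plurisubharmonic on average such that $f$ induces the distribution $T$. (3) As a consequence, if $f\in L^1(U,\mathrm{loc})$ is strictly plurisubharmonic in distribution, then there exists $g\in L^1(U,\mathrm{loc})$ strictly plurisubharmonic on average such that $f=g$ $m$-a.e.
   Context: $m$ is Lebesgue measure on $\mathbb{C}^n\cong\mathbb{R}^{2n}$; $C(U)$ denotes the real-valued continuous functions on $U$; $\|\cdot\|$ is the Euclidean norm of $\mathbb{C}^n$; $L^1(U,\mathrm{loc})$ denotes locally integrable functions on $U$. Strictly plurisubharmonic on average (continuously): an upper semicontinuous function $g:U\to[-\infty,\infty)$ is so called if there exist a positive $\varphi\in C(U)$ and a lower semicontinuous $\delta:U\to(0,\infty)$ such that for all $a\in U$ and all $b\in\mathbb{C}^n$ with $\|b\|<\delta(a)$ (where $\delta(a)$ is small enough that $a+\overline{\mathbb{D}}b\subset U$ for such $b$, $\overline{\mathbb D}$ being the closed unit disk of $\mathbb{C}$), $$\varphi(a)\|b\|^2+g(a)\le\frac1{2\pi}\int_0^{2\pi}g(a+e^{i\theta}b)\,d\theta.$$ $\mathcal{D}(U)$ denotes the real-valued test functions on $U$, and $\mathcal{D}'(U)$ the distributions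 on $U$ (continuous linear functionals on $\mathcal{D}(U)$). A function $f\in L^1(U,\mathrm{loc})$ induces the distribution $\phi\mapsto\int_U f\phi\,dm$. For $T\in\mathcal{D}'(U)$, $\phi\in\mathcal D(U)$ and $w\in\mathbb{C}^n$, put $$D'D''T(\phi)(w,w):=\sum_{j,k=1}^n\frac{\partial^2T}{\partial z_j\partial\overline{z_k}}(\phi)\,w_j\overline{w_k},$$ with derivatives in the sense of distributions. $T$ is called strictly plurisubharmonic if there exists a positive $\psi\in C(U)$ such that $$D'D''T(\phi)(w,w)\ge\Big(\int_U\psi\,\phi\,dm\Big)\|w\|^2\quad\text{for all }\phi\ge0\text{ in }\mathcal{D}(U)\text{ and }w\in\mathbb{C}^n.$$ A function $f\in L^1(U,\mathrm{loc})$ is strictly plurisubharmonic in distribution if the distribution it induces is strictly plurisubharmonic. *)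

theory Defs
  imports "HOL-Analysis.Analysis"
begin

section \<open>Semicontinuity and local integrability\<close>

definition upper_semicontinuous_on :: "'a::topological_space set \<Rightarrow> ('a \<Rightarrow> 'b::linorder) \<Rightarrow> bool" where
  "upper_semicontinuous_on U g \<longleftrightarrow> (\<forall>c. openin (top_of_set U) {x \<in> U. g x < c})"

definition lower_semicontinuous_on :: "'a::topological_space set \<Rightarrow> ('a \<Rightarrow> 'b::linorder) \<Rightarrow> bool" where
  "lower_semicontinuous_on U g \<longleftrightarrow> (\<forall>c. openin (top_of_set U) {x \<in> U. c < g x})"

text \<open>Representatives of elements of \<open>L\<^sup>1(U, loc)\<close> may take infinite values on a null set, so that
  functions \<open>U \<rightarrow> [-\<infinity>, \<infinity>)\<close> can be elements.  As everywhere below, values outside \<open>U\<close> are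
  irrelevant.\<close>

definition loc_integrable_on :: "'a::euclidean_space set \<Rightarrow> ('a \<Rightarrow> ereal) \<Rightarrow> bool" where
  "loc_integrable_on U f \<longleftrightarrow>
     f \<in> borel_measurable (lebesgue_on U) \<and>
     (\<forall>K. compact K \<and> K \<subseteq> U \<longrightarrow> set_nn_integral lebesgue K (\<lambda>x. e2ennreal \<bar>f x\<bar>) < \<infinity>)"


section \<open>Strict plurisubharmonicity on average\<close>

text \<open>Since \<^const>\<open>e2ennreal\<close> sends negative values to \<open>0\<close>, this is the Lebesgue integral
  \<open>\<integral> h\<^sup>+ - \<integral> h\<^sup>-\<close> with values in the extended reals.  It is only applied to functions that are
  bounded above (upper semicontinuous without the value \<open>\<infinity>\<close> on a compact set), hence the
  minuend is finite.\<close>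

definition ereal_integral :: "'a measure \<Rightarrow> ('a \<Rightarrow> ereal) \<Rightarrow> ereal" where
  "ereal_integral M h =
     enn2ereal (\<integral>\<^sup>+x. e2ennreal (h x) \<partial>M) - enn2ereal (\<integral>\<^sup>+x. e2ennreal (- h x) \<partial>M)"

definition circle_mean :: "(complex ^ 'n \<Rightarrow> ereal) \<Rightarrow> complex ^ 'n \<Rightarrow> complex ^ 'n \<Rightarrow> ereal" where
  "circle_mean g a b =
     ereal (1 / (2 * pi)) * ereal_integral (lebesgue_on {0..2 * pi}) (\<lambda>\<theta>. g (a + cis \<theta> *s b))"

definition strictly_psh_on_average :: "(complex ^ 'n) set \<Rightarrow> (complex ^ 'n \<Rightarrow> ereal) \<Rightarrow> bool" where
  "strictly_psh_on_average U g \<longleftrightarrow>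
     (\<forall>x\<in>U. g x < \<infinity>) \<and> upper_semicontinuous_on U g \<and>
     (\<exists>(\<phi> :: complex ^ 'n \<Rightarrow> real) (\<delta> :: complex ^ 'n \<Rightarrow> real).
        continuous_on U \<phi> \<and> (\<forall>x\<in>U. 0 < \<phi> x) \<and>
        lower_semicontinuous_on U \<delta> \<and> (\<forall>x\<in>U. 0 < \<delta> x) \<and>
        (\<forall>a\<in>U. \<forall>b. norm b < \<delta> a \<longrightarrow>
           {a + \<zeta> *s b |\<zeta>. norm \<zeta> \<le> 1} \<subseteq> U \<and>
           ereal (\<phi> a * (norm b)\<^sup>2) + g a \<le> circle_mean g a b))"


section \<open>Test functions and distributions\<close>

definition dir_deriv :: "'a::real_normed_vector \<Rightarrow> ('a \<Rightarrow> real) \<Rightarrow> 'a \<Rightarrow> real" where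
  "dir_deriv v \<phi> = (\<lambda>x. frechet_derivative \<phi> (at x) v)"

text \<open>\<open>iter_deriv [v\<^sub>1, \<dots>, v\<^sub>k] \<phi>\<close> is \<open>\<partial>\<^bsub>v\<^sub>1\<^esub> \<dots> \<partial>\<^bsub>v\<^sub>k\<^esub> \<phi>\<close>.\<close>

definition iter_deriv :: "'a::real_normed_vector list \<Rightarrow> ('a \<Rightarrow> real) \<Rightarrow> 'a \<Rightarrow> real" where
  "iter_deriv vs = foldr dir_deriv vs"

definition smooth :: "('a::real_normed_vector \<Rightarrow> real) \<Rightarrow> bool" where
  "smooth \<phi> \<longleftrightarrow> (\<forall>vs x. iter_deriv vs \<phi> differentiable (at x))"

definition supp :: "('a::topological_space \<Rightarrow> real) \<Rightarrow> 'a set" where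
  "supp \<phi> = closure {x. \<phi> x \<noteq> 0}"

text \<open>Elements of \<open>\<D>(U)\<close> are regarded as functions on the whole space, extended by \<open>0\<close>.\<close>

definition test_functions :: "'a::euclidean_space set \<Rightarrow> ('a \<Rightarrow> real) set" where
  "test_functions U = {\<phi>. smooth \<phi> \<and> compact (supp \<phi>) \<and> supp \<phi> \<subseteq> U}"

definition Ck_norm :: "nat \<Rightarrow> ('a::euclidean_space \<Rightarrow> real) \<Rightarrow> real" where
  "Ck_norm N \<phi> = (\<Sum>vs | set vs \<subseteq> Basis \<and> length vs \<le> N. SUP x. \<bar>iter_deriv vs \<phi> x\<bar>)"

text \<open>A distribution is a real linear functional on the subspace \<open>\<D>(U)\<close> of all functions (its
  values elsewhere are irrelevant), continuous for the usual inductive limit topology: on the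
  test functions supported in a fixed compact set it is bounded by a \<open>C\<^sup>N\<close>-norm.\<close>

definition distributions :: "'a::euclidean_space set \<Rightarrow> (('a \<Rightarrow> real) \<Rightarrow> real) set" where
  "distributions U = {T.
     (\<forall>\<phi>\<in>test_functions U. \<forall>\<eta>\<in>test_functions U. T (\<lambda>x. \<phi> x + \<eta> x) = T \<phi> + T \<eta>) \<and>
     (\<forall>c. \<forall>\<phi>\<in>test_functions U. T (\<lambda>x. c * \<phi> x) = c * T \<phi>) \<and>
     (\<forall>K. compact K \<and> K \<subseteq> U \<longrightarrow>
        (\<exists>C N. \<forall>\<phi>\<in>test_functions U. supp \<phi> \<subseteq> K \<longrightarrow> \<bar>T \<phi>\<bar> \<le> C * Ck_norm N \<phi>))}"

definition induced_dist ::
    "'a::euclidean_space set \<Rightarrow> ('a \<Rightarrow> ereal) \<Rightarrow> ('a \<Rightarrow> real) \<Rightarrow> real" where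
  "induced_dist U f \<phi> = (LINT x:U|lebesgue. real_of_ereal (f x) * \<phi> x)"

definition induces :: "'a::euclidean_space set \<Rightarrow> ('a \<Rightarrow> ereal) \<Rightarrow> (('a \<Rightarrow> real) \<Rightarrow> real) \<Rightarrow> bool" where
  "induces U f T \<longleftrightarrow> (\<forall>\<phi>\<in>test_functions U. T \<phi> = induced_dist U f \<phi>)"


section \<open>Strict plurisubharmonicity in the sense of distributions\<close>

text \<open>The Wirtinger derivatives of a real distribution are complex valued functionals on the real
  test functions, so distributional derivatives are defined for complex valued functionals.\<close>

definition dist_deriv ::
    "'a::real_normed_vector \<Rightarrow> (('a \<Rightarrow> real) \<Rightarrow> complex) \<Rightarrow> ('a \<Rightarrow> real) \<Rightarrow> complex" where
  "dist_deriv v S \<phi> = - S (dir_deriv v \<phi>)"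

definition dist_dz ::
    "'n::finite \<Rightarrow> ((complex ^ 'n \<Rightarrow> real) \<Rightarrow> complex) \<Rightarrow> (complex ^ 'n \<Rightarrow> real) \<Rightarrow> complex" where
  "dist_dz j S \<phi> =
     (dist_deriv (axis j 1) S \<phi> - \<i> * dist_deriv (axis j \<i>) S \<phi>) / 2"

definition dist_dzbar ::
    "'n::finite \<Rightarrow> ((complex ^ 'n \<Rightarrow> real) \<Rightarrow> complex) \<Rightarrow> (complex ^ 'n \<Rightarrow> real) \<Rightarrow> complex" where
  "dist_dzbar j S \<phi> =
     (dist_deriv (axis j 1) S \<phi> + \<i> * dist_deriv (axis j \<i>) S \<phi>) / 2"

definition levi_form ::
    "((complex ^ 'n::finite \<Rightarrow> real) \<Rightarrow> real) \<Rightarrow> (complex ^ 'n \<Rightarrow> real) \<Rightarrow> complex ^ 'n \<Rightarrow> complex" where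
  "levi_form T \<phi> w =
     (\<Sum>j\<in>UNIV. \<Sum>k\<in>UNIV.
        dist_dz j (dist_dzbar k (\<lambda>\<eta>. complex_of_real (T \<eta>))) \<phi> * w $ j * cnj (w $ k))"

text \<open>For a distribution \<open>T\<close> the matrix of second derivatives is Hermitian, so \<open>levi_form T \<phi> w\<close> is
  a real number and \<^const>\<open>Re\<close> only changes its type.\<close>

definition strictly_psh_dist ::
    "(complex ^ 'n::finite) set \<Rightarrow> ((complex ^ 'n \<Rightarrow> real) \<Rightarrow> real) \<Rightarrow> bool" where
  "strictly_psh_dist U T \<longleftrightarrow>
     (\<exists>\<psi> :: complex ^ 'n \<Rightarrow> real. continuous_on U \<psi> \<and> (\<forall>x\<in>U. 0 < \<psi> x) \<and>
        (\<forall>\<phi>\<in>test_functions U. (\<forall>x. 0 \<le> \<phi> x) \<longrightarrow>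
           (\<forall>w. (LINT x:U|lebesgue. \<psi> x * \<phi> x) * (norm w)\<^sup>2 \<le> Re (levi_form T \<phi> w))))"

definition strictly_psh_in_distribution ::
    "(complex ^ 'n::finite) set \<Rightarrow> (complex ^ 'n \<Rightarrow> ereal) \<Rightarrow> bool" where
  "strictly_psh_in_distribution U f \<longleftrightarrow> strictly_psh_dist U (induced_dist U f)"

end

theory Submission imports Defs begin

text \<open>Let \<open>\<rho>\<^sub>t\<close> be a radial mollifier supported in the ball of radius \<open>e\<^sup>t\<close>.  Its \<open>t\<close>-derivative is the
  Laplacian of a nonnegative function.  Hence \<open>T * \<rho>\<^sub>t\<close> decreases as \<open>t\<close> tends to \<open>-\<infinity>\<close> whenever \<open>T\<close>
  is subharmonic.  If \<open>T\<close> is strictly plurisubharmonic, the restriction of \<open>T * \<rho>\<^sub>t\<close> to a complex disc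
  satisfies the mean value inequality with a gain that is quadratic in the radius and uniform in
  \<open>t\<close>, because its circle means are convex functions of the logarithm of the radius.  The monotone
  limit \<open>f\<close> of the mollifications is upper semicontinuous, inherits the mean value inequality, and
  induces \<open>T\<close>, because \<open>T * \<rho>\<^sub>t\<close> tends to \<open>T\<close>.

  Conversely, if \<open>f\<close> is strictly plurisubharmonic on average, the mean value inequality over all
  circles in a ball, together with the rotation invariance of Lebesgue measure, shows that \<open>f\<close> is
  integrable on a ball as soon as it is finite at the centre.  By connectedness \<open>f\<close> is locally
  integrable.  Multiplying the mean value inequality on circles of radius \<open>t\<close> by a test function
  and shifting the circle means to the test function by Fubini's theorem, one obtains the
  distributional inequality from a second order Taylor expansion as \<open>t\<close> tends to \<open>0\<close>.

  The third part holds because a locally integrable function is determined almost everywhere by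
  the distribution it induces.\<close>

subsection \<open>Smooth functions\<close>

text \<open>A mollification is the number \<open>T (\<lambda>y. mollifier t (x - y))\<close>; every
  function of \<open>x\<close>, of \<open>t\<close> or of polar coordinates in the proof arises by
  moving a test function with a parameter. Differentiating or integrating such a function means
  exchanging \<open>T\<close> with a limit of test functions, which the continuity of
  \<open>T\<close> permits only while all supports stay in one compact subset of \<open>U\<close>.
  This is why radii are controlled throughout and why a mollification at a point is used only for
  small \<open>t\<close>.

  The constants come from one coincidence. The Levi form in direction \<open>w\<close> is a quarter
  of the Laplacian in the real directions \<open>w\<close> and \<open>\<i> *s w\<close>; to second
  order, a circle mean exceeds the central value by a quarter of the same Laplacian. So a function
  on average passes its weight unchanged to its distribution. From a distribution to a function half
  of the weight is given away, since the weight at the centre must be compared with its values at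
  all nearby points that the mollifier sees.

  Infinite values are removed as soon as the centre of a circle has a finite value: then the mean
  inequality becomes one between real integrals.\<close>

lemma dir_deriv_eq:
  assumes "(f has_derivative f') (at x)"
  shows "dir_deriv v f x = f' v"
  using frechet_derivative_at[OF assms] by (simp add: dir_deriv_def)

lemma has_derivative_dir_deriv:
  assumes "f differentiable (at x)"
  shows "(f has_derivative (\<lambda>v. dir_deriv v f x)) (at x)"
  using assms by (simp add: dir_deriv_def frechet_derivative_works[symmetric])

lemma iter_deriv_Nil [simp]: "iter_deriv [] f = f"
  and iter_deriv_Cons: "iter_deriv (v # vs) f = dir_deriv v (iter_deriv vs f)"
  and iter_deriv_append: "iter_deriv (vs @ ws) f = iter_deriv vs (iter_deriv ws f)"
  by (simp_all add: iter_deriv_def)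

text \<open>\<open>smooth\<close> quantifies over all lists of directions at once and offers no
  induction. Grading by the number of derivatives supplies one, for products, compositions and
  families closed under differentiation.\<close>

definition smooth_upto :: "nat \<Rightarrow> ('a::real_normed_vector \<Rightarrow> real) \<Rightarrow> bool" where
  "smooth_upto k f \<longleftrightarrow> (\<forall>vs x. length vs \<le> k \<longrightarrow> iter_deriv vs f differentiable (at x))"

lemma smooth_iff: "smooth f \<longleftrightarrow> (\<forall>k. smooth_upto k f)"
  by (auto simp: smooth_def smooth_upto_def)

lemma smooth_upto_0: "smooth_upto 0 f \<longleftrightarrow> (\<forall>x. f differentiable (at x))"
  by (auto simp: smooth_upto_def)

text \<open>\<open>iter_deriv\<close> adds further derivatives on the outside, whereas the
  inductions differentiate \<open>f\<close> once and apply the hypothesis to the result. Hence lists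
  are split at their last element, which acts first.\<close>

lemma smooth_upto_Suc:
  "smooth_upto (Suc k) f \<longleftrightarrow> (\<forall>x. f differentiable (at x)) \<and> (\<forall>v. smooth_upto k (dir_deriv v f))"
proof safe
  fix x assume "smooth_upto (Suc k) f"
  then show "f differentiable (at x)" unfolding smooth_upto_def by (metis iter_deriv_Nil le0 list.size(3))
next
  fix v assume *: "smooth_upto (Suc k) f"
  show "smooth_upto k (dir_deriv v f)"
    unfolding smooth_upto_def
  proof safe
    fix vs x assume "length (vs :: 'a list) \<le> k"
    then have "iter_deriv (vs @ [v]) f differentiable (at x)"
      using * unfolding smooth_upto_def by simp
    then show "iter_deriv vs (dir_deriv v f) differentiable (at x)"
      by (simp add: iter_deriv_append iter_deriv_Cons)
  qed
next
  assume f: "\<forall>x. f differentiable (at x)" and *: "\<forall>v. smooth_upto k (dir_deriv v f)"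
  show "smooth_upto (Suc k) f"
    unfolding smooth_upto_def
  proof safe
    fix vs x assume vs: "length (vs :: 'a list) \<le> Suc k"
    show "iter_deriv vs f differentiable (at x)"
    proof (cases vs rule: rev_cases)
      case Nil
      then show ?thesis using f by simp
    next
      case (snoc ws w)
      then have "iter_deriv ws (dir_deriv w f) differentiable (at x)"
        using * vs unfolding smooth_upto_def by simp
      then show ?thesis by (simp add: snoc iter_deriv_append iter_deriv_Cons)
    qed
  qed
qed

lemma smooth_upto_differentiable: "smooth_upto k f \<Longrightarrow> f differentiable (at x)"
  by (cases k) (auto simp: smooth_upto_0 smooth_upto_Suc)

lemma smooth_upto_SucD: "smooth_upto (Suc k) f \<Longrightarrow> smooth_upto k f"
  by (auto simp: smooth_upto_def)

lemma smooth_differentiable: "smooth f \<Longrightarrow> f differentiable (at x)"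
  unfolding smooth_iff by (blast intro: smooth_upto_differentiable)

lemma smooth_dir_deriv: "smooth f \<Longrightarrow> smooth (dir_deriv v f)"
  unfolding smooth_iff using smooth_upto_Suc by blast

lemma smooth_iter_deriv: "smooth f \<Longrightarrow> smooth (iter_deriv vs f)"
  by (induction vs) (auto simp: iter_deriv_Cons intro: smooth_dir_deriv)

lemma smooth_continuous_on: "smooth f \<Longrightarrow> continuous_on S f"
  by (meson continuous_at_imp_continuous_on differentiable_imp_continuous_within smooth_differentiable)

lemma smooth_measurable [measurable_dest]:
  fixes f :: "'a::euclidean_space \<Rightarrow> real"
  shows "smooth f \<Longrightarrow> f \<in> borel_measurable borel"
  by (rule borel_measurable_continuous_onI) (rule smooth_continuous_on)

lemma dir_deriv_const [simp]: "dir_deriv v (\<lambda>x. c) = (\<lambda>x. 0)"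
  by (simp add: dir_deriv_def)

lemma smooth_const [simp]: "smooth (\<lambda>x::'a::real_normed_vector. c)"
proof -
  have "smooth_upto k (\<lambda>x::'a. c)" for k c
    by (induction k arbitrary: c) (auto simp: smooth_upto_0 smooth_upto_Suc)
  then show ?thesis by (simp add: smooth_iff)
qed

lemma dir_deriv_bounded_linear:
  assumes "bounded_linear l"
  shows "dir_deriv v l = (\<lambda>x. l v)"
  using dir_deriv_eq[OF bounded_linear_imp_has_derivative[OF assms]] by auto

lemma smooth_upto_const [simp]: "smooth_upto k (\<lambda>x. c)"
  using smooth_const smooth_iff by blast

lemma smooth_bounded_linear:
  assumes "bounded_linear l"
  shows "smooth l"
proof -
  have "smooth_upto k l" for k
    using assms smooth_const
    by (cases k) (auto simp: smooth_upto_0 smooth_upto_Suc dir_deriv_bounded_linear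
        bounded_linear_imp_differentiable smooth_iff)
  then show ?thesis by (simp add: smooth_iff)
qed

lemma dir_deriv_add:
  assumes "f differentiable (at x)" "g differentiable (at x)"
  shows "dir_deriv v (\<lambda>x. f x + g x) x = dir_deriv v f x + dir_deriv v g x"
  by (rule dir_deriv_eq[OF has_derivative_add[OF has_derivative_dir_deriv[OF assms(1)]
        has_derivative_dir_deriv[OF assms(2)]]])

lemma dir_deriv_mult:
  assumes "f differentiable (at x)" "g differentiable (at x)"
  shows "dir_deriv v (\<lambda>x. f x * g x) x = f x * dir_deriv v g x + dir_deriv v f x * g x"
  by (rule dir_deriv_eq[OF has_derivative_mult[OF has_derivative_dir_deriv[OF assms(1)]
        has_derivative_dir_deriv[OF assms(2)]]])

lemma smooth_upto_add:
  "smooth_upto k f \<Longrightarrow> smooth_upto k g \<Longrightarrow> smooth_upto k (\<lambda>x. f x + g x)"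
proof (induction k arbitrary: f g)
  case 0
  then show ?case by (auto simp: smooth_upto_0 intro: differentiable_add)
next
  case (Suc k)
  have "dir_deriv v (\<lambda>x. f x + g x) = (\<lambda>x. dir_deriv v f x + dir_deriv v g x)" for v
    using Suc.prems by (intro ext dir_deriv_add) (auto simp: smooth_upto_Suc)
  with Suc show ?case by (auto simp: smooth_upto_Suc)
qed

lemma smooth_add: "smooth f \<Longrightarrow> smooth g \<Longrightarrow> smooth (\<lambda>x. f x + g x)"
  by (simp add: smooth_iff smooth_upto_add)

lemma smooth_upto_mult:
  "smooth_upto k f \<Longrightarrow> smooth_upto k g \<Longrightarrow> smooth_upto k (\<lambda>x. f x * g x)"
proof (induction k arbitrary: f g)
  case 0
  then show ?case by (auto simp: smooth_upto_0 intro: differentiable_mult)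
next
  case (Suc k)
  have "dir_deriv v (\<lambda>x. f x * g x) = (\<lambda>x. f x * dir_deriv v g x + dir_deriv v f x * g x)" for v
    using Suc.prems by (intro ext dir_deriv_mult) (auto simp: smooth_upto_Suc)
  moreover have "smooth_upto k f" "smooth_upto k g"
    using Suc.prems by (simp_all add: smooth_upto_SucD)
  ultimately show ?case
    using Suc by (auto simp: smooth_upto_Suc intro!: smooth_upto_add differentiable_mult)
qed

lemma smooth_mult: "smooth f \<Longrightarrow> smooth g \<Longrightarrow> smooth (\<lambda>x. f x * g x)"
  by (simp add: smooth_iff smooth_upto_mult)

lemma smooth_cmult: "smooth f \<Longrightarrow> smooth (\<lambda>x. c * f x)"
  by (intro smooth_mult smooth_const)

lemma smooth_minus: "smooth f \<Longrightarrow> smooth (\<lambda>x. - f x)"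
  using smooth_cmult[of f "-1"] by simp

lemma smooth_diff: "smooth f \<Longrightarrow> smooth g \<Longrightarrow> smooth (\<lambda>x. f x - g x)"
  using smooth_add[OF _ smooth_minus, of f g] by simp

lemma smooth_sum: "(\<And>i. i \<in> I \<Longrightarrow> smooth (f i)) \<Longrightarrow> smooth (\<lambda>x. \<Sum>i\<in>I. f i x)"
  by (induction I rule: infinite_finite_induct) (auto intro: smooth_add)

lemma smooth_prod: "(\<And>i. i \<in> I \<Longrightarrow> smooth (f i)) \<Longrightarrow> smooth (\<lambda>x. \<Prod>i\<in>I. f i x)"
  by (induction I rule: infinite_finite_induct) (auto intro: smooth_mult)

lemma smooth_inner_right [simp]: "smooth (\<lambda>x. x \<bullet> i)"
  by (simp add: smooth_bounded_linear bounded_linear_inner_left)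

lemma dir_deriv_scale_direction:
  "f differentiable (at x) \<Longrightarrow> dir_deriv (c *\<^sub>R v) f x = c * dir_deriv v f x"
  and dir_deriv_add_direction:
  "f differentiable (at x) \<Longrightarrow> dir_deriv (v + w) f x = dir_deriv v f x + dir_deriv w f x"
  and dir_deriv_zero_direction:
  "f differentiable (at x) \<Longrightarrow> dir_deriv 0 f x = 0"
  by (auto dest!: linear_frechet_derivative simp: dir_deriv_def linear_cmul linear_add linear_0)

lemma dir_deriv_sum_direction:
  "f differentiable (at x) \<Longrightarrow> dir_deriv (\<Sum>i\<in>I. v i) f x = (\<Sum>i\<in>I. dir_deriv (v i) f x)"
  by (auto dest!: linear_frechet_derivative simp: dir_deriv_def linear_sum)

text \<open>For maps between Euclidean spaces smoothness is understood componentwise.\<close>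

lemma differentiable_componentwise_at:
  fixes X :: "'a::real_normed_vector \<Rightarrow> 'b::euclidean_space"
  assumes "\<And>i. i \<in> Basis \<Longrightarrow> (\<lambda>x. X x \<bullet> i) differentiable (at x)"
  shows "(X has_derivative (\<lambda>v. \<Sum>i\<in>Basis. dir_deriv v (\<lambda>x. X x \<bullet> i) x *\<^sub>R i)) (at x)"
proof -
  have "((\<lambda>x. \<Sum>i\<in>Basis. (X x \<bullet> i) *\<^sub>R i) has_derivative
      (\<lambda>v. \<Sum>i\<in>Basis. dir_deriv v (\<lambda>x. X x \<bullet> i) x *\<^sub>R i)) (at x)"
    by (intro has_derivative_sum has_derivative_scaleR_left has_derivative_dir_deriv assms)
  then show ?thesis by (simp add: euclidean_representation)
qed

lemma dir_deriv_compose: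
  fixes X :: "'a::real_normed_vector \<Rightarrow> 'b::euclidean_space" and g :: "'b \<Rightarrow> real"
  assumes "g differentiable (at (X x))" "\<And>i. i \<in> Basis \<Longrightarrow> (\<lambda>x. X x \<bullet> i) differentiable (at x)"
  shows "(\<lambda>x. g (X x)) differentiable (at x)"
    and "dir_deriv v (\<lambda>x. g (X x)) x = (\<Sum>i\<in>Basis. dir_deriv v (\<lambda>x. X x \<bullet> i) x * dir_deriv i g (X x))"
proof -
  note X = differentiable_componentwise_at[of X, OF assms(2)]
  have D: "((\<lambda>x. g (X x)) has_derivative
      (\<lambda>v. dir_deriv (\<Sum>i\<in>Basis. dir_deriv v (\<lambda>x. X x \<bullet> i) x *\<^sub>R i) g (X x))) (at x)"
    by (rule has_derivative_compose[OF X has_derivative_dir_deriv[OF assms(1)]])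
  then show "(\<lambda>x. g (X x)) differentiable (at x)" by (auto simp: differentiable_def)
  show "dir_deriv v (\<lambda>x. g (X x)) x = (\<Sum>i\<in>Basis. dir_deriv v (\<lambda>x. X x \<bullet> i) x * dir_deriv i g (X x))"
    using dir_deriv_eq[OF D] assms(1) by (simp add: dir_deriv_sum_direction dir_deriv_scale_direction)
qed

text \<open>Induction on the order with \<open>g\<close> arbitrary: by the chain rule a derivative
  of the composition is a sum of products of smooth factors with compositions of partial derivatives
  of \<open>g\<close> with the same inner map.\<close>

lemma smooth_compose:
  fixes X :: "'a::real_normed_vector \<Rightarrow> 'b::euclidean_space" and g :: "'b \<Rightarrow> real"
  assumes "smooth g" "\<And>i. i \<in> Basis \<Longrightarrow> smooth (\<lambda>x. X x \<bullet> i)"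
  shows "smooth (\<lambda>x. g (X x))"
proof -
  have "smooth_upto k (\<lambda>x. g (X x))" if "smooth g" for k and g :: "'b \<Rightarrow> real"
    using that
  proof (induction k arbitrary: g)
    case 0
    then show ?case
      using dir_deriv_compose(1)[of g X] assms(2) by (auto simp: smooth_upto_0 smooth_differentiable)
  next
    case (Suc k)
    have "dir_deriv v (\<lambda>x. g (X x)) =
        (\<lambda>x. \<Sum>i\<in>Basis. dir_deriv v (\<lambda>x. X x \<bullet> i) x * dir_deriv i g (X x))" for v
      using Suc.prems assms(2) by (intro ext dir_deriv_compose(2)) (auto simp: smooth_differentiable)
    moreover have "smooth_upto k (\<lambda>x. \<Sum>i\<in>I. dir_deriv v (\<lambda>x. X x \<bullet> i) x * dir_deriv i g (X x))"
      if "I \<subseteq> Basis" for I v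
      using finite_subset[OF that finite_Basis] that
    proof (induction I rule: finite_induct)
      case empty
      then show ?case using smooth_const[of 0] by (simp add: smooth_iff)
    next
      case (insert i I)
      have "smooth_upto k (\<lambda>x. dir_deriv v (\<lambda>x. X x \<bullet> i) x)"
        using insert.prems assms(2) smooth_dir_deriv[of "\<lambda>x. X x \<bullet> i" v] by (auto simp: smooth_iff)
      then have "smooth_upto k (\<lambda>x. dir_deriv v (\<lambda>x. X x \<bullet> i) x * dir_deriv i g (X x))"
        using Suc by (intro smooth_upto_mult) (auto simp: smooth_dir_deriv)
      then show ?case using insert by (auto intro: smooth_upto_add)
    qed
    ultimately show ?case
      using dir_deriv_compose(1)[of g X] assms(2) Suc.prems
      by (auto simp: smooth_upto_Suc smooth_differentiable)
  qed
  then show ?thesis using assms(1) by (auto simp: smooth_iff)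
qed

lemma smooth_compose_real:
  fixes g :: "real \<Rightarrow> real"
  shows "smooth g \<Longrightarrow> smooth f \<Longrightarrow> smooth (\<lambda>x. g (f x))"
  using smooth_compose[of g f] by simp

lemma smooth_fst: "smooth f \<Longrightarrow> smooth (\<lambda>p. f (fst p))"
  for f :: "'a::euclidean_space \<Rightarrow> real"
  by (rule smooth_compose) (auto intro: smooth_bounded_linear bounded_linear_compose[OF bounded_linear_inner_left bounded_linear_fst])

lemma smooth_snd: "smooth f \<Longrightarrow> smooth (\<lambda>p. f (snd p))"
  for f :: "'a::euclidean_space \<Rightarrow> real"
  by (rule smooth_compose) (auto intro: smooth_bounded_linear bounded_linear_compose[OF bounded_linear_inner_left bounded_linear_snd])

lemma dir_deriv_real:
  "(h has_real_derivative d) (at x) \<Longrightarrow> dir_deriv v h x = v * d"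
  unfolding has_field_derivative_def by (drule dir_deriv_eq[where v=v]) (simp add: mult.commute)

text \<open>If each derivative is a finite linear combination of members of the family, the order of
  differentiability rises for all members simultaneously. This yields \<open>exp\<close>,
  \<open>sin\<close>, \<open>cos\<close> and the bump functions.\<close>

lemma smooth_real_family:
  fixes h :: "'i \<Rightarrow> real \<Rightarrow> real"
  assumes "\<And>i. \<exists>js c. finite js \<and> (\<forall>x. (h i has_real_derivative (\<Sum>j\<in>js. c j * h j x)) (at x))"
  shows "smooth (h i)"
proof -
  have "smooth_upto k (h i)" for k i
  proof (induction k arbitrary: i)
    case 0
    show ?case using assms[of i] unfolding smooth_upto_0
      using differentiableI has_field_derivative_imp_has_derivative by blast
  next
    case (Suc k)
    obtain js c where js: "finite js" "\<And>x. (h i has_real_derivative (\<Sum>j\<in>js. c j * h j x)) (at x)"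
      using assms[of i] by blast
    have "h i differentiable (at x)" for x
      using js(2) differentiableI has_field_derivative_imp_has_derivative by blast
    moreover have "dir_deriv v (h i) = (\<lambda>x. v * (\<Sum>j\<in>js. c j * h j x))" for v
      using dir_deriv_real[OF js(2)] by blast
    moreover have "smooth_upto k (\<lambda>x. \<Sum>j\<in>js. c j * h j x)"
      using js(1)
    proof (induction js rule: finite_induct)
      case empty
      then show ?case using smooth_const[of 0] by (simp add: smooth_iff)
    next
      case (insert j js)
      have "smooth_upto k (\<lambda>x. c j * h j x)"
        using smooth_const Suc by (intro smooth_upto_mult) (auto simp: smooth_iff)
      with insert show ?case by (auto intro: smooth_upto_add)
    qed
    ultimately show ?case
      using smooth_const by (auto simp: smooth_upto_Suc smooth_iff intro!: smooth_upto_mult)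
  qed
  then show ?thesis by (simp add: smooth_iff)
qed

lemma smooth_exp [simp]: "smooth (exp :: real \<Rightarrow> real)"
proof (rule smooth_real_family[of "\<lambda>_::unit. exp"])
  show "\<exists>js c. finite js \<and> (\<forall>x. (exp has_real_derivative (\<Sum>j\<in>(js::unit set). c j * exp x)) (at x))"
    by (rule exI[of _ "{()}"], rule exI[of _ "\<lambda>_. 1"]) (auto intro: DERIV_exp)
qed

lemma smooth_sin_cos: "smooth (sin :: real \<Rightarrow> real)" "smooth (cos :: real \<Rightarrow> real)"
proof -
  have "smooth (if b then sin else cos :: real \<Rightarrow> real)" for b
  proof (rule smooth_real_family[of "\<lambda>b. if b then sin else cos"])
    fix b :: bool
    show "\<exists>js c. finite js \<and> (\<forall>x. ((if b then sin else cos) has_real_derivative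
        (\<Sum>j\<in>js. c j * (if j then sin else cos) x)) (at x))"
      \<comment> \<open>\<open>True\<close> stands for \<open>sin\<close>. Differentiation switches
        the index, and the sign is negative exactly when the result is \<open>sin\<close>.\<close>
      by (rule exI[of _ "{\<not> b}"], rule exI[of _ "\<lambda>j. if j then -1 else 1"])
         (auto intro!: derivative_eq_intros)
  qed
  from this[of True] this[of False]
  show "smooth (sin :: real \<Rightarrow> real)" "smooth (cos :: real \<Rightarrow> real)" by auto
qed

lemma has_derivative_along_line:
  assumes "f differentiable (at (x + s *\<^sub>R v))"
  shows "((\<lambda>s. f (x + s *\<^sub>R v)) has_real_derivative dir_deriv v f (x + s *\<^sub>R v)) (at s)"
proof -
  have "((\<lambda>s. x + s *\<^sub>R v) has_derivative (\<lambda>h. h *\<^sub>R v)) (at s)"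
    by (auto intro!: derivative_eq_intros)
  from has_derivative_compose[OF this has_derivative_dir_deriv[OF assms]]
  show ?thesis
    using assms by (simp add: has_field_derivative_def dir_deriv_scale_direction mult_commute_abs)
qed

text \<open>The bound on \<open>\<xi>\<close> serves limits in which \<open>h\<close> tends to
  \<open>0\<close> from both sides; the sign clause locates the intermediate points when the theorem
  is applied twice to a second difference.\<close>

lemma mean_value_along_line:
  assumes "smooth f"
  shows "\<exists>\<xi>. \<bar>\<xi>\<bar> \<le> \<bar>h\<bar> \<and> (0 \<le> h \<longrightarrow> 0 \<le> \<xi>) \<and> f (x + h *\<^sub>R v) - f x = h * dir_deriv v f (x + \<xi> *\<^sub>R v)"
proof -
  note D = has_derivative_along_line[OF smooth_differentiable[OF assms], where x=x and v=v]
  consider "h = 0" | "h > 0" | "h < 0" by linarith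
  then show ?thesis
  proof cases
    case 2
    from MVT2[OF 2 D] obtain z where "0 < z" "z < h"
      "f (x + h *\<^sub>R v) - f (x + 0 *\<^sub>R v) = (h - 0) * dir_deriv v f (x + z *\<^sub>R v)" by blast
    then show ?thesis by (intro exI[of _ z]) auto
  next
    case 3
    from MVT2[OF 3 D] obtain z where "h < z" "z < 0"
      "f (x + 0 *\<^sub>R v) - f (x + h *\<^sub>R v) = (0 - h) * dir_deriv v f (x + z *\<^sub>R v)" by blast
    then show ?thesis using 3 by (intro exI[of _ z]) (auto simp: algebra_simps)
  qed auto
qed

section \<open>Translations, symmetry of second derivatives, reflections and slices\<close>

lemma dir_deriv_translate:
  assumes "f differentiable (at (c + y))"
  shows "dir_deriv v (\<lambda>y. f (c + y)) y = dir_deriv v f (c + y)"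
proof -
  have "((\<lambda>y. c + y) has_derivative (\<lambda>h. h)) (at y)"
    by (auto intro!: derivative_eq_intros)
  from dir_deriv_eq[OF has_derivative_compose[OF this has_derivative_dir_deriv[OF assms]]]
  show ?thesis by simp
qed

lemma smooth_translate:
  fixes f :: "'a::euclidean_space \<Rightarrow> real"
  shows "smooth f \<Longrightarrow> smooth (\<lambda>y. f (c + y))"
  by (rule smooth_compose) (auto simp: inner_add_left intro!: smooth_add)

text \<open>The second difference of \<open>f\<close> over the parallelogram spanned by
  \<open>h v\<close> and \<open>h w\<close> is symmetric in \<open>v\<close> and \<open>w\<close>.
  Two applications of the mean value theorem, in either order of the directions, turn it into
  \<open>h * h\<close> times either mixed derivative at some point near \<open>x\<close>, and both
  mixed derivatives are continuous at \<open>x\<close>.\<close>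

lemma dir_deriv_commute:
  fixes f :: "'a::euclidean_space \<Rightarrow> real"
  assumes f: "smooth f"
  shows "dir_deriv v (dir_deriv w f) x = dir_deriv w (dir_deriv v f) x"
proof (rule ccontr)
  have second_difference: "\<exists>\<xi> \<eta>. 0 \<le> \<xi> \<and> \<xi> \<le> h \<and> 0 \<le> \<eta> \<and> \<eta> \<le> h \<and>
      f (x + h *\<^sub>R v + h *\<^sub>R w) - f (x + h *\<^sub>R v) - f (x + h *\<^sub>R w) + f x =
      h * h * dir_deriv w (dir_deriv v f) (x + \<xi> *\<^sub>R v + \<eta> *\<^sub>R w)" if h0: "h \<ge> 0" for h v w
  proof -
    define \<phi> where "\<phi> = (\<lambda>y. f (h *\<^sub>R w + y) - f y)"
    have \<phi>: "smooth \<phi>" unfolding \<phi>_def using f by (intro smooth_diff smooth_translate)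
    obtain \<xi> where \<xi>: "0 \<le> \<xi>" "\<xi> \<le> h" "\<phi> (x + h *\<^sub>R v) - \<phi> x = h * dir_deriv v \<phi> (x + \<xi> *\<^sub>R v)"
      using mean_value_along_line[OF \<phi>, of h x v] h0 by fastforce
    have "dir_deriv v \<phi> (x + \<xi> *\<^sub>R v) = dir_deriv v f (x + \<xi> *\<^sub>R v + h *\<^sub>R w) - dir_deriv v f (x + \<xi> *\<^sub>R v)"
      using dir_deriv_add[OF smooth_differentiable[OF smooth_translate[OF f]] smooth_differentiable[OF smooth_minus[OF f]],
          of v "h *\<^sub>R w" "x + \<xi> *\<^sub>R v"]
        dir_deriv_translate[OF smooth_differentiable[OF f], of v "h *\<^sub>R w" "x + \<xi> *\<^sub>R v"]
        dir_deriv_mult[of "\<lambda>_. -1" "x + \<xi> *\<^sub>R v" f v] smooth_differentiable[OF f]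
      unfolding \<phi>_def by (simp add: add_ac)
    moreover obtain \<eta> where \<eta>: "0 \<le> \<eta>" "\<eta> \<le> h"
      "dir_deriv v f (x + \<xi> *\<^sub>R v + h *\<^sub>R w) - dir_deriv v f (x + \<xi> *\<^sub>R v) =
        h * dir_deriv w (dir_deriv v f) (x + \<xi> *\<^sub>R v + \<eta> *\<^sub>R w)"
      using mean_value_along_line[OF smooth_dir_deriv[OF f], of h v "x + \<xi> *\<^sub>R v" w] h0
      by fastforce
    ultimately have "\<phi> (x + h *\<^sub>R v) - \<phi> x = h * (h * dir_deriv w (dir_deriv v f) (x + \<xi> *\<^sub>R v + \<eta> *\<^sub>R w))"
      using \<xi> by simp
    then show ?thesis using \<xi> \<eta>
      by (intro exI[of _ \<xi>] exI[of _ \<eta>]) (auto simp: \<phi>_def algebra_simps)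
  qed
  define a b where "a = dir_deriv v (dir_deriv w f) x" and "b = dir_deriv w (dir_deriv v f) x"
  assume "dir_deriv v (dir_deriv w f) x \<noteq> dir_deriv w (dir_deriv v f) x"
  then have e: "\<bar>a - b\<bar> / 2 > 0" by (simp add: a_def b_def)
  have cont: "continuous (at x) (dir_deriv v (dir_deriv w f))" for v w
    using smooth_differentiable[OF smooth_dir_deriv[OF smooth_dir_deriv[OF f]]]
      differentiable_imp_continuous_within by blast
  obtain d1 where d1: "d1 > 0" "\<And>y. dist y x < d1 \<Longrightarrow> \<bar>dir_deriv v (dir_deriv w f) y - a\<bar> < \<bar>a - b\<bar> / 2"
    using cont[of v w] e unfolding continuous_at_eps_delta a_def dist_real_def by meson
  obtain d2 where d2: "d2 > 0" "\<And>y. dist y x < d2 \<Longrightarrow> \<bar>dir_deriv w (dir_deriv v f) y - b\<bar> < \<bar>a - b\<bar> / 2"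
    using cont[of w v] e unfolding continuous_at_eps_delta b_def dist_real_def by meson
  \<comment> \<open>With this size the whole parallelogram lies within \<open>min d1 d2\<close> of
    \<open>x\<close>; adding \<open>1\<close> keeps the denominator positive when both directions
    vanish.\<close>
  define h where "h = min d1 d2 / (2 * (norm v + norm w + 1))"
  have den: "2 * (norm v + norm w + 1) > 0" by (smt (verit) norm_ge_zero)
  have h: "h > 0" unfolding h_def by (intro divide_pos_pos den) (use d1 d2 in auto)
  have small: "dist (x + \<xi> *\<^sub>R v' + \<eta> *\<^sub>R w') x < min d1 d2"
    if "0 \<le> \<xi>" "\<xi> \<le> h" "0 \<le> \<eta>" "\<eta> \<le> h" "norm v' + norm w' = norm v + norm w" for \<xi> \<eta> and v' w' :: 'a
  proof -
    have "dist (x + \<xi> *\<^sub>R v' + \<eta> *\<^sub>R w') x \<le> \<xi> * norm v' + \<eta> * norm w'"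
      using norm_triangle_ineq[of "\<xi> *\<^sub>R v'" "\<eta> *\<^sub>R w'"] that by (simp add: dist_norm add.assoc)
    also have "\<dots> \<le> h * norm v' + h * norm w'"
      using that by (intro add_mono mult_right_mono) auto
    also have "\<dots> = h * (norm v + norm w)"
      using that by (simp add: distrib_left[symmetric])
    also have "\<dots> < h * (2 * (norm v + norm w + 1))"
      using h by (intro mult_strict_left_mono) (auto, smt (verit) norm_ge_zero)
    also have "\<dots> = min d1 d2" using den by (simp add: h_def)
    finally show ?thesis .
  qed
  obtain \<xi> \<eta> where 1: "0 \<le> \<xi>" "\<xi> \<le> h" "0 \<le> \<eta>" "\<eta> \<le> h"
      "f (x + h *\<^sub>R v + h *\<^sub>R w) - f (x + h *\<^sub>R v) - f (x + h *\<^sub>R w) + f x =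
      h * h * dir_deriv w (dir_deriv v f) (x + \<xi> *\<^sub>R v + \<eta> *\<^sub>R w)"
    using second_difference[of h v w] h by auto
  obtain \<xi>' \<eta>' where 2: "0 \<le> \<xi>'" "\<xi>' \<le> h" "0 \<le> \<eta>'" "\<eta>' \<le> h"
      "f (x + h *\<^sub>R w + h *\<^sub>R v) - f (x + h *\<^sub>R w) - f (x + h *\<^sub>R v) + f x =
      h * h * dir_deriv v (dir_deriv w f) (x + \<xi>' *\<^sub>R w + \<eta>' *\<^sub>R v)"
    using second_difference[of h w v] h by auto
  have "h * h * dir_deriv w (dir_deriv v f) (x + \<xi> *\<^sub>R v + \<eta> *\<^sub>R w) =
      h * h * dir_deriv v (dir_deriv w f) (x + \<xi>' *\<^sub>R w + \<eta>' *\<^sub>R v)"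
  proof -
    have eq: "x + h *\<^sub>R w + h *\<^sub>R v = x + h *\<^sub>R v + h *\<^sub>R w" by simp
    from 2(5) have "f (x + h *\<^sub>R v + h *\<^sub>R w) - f (x + h *\<^sub>R w) - f (x + h *\<^sub>R v) + f x =
      h * h * dir_deriv v (dir_deriv w f) (x + \<xi>' *\<^sub>R w + \<eta>' *\<^sub>R v)" by (simp only: eq)
    with 1(5) show ?thesis by linarith
  qed
  then have "dir_deriv w (dir_deriv v f) (x + \<xi> *\<^sub>R v + \<eta> *\<^sub>R w) =
      dir_deriv v (dir_deriv w f) (x + \<xi>' *\<^sub>R w + \<eta>' *\<^sub>R v)" using h by simp
  then show False
    using d1(2)[of "x + \<xi>' *\<^sub>R w + \<eta>' *\<^sub>R v"] d2(2)[of "x + \<xi> *\<^sub>R v + \<eta> *\<^sub>R w"]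
      small[OF 1(1-4), of v w] small[OF 2(1-4), of w v] by (auto simp: abs_if split: if_splits)
qed

lemma iter_deriv_dir_deriv_commute:
  fixes f :: "'a::euclidean_space \<Rightarrow> real"
  assumes "smooth f"
  shows "iter_deriv vs (dir_deriv v f) = dir_deriv v (iter_deriv vs f)"
proof (induction vs)
  case (Cons w vs)
  then show ?case
    using dir_deriv_commute[OF smooth_iter_deriv[OF assms, of vs], of w v]
    by (auto simp: iter_deriv_Cons)
qed simp

lemma iter_deriv_add:
  "smooth f \<Longrightarrow> smooth g \<Longrightarrow> iter_deriv vs (\<lambda>x. f x + g x) = (\<lambda>x. iter_deriv vs f x + iter_deriv vs g x)"
  by (induction vs) (auto simp: iter_deriv_Cons intro!: dir_deriv_add smooth_differentiable smooth_iter_deriv)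

lemma iter_deriv_cmult:
  "smooth f \<Longrightarrow> iter_deriv vs (\<lambda>x. c * f x) = (\<lambda>x. c * iter_deriv vs f x)"
proof (induction vs)
  case (Cons v vs)
  then show ?case
    using dir_deriv_mult[of "\<lambda>_. c" _ "iter_deriv vs f" v] smooth_differentiable[OF smooth_iter_deriv[of f vs]]
    by (auto simp: iter_deriv_Cons)
qed simp

lemma iter_deriv_diff:
  "smooth f \<Longrightarrow> smooth g \<Longrightarrow> iter_deriv vs (\<lambda>x. f x - g x) = (\<lambda>x. iter_deriv vs f x - iter_deriv vs g x)"
  using iter_deriv_add[of f "\<lambda>x. (-1) * g x" vs] iter_deriv_cmult[of g vs "-1"] smooth_cmult[of g "-1"] by simp

lemma iter_deriv_sum:
  "(\<And>i. i \<in> I \<Longrightarrow> smooth (f i)) \<Longrightarrow> iter_deriv vs (\<lambda>x. \<Sum>i\<in>I. f i x) = (\<lambda>x. \<Sum>i\<in>I. iter_deriv vs (f i) x)"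
proof (induction I rule: infinite_finite_induct)
  case (insert i I)
  then show ?case by (simp add: iter_deriv_add smooth_sum)
qed (use iter_deriv_cmult[of "\<lambda>x. 0" vs 0] in auto)

lemma smooth_reflect:
  fixes f :: "'a::euclidean_space \<Rightarrow> real"
  shows "smooth f \<Longrightarrow> smooth (\<lambda>y. f (x - y))"
  by (rule smooth_compose) (auto simp: inner_diff_left intro!: smooth_diff)

lemma dir_deriv_reflect:
  assumes "f differentiable (at (x - y))"
  shows "dir_deriv v (\<lambda>y. f (x - y)) y = - dir_deriv v f (x - y)"
proof -
  have "((\<lambda>y. x - y) has_derivative (\<lambda>h. - h)) (at y)"
    by (auto intro!: derivative_eq_intros)
  from dir_deriv_eq[OF has_derivative_compose[OF this has_derivative_dir_deriv[OF assms]]]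
  show ?thesis using dir_deriv_scale_direction[OF assms, of "-1" v] by simp
qed

lemma iter_deriv_reflect:
  fixes f :: "'a::euclidean_space \<Rightarrow> real"
  assumes "smooth f"
  shows "iter_deriv vs (\<lambda>y. f (x - y)) = (\<lambda>y. (-1) ^ length vs * iter_deriv vs f (x - y))"
proof (induction vs)
  case (Cons v vs)
  have "dir_deriv v (\<lambda>y. (-1) ^ length vs * iter_deriv vs f (x - y)) y =
      (-1) ^ length vs * dir_deriv v (\<lambda>y. iter_deriv vs f (x - y)) y" for y
    using dir_deriv_mult[of "\<lambda>_. (-1) ^ length vs" y "\<lambda>y. iter_deriv vs f (x - y)" v]
      smooth_differentiable[OF smooth_reflect[OF smooth_iter_deriv[OF assms]]] by simp
  then show ?case
    using Cons dir_deriv_reflect[OF smooth_differentiable[OF smooth_iter_deriv[OF assms]]]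
    by (auto simp: iter_deriv_Cons)
qed simp

text \<open>Parameters are treated as a factor of a product space. Derivatives of a slice are then
  derivatives of \<open>F\<close> in directions \<open>(0, v)\<close>, which commute with those in
  the parameter.\<close>

lemma dir_deriv_slice:
  fixes F :: "'p::euclidean_space \<times> 'a::euclidean_space \<Rightarrow> real"
  assumes "F differentiable (at (p, y))"
  shows "dir_deriv v (\<lambda>y. F (p, y)) y = dir_deriv (0, v) F (p, y)"
proof -
  have "((\<lambda>y. (p, y)) has_derivative (\<lambda>h. (0, h))) (at y)"
    by (auto intro!: derivative_eq_intros)
  from dir_deriv_eq[OF has_derivative_compose[OF this has_derivative_dir_deriv[OF assms]]]
  show ?thesis by simp
qed

lemma smooth_slice:
  fixes F :: "'p::euclidean_space \<times> 'a::euclidean_space \<Rightarrow> real"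
  shows "smooth F \<Longrightarrow> smooth (\<lambda>y. F (p, y))"
  by (rule smooth_compose) (auto simp: Basis_prod_def)

lemma iter_deriv_slice:
  fixes F :: "'p::euclidean_space \<times> 'a::euclidean_space \<Rightarrow> real"
  assumes "smooth F"
  shows "iter_deriv vs (\<lambda>y. F (p, y)) = (\<lambda>y. iter_deriv (map (Pair 0) vs) F (p, y))"
  by (induction vs)
     (auto simp: iter_deriv_Cons dir_deriv_slice[OF smooth_differentiable[OF smooth_iter_deriv[OF assms]]])

subsection \<open>The bump functions\<close>

text \<open>Up to linear combinations, this family is closed under differentiation.\<close>

definition bump :: "nat \<Rightarrow> real \<Rightarrow> real" where
  "bump n t = (if t > 0 then exp (- inverse t) * inverse t ^ n else 0)"

lemma bump_nonneg [simp]: "0 \<le> bump n t"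
  by (simp add: bump_def)

lemma bump_pos: "0 < t \<Longrightarrow> 0 < bump n t"
  by (simp add: bump_def)

lemma bump_eq_0 [simp]: "t \<le> 0 \<Longrightarrow> bump n t = 0"
  by (simp add: bump_def)

lemma bump_le_1: "bump 0 t \<le> 1"
  by (simp add: bump_def)

text \<open>With \<open>u = 1 / t\<close> and \<open>m = n + 2\<close>, the inequality
  \<open>(1 + u / m) ^ m \<le> exp u\<close> bounds \<open>exp (- u) * u ^ n\<close> by a multiple
  of \<open>1 / u ^ 2\<close>. A quadratic bound makes the difference quotient at \<open>0\<close>
  tend to \<open>0\<close>.\<close>

lemma bump_le_square: "bump n t \<le> real (n + 2) ^ (n + 2) * t\<^sup>2"
proof (cases "t > 0")
  case True
  define m where "m = n + 2"
  define u where "u = inverse t"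
  have u: "u > 0" "t = inverse u" using True by (auto simp: u_def)
  have m: "real m > 0" by (simp add: m_def)
  have "(u / m) ^ m \<le> (1 + u / real m) ^ m"
    using u m by (intro power_mono) auto
  also have "\<dots> \<le> exp u"
    using u m by (intro exp_ge_one_plus_x_over_n_power_n) (auto simp: m_def)
  finally have "inverse (exp u) \<le> inverse ((u / m) ^ m)"
    using u m by (intro le_imp_inverse_le) auto
  then have "exp (- u) * u ^ n \<le> inverse ((u / m) ^ m) * u ^ n"
    using u by (intro mult_right_mono) (auto simp: exp_minus)
  also have "\<dots> = real m ^ m * t\<^sup>2"
  proof -
    have "inverse ((u / m) ^ m) * u ^ n = real m ^ m * (inverse u)\<^sup>2"
      using u m by (simp add: m_def power_divide power_add divide_simps power2_eq_square)
    then show ?thesis using u by simp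
  qed
  finally show ?thesis using True by (simp add: bump_def u_def m_def)
qed simp

text \<open>For positive \<open>t\<close> the derivative \<open>- 1 / t ^ 2\<close> of
  \<open>inverse\<close> raises the exponent: by two from the exponential factor, by one from the
  power. In particular \<open>bump 2\<close> is the derivative of \<open>bump 0\<close>, on which
  the choice of the mollifier rests.\<close>

lemma bump_has_derivative: "(bump n has_real_derivative (bump (n + 2) t - n * bump (n + 1) t)) (at t)"
proof -
  consider "t > 0" | "t < 0" | "t = 0" by linarith
  then show ?thesis
  proof cases
    case 1
    define u where "u = inverse t"
    have "((\<lambda>u. exp (- u) * u ^ n) has_real_derivative (exp (- u) * (n * u ^ (n - 1)) - exp (- u) * u ^ n)) (at u)"
      by (auto intro!: derivative_eq_intros simp: algebra_simps)
    moreover have "(inverse has_real_derivative - (u\<^sup>2)) (at t)"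
      using DERIV_inverse[of t UNIV] 1 by (simp add: u_def power2_eq_square)
    ultimately have "((\<lambda>t. exp (- inverse t) * inverse t ^ n) has_real_derivative
        (exp (- u) * (n * u ^ (n - 1)) - exp (- u) * u ^ n) * - (u\<^sup>2)) (at t)"
      unfolding u_def by (rule DERIV_chain2)
    also have "(exp (- u) * (n * u ^ (n - 1)) - exp (- u) * u ^ n) * - (u\<^sup>2) = bump (n + 2) t - n * bump (n + 1) t"
      using 1 by (cases n) (simp_all add: bump_def u_def[symmetric] power2_eq_square algebra_simps)
    finally have "((\<lambda>t. exp (- inverse t) * inverse t ^ n) has_real_derivative (bump (n + 2) t - n * bump (n + 1) t)) (at t)" .
    then show ?thesis
      by (rule has_field_derivative_transform_within_open[of _ _ _ "{0<..}"]) (use 1 in \<open>auto simp: bump_def\<close>)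
  next
    case 2
    have "((\<lambda>t. 0) has_real_derivative (bump (n + 2) t - n * bump (n + 1) t)) (at t)"
      using 2 by (auto intro!: derivative_eq_intros)
    then show ?thesis
      by (rule has_field_derivative_transform_within_open[of _ _ _ "{..<0}"]) (use 2 in \<open>auto simp: bump_def\<close>)
  next
    case 3
    have "((\<lambda>h. bump n h / h) \<longlongrightarrow> 0) (at 0)"
    proof (rule Lim_null_comparison)
      show "\<forall>\<^sub>F h in at 0. norm (bump n h / h) \<le> real (n + 2) ^ (n + 2) * \<bar>h\<bar>"
      proof (rule always_eventually, rule allI)
        fix h :: real
        have "bump n h \<le> real (n + 2) ^ (n + 2) * \<bar>h\<bar> * \<bar>h\<bar>"
          using bump_le_square[of n h] by (simp only: power2_eq_square mult.assoc abs_mult_self_eq)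
        then show "norm (bump n h / h) \<le> real (n + 2) ^ (n + 2) * \<bar>h\<bar>"
          by (cases "h = 0") (auto simp: pos_divide_le_eq)
      qed
      show "((\<lambda>h. real (n + 2) ^ (n + 2) * \<bar>h\<bar>) \<longlongrightarrow> 0) (at 0)"
        by (auto intro!: tendsto_eq_intros)
    qed
    then show ?thesis using 3 by (simp add: has_field_derivative_iff)
  qed
qed

lemma smooth_bump [simp]: "smooth (bump n)"
proof (rule smooth_real_family[of bump])
  fix n
  show "\<exists>js c. finite js \<and> (\<forall>x. (bump n has_real_derivative (\<Sum>j\<in>js. c j * bump j x)) (at x))"
    by (rule exI[of _ "{n+1, n+2}"], rule exI[of _ "\<lambda>j. if j = n+1 then - real n else 1"])
       (use bump_has_derivative[of n] in \<open>auto simp: algebra_simps\<close>)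
qed

lemma bump_lim_1: "0 < t \<Longrightarrow> (\<lambda>k. bump 0 (real k * t)) \<longlonglongrightarrow> 1"
proof -
  assume t: "0 < t"
  have "(\<lambda>k. exp (- inverse t * inverse (real k))) \<longlonglongrightarrow> exp (- inverse t * 0)"
    by (intro tendsto_intros lim_inverse_n)
  then have "(\<lambda>k. exp (- inverse t * inverse (real k))) \<longlonglongrightarrow> 1" by simp
  moreover have "\<forall>\<^sub>F k in sequentially. exp (- inverse t * inverse (real k)) = bump 0 (real k * t)"
    using eventually_gt_at_top[of 0] by eventually_elim (use t in \<open>auto simp: bump_def mult.commute\<close>)
  ultimately show ?thesis by (rule Lim_transform_eventually)
qed

subsection \<open>Test functions and distributions\<close>

lemma not_in_supp: "x \<notin> supp f \<Longrightarrow> f x = 0"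
  using closure_subset[of "{x. f x \<noteq> 0}"] unfolding supp_def by auto

lemma closed_supp [simp]: "closed (supp f)"
  unfolding supp_def by (rule closed_closure)

lemma supp_subsetI: "closed K \<Longrightarrow> (\<And>x. f x \<noteq> 0 \<Longrightarrow> x \<in> K) \<Longrightarrow> supp f \<subseteq> K"
  unfolding supp_def by (rule closure_minimal) auto

lemma supp_dir_deriv: "supp (dir_deriv v f) \<subseteq> supp f"
proof (rule supp_subsetI)
  show "closed (supp f)" by simp
  fix x assume "dir_deriv v f x \<noteq> 0"
  show "x \<in> supp f"
  proof (rule ccontr)
    assume x: "x \<notin> supp f"
    have "(f has_derivative (\<lambda>_. 0)) (at x)"
      by (rule has_derivative_transform_within_open[of "\<lambda>_. 0" _ _ _ "- supp f"])
         (use x in \<open>auto simp: not_in_supp[of _ f] open_Compl\<close>)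
    then show False using dir_deriv_eq \<open>dir_deriv v f x \<noteq> 0\<close> by fastforce
  qed
qed

lemma supp_iter_deriv: "supp (iter_deriv vs f) \<subseteq> supp f"
proof (induction vs)
  case (Cons v vs)
  then show ?case using supp_dir_deriv[of v "iter_deriv vs f"] by (auto simp: iter_deriv_Cons)
qed simp

lemma test_functionsI:
  assumes "smooth f" "compact K" "K \<subseteq> U" "\<And>x. f x \<noteq> 0 \<Longrightarrow> x \<in> K"
  shows "f \<in> test_functions U" "supp f \<subseteq> K"
proof -
  show *: "supp f \<subseteq> K" by (rule supp_subsetI) (use assms in \<open>auto simp: compact_imp_closed\<close>)
  then have "compact (supp f)"
    using assms(2) by (metis closed_closure compact_Int_closed inf.absorb_iff2 supp_def)
  with * assms show "f \<in> test_functions U" by (auto simp: test_functions_def)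
qed

lemma test_functionsD:
  assumes "f \<in> test_functions U"
  shows "smooth f" "compact (supp f)" "supp f \<subseteq> U"
  using assms by (auto simp: test_functions_def)

lemma test_functions_add:
  assumes "f \<in> test_functions U" "g \<in> test_functions U"
  shows "(\<lambda>x. f x + g x) \<in> test_functions U"
proof (rule test_functionsI)
  show "x \<in> supp f \<union> supp g" if "f x + g x \<noteq> 0" for x
    using that not_in_supp[of x f] not_in_supp[of x g] by (cases "x \<in> supp f") auto
qed (use assms in \<open>auto simp: test_functions_def intro: smooth_add\<close>)

lemma test_functions_cmult:
  assumes "f \<in> test_functions U"
  shows "(\<lambda>x. c * f x) \<in> test_functions U"
proof (rule test_functionsI)
  show "x \<in> supp f" if "c * f x \<noteq> 0" for x
    using that not_in_supp[of x f] by (cases "x \<in> supp f") auto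
qed (use assms in \<open>auto simp: test_functions_def intro: smooth_cmult\<close>)

lemma test_functions_diff:
  "f \<in> test_functions U \<Longrightarrow> g \<in> test_functions U \<Longrightarrow> (\<lambda>x. f x - g x) \<in> test_functions U"
  using test_functions_add[OF _ test_functions_cmult[of g U "-1"], of f] by simp

lemma test_functions_zero: "(\<lambda>x. 0) \<in> test_functions U"
  by (rule test_functionsI[of _ "{}"]) auto

lemma test_functions_sum:
  "(\<And>i. i \<in> I \<Longrightarrow> f i \<in> test_functions U) \<Longrightarrow> (\<lambda>x. \<Sum>i\<in>I. f i x) \<in> test_functions U"
  by (induction I rule: infinite_finite_induct) (auto intro: test_functions_add test_functions_zero)

lemma test_functions_dir_deriv: "f \<in> test_functions U \<Longrightarrow> dir_deriv v f \<in> test_functions U"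
  using supp_dir_deriv[of v f] not_in_supp[of _ "dir_deriv v f"]
  by (intro test_functionsI(1)[of _ "supp f"]) (auto simp: test_functions_def intro: smooth_dir_deriv)

lemma test_functions_bounded:
  assumes "f \<in> test_functions U"
  shows "\<exists>B>0. \<forall>x. \<bar>f x\<bar> \<le> B"
proof -
  have "compact (f ` supp f)"
    using assms by (intro compact_continuous_image) (auto simp: test_functions_def smooth_continuous_on)
  then have "bounded (f ` supp f)" by (rule compact_imp_bounded)
  then obtain B where B: "B > 0" "\<And>x. x \<in> supp f \<Longrightarrow> norm (f x) \<le> B"
    unfolding bounded_pos by blast
  have "\<bar>f x\<bar> \<le> B" for x
    using B not_in_supp[of x f] by (cases "x \<in> supp f") auto
  with B(1) show ?thesis by blast
qed

lemma Ck_norm_le: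
  fixes \<phi> :: "'a::euclidean_space \<Rightarrow> real"
  assumes "\<And>vs x. set vs \<subseteq> Basis \<Longrightarrow> length vs \<le> N \<Longrightarrow> \<bar>iter_deriv vs \<phi> x\<bar> \<le> M"
  shows "Ck_norm N \<phi> \<le> real (card {vs :: 'a list. set vs \<subseteq> Basis \<and> length vs \<le> N}) * M"
proof -
  have "Ck_norm N \<phi> \<le> (\<Sum>vs :: 'a list | set vs \<subseteq> Basis \<and> length vs \<le> N. M)"
    unfolding Ck_norm_def
  proof (rule sum_mono)
    fix vs :: "'a list" assume "vs \<in> {vs. set vs \<subseteq> Basis \<and> length vs \<le> N}"
    then show "(SUP x. \<bar>iter_deriv vs \<phi> x\<bar>) \<le> M" using assms by (intro cSUP_least) auto
  qed
  then show ?thesis by simp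
qed

text \<open>Derivatives of test functions are bounded, so each supremum is a genuine one and
  dominates the value of the absolute derivative at \<open>0\<close>.\<close>

lemma Ck_norm_nonneg:
  assumes "\<phi> \<in> test_functions U"
  shows "0 \<le> Ck_norm N \<phi>"
  unfolding Ck_norm_def
proof (rule sum_nonneg)
  fix vs :: "'a list"
  have "iter_deriv vs \<phi> \<in> test_functions U"
    using assms by (induction vs) (auto simp: iter_deriv_Cons test_functions_dir_deriv)
  then obtain B where "\<forall>x. \<bar>iter_deriv vs \<phi> x\<bar> \<le> B" using test_functions_bounded by blast
  then have "\<bar>iter_deriv vs \<phi> 0\<bar> \<le> (SUP x. \<bar>iter_deriv vs \<phi> x\<bar>)"
    by (intro cSUP_upper) (auto intro!: bdd_aboveI[of _ B])
  then show "0 \<le> (SUP x. \<bar>iter_deriv vs \<phi> x\<bar>)" by linarith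
qed

section \<open>Linearity, continuity and parameter dependence of distributions\<close>

lemma distribution_linear:
  assumes "T \<in> distributions U"
  shows "\<phi> \<in> test_functions U \<Longrightarrow> \<eta> \<in> test_functions U \<Longrightarrow> T (\<lambda>x. \<phi> x + \<eta> x) = T \<phi> + T \<eta>"
    and "\<phi> \<in> test_functions U \<Longrightarrow> T (\<lambda>x. c * \<phi> x) = c * T \<phi>"
    and "\<phi> \<in> test_functions U \<Longrightarrow> \<eta> \<in> test_functions U \<Longrightarrow> T (\<lambda>x. \<phi> x - \<eta> x) = T \<phi> - T \<eta>"
    and "(\<And>i. i \<in> I \<Longrightarrow> f i \<in> test_functions U) \<Longrightarrow> T (\<lambda>x. \<Sum>i\<in>I. f i x) = (\<Sum>i\<in>I. T (f i))"
proof -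
  show add: "T (\<lambda>x. \<phi> x + \<eta> x) = T \<phi> + T \<eta>" if "\<phi> \<in> test_functions U" "\<eta> \<in> test_functions U" for \<phi> \<eta>
    using assms that unfolding distributions_def by blast
  show cmult: "T (\<lambda>x. c * \<phi> x) = c * T \<phi>" if "\<phi> \<in> test_functions U" for c \<phi>
    using assms that unfolding distributions_def by blast
  show "T (\<lambda>x. \<phi> x - \<eta> x) = T \<phi> - T \<eta>" if "\<phi> \<in> test_functions U" "\<eta> \<in> test_functions U" for \<phi> \<eta>
    using add[OF that(1) test_functions_cmult[OF that(2), of "-1"]] cmult[OF that(2), of "-1"] by simp
  have zero: "T (\<lambda>x. 0) = 0" using cmult[OF test_functions_zero, of 0] by simp
  show "T (\<lambda>x. \<Sum>i\<in>I. f i x) = (\<Sum>i\<in>I. T (f i))" if "\<And>i. i \<in> I \<Longrightarrow> f i \<in> test_functions U" for I :: "'i set" and f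
    using that
  proof (induction I rule: infinite_finite_induct)
    case (insert i I)
    then show ?case using add[of "f i" "\<lambda>x. \<Sum>i\<in>I. f i x"] by (simp add: test_functions_sum)
  qed (simp_all add: zero)
qed

lemma finite_Basis_lists: "finite {vs :: 'a::euclidean_space list. set vs \<subseteq> Basis \<and> length vs \<le> N}"
  using finite_lists_length_le[OF finite_Basis] .

text \<open>The continuity estimate without suprema: a uniform bound on finitely many derivatives
  suffices. \<open>C\<close> is made positive because later error bounds divide by it.\<close>

lemma distribution_bound:
  fixes U :: "'a::euclidean_space set"
  assumes T: "T \<in> distributions U" and "compact K" "K \<subseteq> U"
  shows "\<exists>C>0. \<exists>L :: 'a list set. finite L \<and> (\<forall>\<phi>\<in>test_functions U. \<forall>M. supp \<phi> \<subseteq> K \<longrightarrow>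
           (\<forall>vs\<in>L. \<forall>x. \<bar>iter_deriv vs \<phi> x\<bar> \<le> M) \<longrightarrow> \<bar>T \<phi>\<bar> \<le> C * M)"
proof -
  have "\<forall>K. compact K \<and> K \<subseteq> U \<longrightarrow>
      (\<exists>C N. \<forall>\<phi>\<in>test_functions U. supp \<phi> \<subseteq> K \<longrightarrow> \<bar>T \<phi>\<bar> \<le> C * Ck_norm N \<phi>)"
    using T[unfolded distributions_def mem_Collect_eq] by (elim conjE)
  with assms(2,3) obtain C N where
    C: "\<And>\<phi>. \<phi> \<in> test_functions U \<Longrightarrow> supp \<phi> \<subseteq> K \<Longrightarrow> \<bar>T \<phi>\<bar> \<le> C * Ck_norm N \<phi>"
    by meson
  define L where "L = {vs :: 'a list. set vs \<subseteq> Basis \<and> length vs \<le> N}"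
  have L: "finite L" "[] \<in> L" using finite_Basis_lists[of N] by (auto simp: L_def)
  show ?thesis
  proof (intro exI[of _ "(\<bar>C\<bar> + 1) * real (card L)"] conjI exI[of _ L] ballI allI impI)
    have "card L > 0" using L card_gt_0_iff by blast
    then show "0 < (\<bar>C\<bar> + 1) * real (card L)" by (intro mult_pos_pos) auto
  next
    fix \<phi> M assume \<phi>: "\<phi> \<in> test_functions U" "supp \<phi> \<subseteq> K" "\<forall>vs\<in>L. \<forall>x. \<bar>iter_deriv vs \<phi> x\<bar> \<le> M"
    have le: "Ck_norm N \<phi> \<le> real (card L) * M" unfolding L_def by (rule Ck_norm_le) (use \<phi>(3) L_def in blast)
    have "\<bar>T \<phi>\<bar> \<le> C * Ck_norm N \<phi>" using C \<phi> by blast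
    also have "\<dots> \<le> (\<bar>C\<bar> + 1) * Ck_norm N \<phi>" using Ck_norm_nonneg[OF \<phi>(1)] by (intro mult_right_mono) auto
    also have "\<dots> \<le> (\<bar>C\<bar> + 1) * (real (card L) * M)" using le by (intro mult_left_mono) auto
    finally show "\<bar>T \<phi>\<bar> \<le> (\<bar>C\<bar> + 1) * real (card L) * M" by (simp add: mult.assoc)
  qed (use L in auto)
qed

text \<open>Uniform convergence of every derivative need be checked on \<open>K\<close> only, as
  outside \<open>K\<close> all derivatives vanish. An arbitrary filter covers limits in a parameter
  and limits of difference quotients alike.\<close>

lemma distribution_tendsto:
  fixes U :: "'a::euclidean_space set"
  assumes T: "T \<in> distributions U" and K: "compact K" "K \<subseteq> U"
    and \<phi>: "\<phi> \<in> test_functions U" "supp \<phi> \<subseteq> K"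
    and f: "\<forall>\<^sub>F i in F. f i \<in> test_functions U \<and> supp (f i) \<subseteq> K"
    and lim: "\<And>vs e. 0 < e \<Longrightarrow> \<forall>\<^sub>F i in F. \<forall>x\<in>K. \<bar>iter_deriv vs (f i) x - iter_deriv vs \<phi> x\<bar> \<le> e"
  shows "((\<lambda>i. T (f i)) \<longlongrightarrow> T \<phi>) F"
proof (rule tendstoI)
  fix e :: real assume e: "0 < e"
  obtain C L where C: "C > 0" "finite L" and bound: "\<And>\<phi> M. \<phi> \<in> test_functions U \<Longrightarrow> supp \<phi> \<subseteq> K \<Longrightarrow>
      \<forall>vs\<in>L. \<forall>x. \<bar>iter_deriv vs \<phi> x\<bar> \<le> M \<Longrightarrow> \<bar>T \<phi>\<bar> \<le> C * M"
    using distribution_bound[OF T K] by blast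
  define M where "M = e / (2 * C)"
  have M: "M > 0" using C e by (simp add: M_def)
  have "\<forall>\<^sub>F i in F. \<forall>vs\<in>L. \<forall>x\<in>K. \<bar>iter_deriv vs (f i) x - iter_deriv vs \<phi> x\<bar> \<le> M"
    using lim[OF M] C(2) by (simp add: eventually_ball_finite_distrib)
  with f show "\<forall>\<^sub>F i in F. dist (T (f i)) (T \<phi>) < e"
  proof eventually_elim
    case (elim i)
    have "supp (\<lambda>x. f i x - \<phi> x) \<subseteq> K"
    proof (rule supp_subsetI)
      show "x \<in> K" if "f i x - \<phi> x \<noteq> 0" for x
        using that elim \<phi> not_in_supp[of x "f i"] not_in_supp[of x \<phi>] by (cases "x \<in> supp \<phi>") auto
    qed (use K compact_imp_closed in auto)
    moreover have "\<bar>iter_deriv vs (\<lambda>x. f i x - \<phi> x) x\<bar> \<le> M" if "vs \<in> L" for vs x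
    proof -
      have eq: "iter_deriv vs (\<lambda>x. f i x - \<phi> x) x = iter_deriv vs (f i) x - iter_deriv vs \<phi> x"
        using elim \<phi> by (simp add: iter_deriv_diff test_functions_def)
      show ?thesis
      proof (cases "x \<in> K")
        case False
        then have "iter_deriv vs (f i) x = 0" "iter_deriv vs \<phi> x = 0"
          using supp_iter_deriv[of vs "f i"] supp_iter_deriv[of vs \<phi>] elim \<phi>
            not_in_supp[of x "iter_deriv vs (f i)"] not_in_supp[of x "iter_deriv vs \<phi>"] by blast+
        then show ?thesis using eq M by simp
      qed (use elim that eq in auto)
    qed
    ultimately have "\<bar>T (\<lambda>x. f i x - \<phi> x)\<bar> \<le> C * M"
      using elim \<phi> by (intro bound) (auto intro: test_functions_diff)
    moreover have "C * M < e" using C e by (simp add: M_def)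
    ultimately show ?case
      using elim \<phi> distribution_linear(3)[OF T, of "f i" \<phi>] by (simp add: dist_real_def)
  qed
qed

text \<open>A tube argument: \<open>G\<close> is uniformly continuous on the product of
  \<open>K\<close> with a compact ball around \<open>p0\<close>.\<close>

lemma continuous_uniformly_in_second:
  fixes G :: "'p::euclidean_space \<times> 'a::euclidean_space \<Rightarrow> real"
  assumes G: "continuous_on UNIV G" and K: "compact K" and e: "0 < e"
  shows "\<forall>\<^sub>F p in nhds p0. \<forall>y\<in>K. \<bar>G (p, y) - G (p0, y)\<bar> \<le> e"
proof -
  have "uniformly_continuous_on (cball p0 1 \<times> K) G"
    using K continuous_on_subset[OF G] by (intro compact_uniformly_continuous compact_Times) auto
  then obtain d where d: "d > 0" "\<And>z z'. z \<in> cball p0 1 \<times> K \<Longrightarrow> z' \<in> cball p0 1 \<times> K \<Longrightarrow>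
      dist z' z < d \<Longrightarrow> dist (G z') (G z) < e"
    using e unfolding uniformly_continuous_on_def by meson
  have "\<forall>\<^sub>F p in nhds p0. dist p p0 < min 1 d"
    unfolding eventually_nhds_metric using d(1) by (intro exI[of _ "min 1 d"]) auto
  then show ?thesis
  proof eventually_elim
    case (elim p)
    show ?case
    proof
      fix y assume "y \<in> K"
      then have "dist (G (p, y)) (G (p0, y)) < e"
        using elim by (intro d(2)) (auto simp: dist_Pair_Pair dist_commute)
      then show "\<bar>G (p, y) - G (p0, y)\<bar> \<le> e" by (simp add: dist_real_def)
    qed
  qed
qed

lemma distribution_param_continuous:
  fixes F :: "'p::euclidean_space \<times> 'a::euclidean_space \<Rightarrow> real"
  assumes T: "T \<in> distributions U" and K: "compact K" "K \<subseteq> U" and F: "smooth F"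
    and V: "open V" "\<And>p y. p \<in> V \<Longrightarrow> F (p, y) \<noteq> 0 \<Longrightarrow> y \<in> K" and p0: "p0 \<in> V"
  shows "((\<lambda>p. T (\<lambda>y. F (p, y))) \<longlongrightarrow> T (\<lambda>y. F (p0, y))) (at p0 within S)"
proof (rule distribution_tendsto[OF T K])
  have *: "(\<lambda>y. F (p, y)) \<in> test_functions U" "supp (\<lambda>y. F (p, y)) \<subseteq> K" if "p \<in> V" for p
    by (rule test_functionsI[OF smooth_slice[OF F] K V(2)[OF that]]; assumption)+
  show "(\<lambda>y. F (p0, y)) \<in> test_functions U" "supp (\<lambda>y. F (p0, y)) \<subseteq> K" using * p0 by auto
  have "\<forall>\<^sub>F p in at p0 within S. p \<in> V"
    using V(1) p0 by (rule eventually_at_in_open'[THEN eventually_at_filter[THEN iffD1], THEN eventually_mono, THEN eventually_at_filter[THEN iffD2]]) auto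
  then show "\<forall>\<^sub>F p in at p0 within S. (\<lambda>y. F (p, y)) \<in> test_functions U \<and> supp (\<lambda>y. F (p, y)) \<subseteq> K"
    by eventually_elim (use * in auto)
  fix vs :: "'a list" and e :: real assume "0 < e"
  from continuous_uniformly_in_second[OF smooth_continuous_on[OF smooth_iter_deriv[OF F]] K(1) this]
  have "\<forall>\<^sub>F p in nhds p0. \<forall>y\<in>K. \<bar>iter_deriv vs (\<lambda>y. F (p, y)) y - iter_deriv vs (\<lambda>y. F (p0, y)) y\<bar> \<le> e"
    unfolding iter_deriv_slice[OF F] .
  then show "\<forall>\<^sub>F p in at p0 within S. \<forall>y\<in>K. \<bar>iter_deriv vs (\<lambda>y. F (p, y)) y - iter_deriv vs (\<lambda>y. F (p0, y)) y\<bar> \<le> e"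
    by (rule filter_leD[OF at_within_le_nhds])
qed

text \<open>A parameter in the open set \<open>V\<close> can be moved a little along
  \<open>v\<close> inside \<open>V\<close>. For \<open>y\<close> outside \<open>K\<close> the
  function \<open>F\<close> vanishes along this whole segment.\<close>

lemma dir_deriv_param_support:
  fixes F :: "'p::euclidean_space \<times> 'a::euclidean_space \<Rightarrow> real"
  assumes F: "smooth F" and V: "open V" "\<And>p y. p \<in> V \<Longrightarrow> F (p, y) \<noteq> 0 \<Longrightarrow> y \<in> K"
    and p: "p \<in> V" "dir_deriv (v, 0) F (p, y) \<noteq> 0"
  shows "y \<in> K"
proof (rule ccontr)
  assume y: "y \<notin> K"
  have "((\<lambda>h. F ((p, y) + h *\<^sub>R (v, 0))) has_real_derivative 0) (at 0)"
  proof (rule has_field_derivative_transform_within_open)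
    show "((\<lambda>h::real. 0::real) has_real_derivative 0) (at 0)" by simp
    show "open ((\<lambda>h. p + h *\<^sub>R v) -` V)"
      by (intro open_vimage V continuous_intros)
    show "0 \<in> (\<lambda>h. p + h *\<^sub>R v) -` V" using p by simp
    show "0 = F ((p, y) + h *\<^sub>R (v, 0))" if "h \<in> (\<lambda>h. p + h *\<^sub>R v) -` V" for h
      using V(2)[of "p + h *\<^sub>R v" y] that y by auto
  qed
  moreover have "((\<lambda>h. F ((p, y) + h *\<^sub>R (v, 0))) has_real_derivative dir_deriv (v, 0) F (p, y)) (at 0)"
    using has_derivative_along_line[of F "(p, y)" 0 "(v, 0)"] smooth_differentiable[OF F] by simp
  ultimately show False using DERIV_unique p(2) by blast
qed

text \<open>Differentiation under \<open>T\<close>. The difference quotients in the parameter are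
  test functions supported in \<open>K\<close>, and the mean value theorem shows that they converge
  uniformly on \<open>K\<close> together with all their derivatives in \<open>y\<close>.\<close>

lemma distribution_param_derivative:
  fixes F :: "'p::euclidean_space \<times> 'a::euclidean_space \<Rightarrow> real"
  assumes T: "T \<in> distributions U" and K: "compact K" "K \<subseteq> U" and F: "smooth F"
    and V: "open V" "\<And>p y. p \<in> V \<Longrightarrow> F (p, y) \<noteq> 0 \<Longrightarrow> y \<in> K" and t: "p0 + t *\<^sub>R v \<in> V"
  shows "((\<lambda>t. T (\<lambda>y. F (p0 + t *\<^sub>R v, y))) has_real_derivative
           T (\<lambda>y. dir_deriv (v, 0) F (p0 + t *\<^sub>R v, y))) (at t)"
proof -
  define p where "p = p0 + t *\<^sub>R v"
  have *: "(\<lambda>y. F (p, y)) \<in> test_functions U" "supp (\<lambda>y. F (p, y)) \<subseteq> K" if "p \<in> V" for p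
    by (rule test_functionsI[OF smooth_slice[OF F] K V(2)[OF that]]; assumption)+
  have p: "p \<in> V" using t by (simp add: p_def)
  have line: "(\<lambda>h. p + h *\<^sub>R v) \<midarrow>0\<rightarrow> p" by (auto intro!: tendsto_eq_intros)
  have nh: "\<forall>\<^sub>F h in at 0. Q (p + h *\<^sub>R v)" if "\<forall>\<^sub>F q in nhds p. Q q" for Q
    using line that unfolding filterlim_iff by blast
  have V_ev: "\<forall>\<^sub>F h in at 0. p + h *\<^sub>R v \<in> V"
    using V(1) p by (intro nh) (auto simp: eventually_nhds)
  have "((\<lambda>h. T (\<lambda>y. (1 / h) * (F (p + h *\<^sub>R v, y) - F (p, y)))) \<longlongrightarrow> T (\<lambda>y. dir_deriv (v, 0) F (p, y))) (at 0)"
  proof (rule distribution_tendsto[OF T K])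
    note dF = test_functionsI[OF smooth_slice[OF smooth_dir_deriv[OF F]] K dir_deriv_param_support[OF F V p]]
    show "(\<lambda>y. dir_deriv (v, 0) F (p, y)) \<in> test_functions U" by (rule dF(1))
    show "supp (\<lambda>y. dir_deriv (v, 0) F (p, y)) \<subseteq> K" by (rule dF(2))
    show "\<forall>\<^sub>F h in at 0. (\<lambda>y. 1 / h * (F (p + h *\<^sub>R v, y) - F (p, y))) \<in> test_functions U \<and>
        supp (\<lambda>y. 1 / h * (F (p + h *\<^sub>R v, y) - F (p, y))) \<subseteq> K"
      using V_ev
    proof eventually_elim
      case (elim h)
      show ?case
      proof
        show "(\<lambda>y. 1 / h * (F (p + h *\<^sub>R v, y) - F (p, y))) \<in> test_functions U"
          using * elim p by (intro test_functions_cmult test_functions_diff) auto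
        show "supp (\<lambda>y. 1 / h * (F (p + h *\<^sub>R v, y) - F (p, y))) \<subseteq> K"
        proof (rule supp_subsetI)
          show "y \<in> K" if "1 / h * (F (p + h *\<^sub>R v, y) - F (p, y)) \<noteq> 0" for y
            using V(2)[OF elim, of y] V(2)[OF p, of y] that by (cases "F (p, y) = 0") auto
        qed (use K compact_imp_closed in auto)
      qed
    qed
    fix vs :: "'a list" and e :: real assume e: "0 < e"
    \<comment> \<open>The derivative \<open>vs\<close> of the quotient is the quotient of
      \<open>G\<close>, and by symmetry of derivatives that of the limit is the parameter derivative
      of \<open>G\<close>. One mean value argument therefore serves all orders.\<close>
    define G where "G = iter_deriv (map (Pair (0::'p)) vs) F"
    have G: "smooth G" unfolding G_def by (rule smooth_iter_deriv[OF F])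
    have quotient: "iter_deriv vs (\<lambda>y. 1 / h * (F (p + h *\<^sub>R v, y) - F (p, y))) y =
        1 / h * (G (p + h *\<^sub>R v, y) - G (p, y))" for h y
      by (simp only: iter_deriv_cmult[OF smooth_diff[OF smooth_slice[OF F] smooth_slice[OF F]]]
          iter_deriv_diff[OF smooth_slice[OF F] smooth_slice[OF F]] iter_deriv_slice[OF F] G_def)
    have limit: "iter_deriv vs (\<lambda>y. dir_deriv (v, 0) F (p, y)) y = dir_deriv (v, 0) G (p, y)" for y
      by (simp add: iter_deriv_slice[OF smooth_dir_deriv[OF F]] iter_deriv_dir_deriv_commute[OF F] G_def)
    have "\<forall>\<^sub>F q in nhds p. \<forall>y\<in>K. \<bar>dir_deriv (v, 0) G (q, y) - dir_deriv (v, 0) G (p, y)\<bar> \<le> e"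
      by (rule continuous_uniformly_in_second[OF smooth_continuous_on[OF smooth_dir_deriv[OF G]] K(1) e])
    then have "\<forall>\<^sub>F h in at 0. \<forall>y\<in>K. \<bar>dir_deriv (v, 0) G (p + h *\<^sub>R v, y) - dir_deriv (v, 0) G (p, y)\<bar> \<le> e"
      by (rule nh)
    then obtain d where d: "d > 0" "\<And>h y. h \<noteq> 0 \<Longrightarrow> \<bar>h\<bar> < d \<Longrightarrow> y \<in> K \<Longrightarrow>
        \<bar>dir_deriv (v, 0) G (p + h *\<^sub>R v, y) - dir_deriv (v, 0) G (p, y)\<bar> \<le> e"
      by (auto simp: eventually_at dist_real_def)
    have "\<forall>\<^sub>F h in at 0. h \<noteq> 0 \<and> \<bar>h\<bar> < d"
      unfolding eventually_at using d(1) by (intro exI[of _ d]) (auto simp: dist_real_def)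
    then show "\<forall>\<^sub>F h in at 0. \<forall>y\<in>K. \<bar>iter_deriv vs (\<lambda>y. 1 / h * (F (p + h *\<^sub>R v, y) - F (p, y))) y -
        iter_deriv vs (\<lambda>y. dir_deriv (v, 0) F (p, y)) y\<bar> \<le> e"
    proof eventually_elim
      case (elim h)
      show ?case
      proof
        fix y assume y: "y \<in> K"
        obtain \<xi> where \<xi>: "\<bar>\<xi>\<bar> \<le> \<bar>h\<bar>" "G (p + h *\<^sub>R v, y) - G (p, y) = h * dir_deriv (v, 0) G (p + \<xi> *\<^sub>R v, y)"
          using mean_value_along_line[OF G, of h "(p, y)" "(v, 0)"] by auto
        \<comment> \<open>The punctured filter gives the estimate for nonzero increments; for
          \<open>\<xi> = 0\<close> the difference vanishes.\<close>
        have "\<bar>dir_deriv (v, 0) G (p + \<xi> *\<^sub>R v, y) - dir_deriv (v, 0) G (p, y)\<bar> \<le> e"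
          using d(2)[of \<xi> y] \<xi> elim y e by (cases "\<xi> = 0") auto
        then show "\<bar>iter_deriv vs (\<lambda>y. 1 / h * (F (p + h *\<^sub>R v, y) - F (p, y))) y -
            iter_deriv vs (\<lambda>y. dir_deriv (v, 0) F (p, y)) y\<bar> \<le> e"
          unfolding quotient limit using \<xi> elim by simp
      qed
    qed
  qed
  moreover have "\<forall>\<^sub>F h in at 0. T (\<lambda>y. (1 / h) * (F (p + h *\<^sub>R v, y) - F (p, y))) =
      (T (\<lambda>y. F (p + h *\<^sub>R v, y)) - T (\<lambda>y. F (p, y))) / h"
    using V_ev
  proof eventually_elim
    case (elim h)
    show ?case
      using distribution_linear(2)[OF T test_functions_diff[OF *(1)[OF elim] *(1)[OF p]], of "1 / h"]
        distribution_linear(3)[OF T *(1)[OF elim] *(1)[OF p]] by simp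
  qed
  ultimately have "((\<lambda>h. (T (\<lambda>y. F (p + h *\<^sub>R v, y)) - T (\<lambda>y. F (p, y))) / h) \<longlongrightarrow>
      T (\<lambda>y. dir_deriv (v, 0) F (p, y))) (at 0)"
    by (rule Lim_transform_eventually)
  then show ?thesis
    unfolding DERIV_def p_def by (simp add: scaleR_add_left add.assoc)
qed

subsection \<open>The Levi form and cutoff functions\<close>

lemma vec_eq_sum_axis:
  fixes w :: "complex ^ 'n::finite"
  shows "w = (\<Sum>j\<in>UNIV. Re (w $ j) *\<^sub>R axis j 1 + Im (w $ j) *\<^sub>R axis j \<i>)"
proof -
  have "(\<Sum>j\<in>UNIV. Re (w $ j) *\<^sub>R axis j 1 + Im (w $ j) *\<^sub>R axis j \<i>) $ k = w $ k" for k
  proof -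
    have "(\<Sum>j\<in>UNIV. Re (w $ j) *\<^sub>R axis j 1 + Im (w $ j) *\<^sub>R axis j \<i>) $ k =
        (\<Sum>j\<in>UNIV. if j = k then w $ k else 0)"
      unfolding sum_component
      by (rule sum.cong) (auto simp: axis_def complex_eq_iff)
    then show ?thesis by simp
  qed
  then show ?thesis by (simp add: vec_eq_iff)
qed

lemma distribution_dir_deriv_expand:
  fixes U :: "(complex ^ 'n::finite) set"
  assumes T: "T \<in> distributions U" and \<phi>: "\<phi> \<in> test_functions U"
  shows "T (dir_deriv w \<phi>) =
    (\<Sum>j\<in>UNIV. Re (w $ j) * T (dir_deriv (axis j 1) \<phi>) + Im (w $ j) * T (dir_deriv (axis j \<i>) \<phi>))"
proof -
  note diff = smooth_differentiable[OF test_functionsD(1)[OF \<phi>]]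
  have "dir_deriv w \<phi> x = (\<Sum>j\<in>UNIV. Re (w $ j) * dir_deriv (axis j 1) \<phi> x + Im (w $ j) * dir_deriv (axis j \<i>) \<phi> x)" for x
    by (subst vec_eq_sum_axis[of w])
       (simp add: dir_deriv_sum_direction dir_deriv_add_direction dir_deriv_scale_direction diff)
  then have "dir_deriv w \<phi> = (\<lambda>x. \<Sum>j\<in>UNIV. Re (w $ j) * dir_deriv (axis j 1) \<phi> x + Im (w $ j) * dir_deriv (axis j \<i>) \<phi> x)"
    by blast
  moreover have "T (\<lambda>x. Re (w $ j) * dir_deriv (axis j 1) \<phi> x + Im (w $ j) * dir_deriv (axis j \<i>) \<phi> x) =
      Re (w $ j) * T (dir_deriv (axis j 1) \<phi>) + Im (w $ j) * T (dir_deriv (axis j \<i>) \<phi>)" for j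
    using \<phi> by (simp only: distribution_linear(1,2)[OF T] test_functions_cmult test_functions_dir_deriv)
  ultimately show ?thesis
    using \<phi> by (simp only: distribution_linear(4)[OF T] test_functions_add test_functions_cmult test_functions_dir_deriv)
qed

text \<open>The distributional form of the identity that the Laplacian along a complex line is four
  times the mixed Wirtinger derivative. Both sides are expanded in the real basis of coordinate
  directions.\<close>

lemma Re_levi_form:
  fixes U :: "(complex ^ 'n::finite) set"
  assumes T: "T \<in> distributions U" and \<phi>: "\<phi> \<in> test_functions U"
  shows "Re (levi_form T \<phi> w) =
    (T (dir_deriv w (dir_deriv w \<phi>)) + T (dir_deriv (\<i> *s w) (dir_deriv (\<i> *s w) \<phi>))) / 4"
proof -
  define D where "D = (\<lambda>u v. T (dir_deriv u (dir_deriv v \<phi>)))"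
  have expand: "D w w = (\<Sum>j\<in>UNIV. \<Sum>k\<in>UNIV.
      Re (w $ j) * (Re (w $ k) * D (axis k 1) (axis j 1) + Im (w $ k) * D (axis k \<i>) (axis j 1)) +
      Im (w $ j) * (Re (w $ k) * D (axis k 1) (axis j \<i>) + Im (w $ k) * D (axis k \<i>) (axis j \<i>)))" for w
  proof -
    have 1: "D w w = (\<Sum>j\<in>UNIV. Re (w $ j) * D w (axis j 1) + Im (w $ j) * D w (axis j \<i>))"
      unfolding D_def distribution_dir_deriv_expand[OF T test_functions_dir_deriv[OF \<phi>], of w w]
      using dir_deriv_commute[OF test_functionsD(1)[OF \<phi>], of _ w] by (metis (no_types, lifting) ext)
    have 2: "D w u = (\<Sum>k\<in>UNIV. Re (w $ k) * D (axis k 1) u + Im (w $ k) * D (axis k \<i>) u)" for u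
      unfolding D_def by (rule distribution_dir_deriv_expand[OF T test_functions_dir_deriv[OF \<phi>]])
    show ?thesis
      unfolding 1 2[of "axis _ _"] sum_distrib_left sum.distrib[symmetric] ..
  qed
  have "4 * Re (levi_form T \<phi> w) = (\<Sum>j\<in>UNIV. \<Sum>k\<in>UNIV.
      (D (axis k 1) (axis j 1) + D (axis k \<i>) (axis j \<i>)) * (Re (w $ j) * Re (w $ k) + Im (w $ j) * Im (w $ k)) -
      (D (axis k \<i>) (axis j 1) - D (axis k 1) (axis j \<i>)) * (Im (w $ j) * Re (w $ k) - Re (w $ j) * Im (w $ k)))"
    unfolding levi_form_def Re_sum sum_distrib_left
    by (intro sum.cong refl) (simp add: dist_dz_def dist_dzbar_def dist_deriv_def D_def field_simps)
  \<comment> \<open>Passing from \<open>w\<close> to \<open>\<i> *s w\<close> replaces the pair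
    \<open>(Re, Im)\<close> of each component by \<open>(- Im, Re)\<close>, so the double sums agree
    term by term.\<close>
  also have "\<dots> = D w w + D (\<i> *s w) (\<i> *s w)"
    unfolding expand sum.distrib[symmetric]
    by (intro sum.cong refl) (simp add: algebra_simps)
  finally show ?thesis by (simp add: D_def)
qed

lemma strictly_psh_dist_iff:
  fixes U :: "(complex ^ 'n::finite) set"
  assumes T: "T \<in> distributions U"
  shows "strictly_psh_dist U T \<longleftrightarrow>
     (\<exists>\<psi> :: complex ^ 'n \<Rightarrow> real. continuous_on U \<psi> \<and> (\<forall>x\<in>U. 0 < \<psi> x) \<and>
        (\<forall>\<phi>\<in>test_functions U. (\<forall>x. 0 \<le> \<phi> x) \<longrightarrow>
           (\<forall>w. 4 * (LINT x:U|lebesgue. \<psi> x * \<phi> x) * (norm w)\<^sup>2 \<le>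
              T (dir_deriv w (dir_deriv w \<phi>)) + T (dir_deriv (\<i> *s w) (dir_deriv (\<i> *s w) \<phi>)))))"
proof -
  have "(A * c \<le> Re (levi_form T \<phi> w)) \<longleftrightarrow> (4 * A * c \<le>
      T (dir_deriv w (dir_deriv w \<phi>)) + T (dir_deriv (\<i> *s w) (dir_deriv (\<i> *s w) \<phi>)))"
    if "\<phi> \<in> test_functions U" for \<phi> w A c
    unfolding Re_levi_form[OF T that] by auto
  then show ?thesis unfolding strictly_psh_dist_def by (simp cong: conj_cong ball_cong)
qed

lemma smooth_norm_square: "smooth (\<lambda>x::'a::euclidean_space. (norm x)\<^sup>2)"
proof -
  have "(\<lambda>x::'a. (norm x)\<^sup>2) = (\<lambda>x. \<Sum>i\<in>Basis. (x \<bullet> i) * (x \<bullet> i))"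
    by (simp add: power2_norm_eq_inner euclidean_inner[symmetric])
  then show ?thesis by (simp add: smooth_sum smooth_mult)
qed

lemma smooth_bump_ball: "smooth (\<lambda>x::'a::euclidean_space. bump n (c - d * (norm (a - x))\<^sup>2))"
  by (intro smooth_compose_real[OF smooth_bump] smooth_diff smooth_const smooth_cmult
      smooth_reflect[OF smooth_norm_square])

text \<open>Values of at least \<open>1\<close> on \<open>K\<close> are enough for all uses, so a
  finite sum of bumps that is positive on \<open>K\<close> can simply be divided by its minimum
  there.\<close>

lemma cutoff_exists:
  fixes U :: "'a::euclidean_space set"
  assumes U: "open U" and K: "compact K" "K \<subseteq> U"
  shows "\<exists>\<kappa>\<in>test_functions U. (\<forall>x. 0 \<le> \<kappa> x) \<and> (\<forall>x\<in>K. 1 \<le> \<kappa> x)"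
proof (cases "K = {}")
  case True
  then show ?thesis using test_functions_zero by force
next
  case False
  obtain e where e: "e > 0" "(\<Union>x\<in>K. cball x e) \<subseteq> U"
    using compact_subset_open_imp_cball_epsilon_subset[OF K(1) U K(2)] by blast
  obtain X where X: "finite X" "X \<subseteq> K" "K \<subseteq> (\<Union>x\<in>X. ball x e)"
    using compactE_image[OF K(1), of K "\<lambda>x. ball x e"] e(1) by (metis (no_types, lifting) UN_I centre_in_ball open_ball subsetI)
  define \<beta> where "\<beta> = (\<lambda>x y :: 'a. bump 0 (e\<^sup>2 - 1 * (norm (x - y))\<^sup>2))"
  have \<beta>: "\<beta> x \<in> test_functions U" if "x \<in> X" for x
  proof (rule test_functionsI)
    show "smooth (\<beta> x)" unfolding \<beta>_def by (rule smooth_bump_ball)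
    show "compact (cball x e)" by simp
    show "cball x e \<subseteq> U" using that X e by blast
    show "y \<in> cball x e" if "\<beta> x y \<noteq> 0" for y
    proof (rule ccontr)
      assume "y \<notin> cball x e"
      then have "e\<^sup>2 \<le> (norm (x - y))\<^sup>2" using e(1) by (intro power_mono) (auto simp: dist_norm)
      then show False using that by (simp add: \<beta>_def)
    qed
  qed
  define \<kappa> where "\<kappa> = (\<lambda>y. \<Sum>x\<in>X. \<beta> x y)"
  have \<kappa>: "\<kappa> \<in> test_functions U" unfolding \<kappa>_def by (rule test_functions_sum[OF \<beta>])
  have nonneg: "0 \<le> \<kappa> y" for y unfolding \<kappa>_def \<beta>_def by (simp add: sum_nonneg)
  have pos: "0 < \<kappa> y" if yK: "y \<in> K" for y
  proof -
    obtain x where x: "x \<in> X" "y \<in> ball x e" using X(3) yK by blast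
    then have "(norm (x - y))\<^sup>2 < e\<^sup>2" by (intro power_strict_mono) (auto simp: dist_norm)
    then have "0 < \<beta> x y" by (simp add: \<beta>_def bump_pos)
    then show ?thesis unfolding \<kappa>_def using X(1) x(1)
      by (intro sum_pos2[of X x]) (auto simp: \<beta>_def)
  qed
  obtain y0 where y0: "y0 \<in> K" "\<And>y. y \<in> K \<Longrightarrow> \<kappa> y0 \<le> \<kappa> y"
    using continuous_attains_inf[OF K(1) False smooth_continuous_on[OF test_functionsD(1)[OF \<kappa>]]] by blast
  show ?thesis
  proof (intro bexI[of _ "\<lambda>y. (1 / \<kappa> y0) * \<kappa> y"] conjI allI ballI)
    show "(\<lambda>y. (1 / \<kappa> y0) * \<kappa> y) \<in> test_functions U" by (rule test_functions_cmult[OF \<kappa>])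
    show "0 \<le> 1 / \<kappa> y0 * \<kappa> y" for y using nonneg by simp
    show "1 \<le> 1 / \<kappa> y0 * \<kappa> y" if "y \<in> K" for y using y0(2)[OF that] pos[OF y0(1)] by (simp add: field_simps)
  qed
qed

subsection \<open>The mollifier\<close>

text \<open>The argument only carries the type, hence the dimension. The profile is
  \<open>bump 2\<close> because it is the derivative of \<open>bump 0\<close>, from which
  \<open>mollifier_primitive\<close> is built.\<close>

definition mollifier_const :: "'a::euclidean_space itself \<Rightarrow> real" where
  "mollifier_const _ = 1 / (LINT z|lborel. bump 2 (1 - (norm (z::'a))\<^sup>2))"

text \<open>The parameter \<open>t\<close> is the logarithm of the radius of the support.\<close>

definition mollifier :: "real \<Rightarrow> 'a::euclidean_space \<Rightarrow> real" where
  "mollifier t z = mollifier_const TYPE('a) * exp (- (real DIM('a) * t)) * bump 2 (1 - exp (- (2 * t)) * (norm z)\<^sup>2)"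

lemma integrable_continuous_compact_support:
  fixes f :: "'a::euclidean_space \<Rightarrow> real"
  assumes "continuous_on K f" "compact K" "\<And>x. x \<notin> K \<Longrightarrow> f x = 0"
  shows "integrable lborel f"
proof -
  have "integrable lborel (\<lambda>x. indicator K x *\<^sub>R f x)"
    by (rule borel_integrable_compact[OF assms(2,1)])
  moreover have "(\<lambda>x. indicator K x *\<^sub>R f x) = f"
    by (rule ext) (use assms(3) in \<open>auto simp: indicator_def\<close>)
  ultimately show ?thesis by simp
qed

lemma smooth_ident: "smooth (\<lambda>t::real. t)"
  by (rule smooth_bounded_linear[OF bounded_linear_ident])

lemma bump_ball_integral:
  fixes f :: "'a::euclidean_space \<Rightarrow> real"
  defines "f \<equiv> \<lambda>z. bump 2 (1 - (norm z)\<^sup>2)"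
  shows "integrable lborel f" "0 < (LINT z|lborel. f z)"
proof -
  have cont: "continuous_on UNIV f"
    using smooth_continuous_on[OF smooth_bump_ball[of 2 1 1 "0::'a"]] by (simp add: f_def)
  show int: "integrable lborel f"
  proof (rule integrable_continuous_compact_support)
    show "continuous_on (cball 0 1) f" by (rule continuous_on_subset[OF cont]) simp
    show "f z = 0" if "z \<notin> cball 0 1" for z
      using that one_le_power[of "norm z" 2] by (simp add: f_def)
  qed simp
  show "0 < (LINT z|lborel. f z)"
  proof (rule ccontr)
    assume "\<not> 0 < (LINT z|lborel. f z)"
    moreover have "0 \<le> (LINT z|lborel. f z)" by (simp add: f_def)
    ultimately have "(LINT z|lborel. f z) = 0" by simp
    then have "AE z in lborel. f z = 0"
      using integral_nonneg_eq_0_iff_AE[OF int] by (simp add: f_def)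
    moreover have "f z \<noteq> 0" if "z \<in> ball 0 1" for z
      using that bump_pos[of "1 - (norm z)\<^sup>2" 2] power_strict_mono[of "norm z" 1 2] by (simp add: f_def)
    ultimately have "AE z in lborel. z \<notin> ball (0::'a) 1" by auto
    then have "emeasure lborel (ball (0::'a) 1) = 0"
      by (subst (asm) AE_iff_measurable[of "ball 0 1"]) auto
    then have "ball (0::'a) 1 \<in> null_sets lborel" by auto
    then have "negligible (ball (0::'a) 1)"
      by (simp add: negligible_iff_null_sets null_sets_completionI)
    then show False using open_not_negligible[of "ball (0::'a) 1"] by simp
  qed
qed

lemma mollifier_const_pos: "0 < mollifier_const TYPE('a::euclidean_space)"
  unfolding mollifier_const_def using bump_ball_integral(2) by simp

lemma mollifier_nonneg [simp]: "0 \<le> mollifier t z"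
  unfolding mollifier_def using mollifier_const_pos[where 'a='a] by (simp add: less_imp_le)

lemma mollifier_nonzeroD: "mollifier t z \<noteq> 0 \<Longrightarrow> norm z < exp t"
proof (rule ccontr)
  assume *: "mollifier t z \<noteq> 0" and "\<not> norm z < exp t"
  then have "(exp t)\<^sup>2 \<le> (norm z)\<^sup>2" by (intro power_mono) auto
  then have "exp (- (2 * t)) * (exp t)\<^sup>2 \<le> exp (- (2 * t)) * (norm z)\<^sup>2" by (rule mult_left_mono) simp
  moreover have "exp (- (2 * t)) * (exp t)\<^sup>2 = 1"
    by (simp add: power2_eq_square flip: exp_add)
  ultimately show False using * by (simp add: mollifier_def)
qed

lemma smooth_mollifier: "smooth (mollifier t :: 'a::euclidean_space \<Rightarrow> real)"
  unfolding mollifier_def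
  by (intro smooth_cmult smooth_compose_real[OF smooth_bump] smooth_diff smooth_const smooth_norm_square)

text \<open>The factor \<open>exp (- (real DIM('a) * t))\<close> compensates the Jacobian of the
  dilation by \<open>exp t\<close>.\<close>

lemma mollifier_integral:
  "has_bochner_integral lborel (mollifier t :: 'a::euclidean_space \<Rightarrow> real) 1"
proof -
  define f where "f = (\<lambda>z::'a. bump 2 (1 - (norm z)\<^sup>2))"
  define J where "J = (LINT z|lborel. f z)"
  note I = bump_ball_integral[where 'a='a, folded f_def, folded J_def]
  have meas [measurable]: "f \<in> borel_measurable borel"
    using I(1) by auto
  have mol: "mollifier t z = (1 / J) * exp (- (real DIM('a) * t)) * f (exp (- t) *\<^sub>R z)" for z :: 'a
    by (simp add: mollifier_def mollifier_const_def J_def f_def power_mult_distrib flip: exp_double)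
  define k where "k = exp (- t) ^ DIM('a)"
  define D where "D = distr lborel borel (\<lambda>z::'a. exp (- t) *\<^sub>R z)"
  have k: "k \<ge> 0" by (simp add: k_def)
  have [measurable]: "f \<in> borel_measurable D" by (simp add: D_def)
  have eq: "density D (\<lambda>_. ennreal k) = (lborel :: 'a measure)"
    using lborel_affine[of "exp (- t)" "0::'a"] by (simp add: D_def k_def)
  have "integrable D (\<lambda>z. k *\<^sub>R f z)" "(LINT z|D. k *\<^sub>R f z) = J"
    using integrable_density[of f D "\<lambda>_. k"] integral_density[of f D "\<lambda>_. k"] I(1) k
    unfolding eq J_def by auto
  then have "integrable lborel (\<lambda>z. k *\<^sub>R f (exp (- t) *\<^sub>R z))" "(LINT z|lborel. k *\<^sub>R f (exp (- t) *\<^sub>R z)) = J"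
    using integrable_distr_eq[of "\<lambda>z::'a. exp (- t) *\<^sub>R z" lborel borel "\<lambda>z. k *\<^sub>R f z"]
      integral_distr[of "\<lambda>z::'a. exp (- t) *\<^sub>R z" lborel borel "\<lambda>z. k *\<^sub>R f z"]
    unfolding D_def by auto
  then have "has_bochner_integral lborel (\<lambda>z. k *\<^sub>R f (exp (- t) *\<^sub>R z)) J"
    by (simp add: has_bochner_integral_iff)
  then have "has_bochner_integral lborel (\<lambda>z::'a. (1 / J) * (k *\<^sub>R f (exp (- t) *\<^sub>R z))) ((1 / J) * J)"
    by (rule has_bochner_integral_mult_right)
  moreover have "(1 / J) * J = 1" using I(2) by simp
  moreover have "k = exp (- (real DIM('a) * t))"
    unfolding k_def by (simp flip: exp_of_nat_mult)
  ultimately show ?thesis unfolding mol by (simp add: mult.assoc)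
qed

lemma dir_deriv_chain_real:
  assumes "(h has_real_derivative h') (at (g y))" "g differentiable (at y)"
  shows "dir_deriv v (\<lambda>y. h (g y)) y = h' * dir_deriv v g y"
  using dir_deriv_eq[OF has_derivative_compose[OF has_derivative_dir_deriv[OF assms(2)]
      assms(1)[unfolded has_field_derivative_def]]] .

lemma dir_deriv_cmult: "f differentiable (at x) \<Longrightarrow> dir_deriv v (\<lambda>x. c * f x) x = c * dir_deriv v f x"
  using dir_deriv_mult[of "\<lambda>_. c" x f v] by simp

lemma dir_deriv_norm_square:
  "dir_deriv v (\<lambda>y. (norm (a - y))\<^sup>2) y = - 2 * ((a - y) \<bullet> v)"
proof -
  have "((\<lambda>y. (a - y) \<bullet> (a - y)) has_derivative (\<lambda>h. - 2 * ((a - y) \<bullet> h))) (at y)"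
    by (auto intro!: derivative_eq_intros simp: inner_commute)
  from dir_deriv_eq[OF this] show ?thesis by (simp add: power2_norm_eq_inner)
qed

text \<open>The mollifiers \<open>\<rho>\<^sub>t\<close> satisfy \<open>\<partial>\<rho>\<^sub>t/\<partial>t = \<Delta> (mollifier_primitive t)\<close>, because \<open>z \<rho>\<^sub>0(z)\<close> is the
  gradient of a nonpositive radial function with compact support.\<close>

definition mollifier_primitive :: "real \<Rightarrow> 'a::euclidean_space \<Rightarrow> real" where
  "mollifier_primitive t z =
     mollifier_const TYPE('a) / 2 * exp (2 * t - real DIM('a) * t) * bump 0 (1 - exp (- (2 * t)) * (norm z)\<^sup>2)"

lemma smooth_mollifier_primitive: "smooth (mollifier_primitive t :: 'a::euclidean_space \<Rightarrow> real)"
  unfolding mollifier_primitive_def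
  by (intro smooth_cmult smooth_compose_real[OF smooth_bump] smooth_diff smooth_const smooth_norm_square)

lemma mollifier_primitive_nonneg: "0 \<le> mollifier_primitive t z"
  unfolding mollifier_primitive_def using mollifier_const_pos[where 'a='a] by (simp add: less_imp_le)

lemma mollifier_primitive_nonzeroD: "mollifier_primitive t z \<noteq> 0 \<Longrightarrow> norm z < exp t"
  using mollifier_nonzeroD[of t z] mollifier_const_pos[where 'a='a]
  unfolding mollifier_def mollifier_primitive_def bump_def by (auto split: if_splits)

lemma mollifier_time_derivative:
  fixes x y :: "'a::euclidean_space"
  shows "dir_deriv (1, 0) (\<lambda>(t, y). mollifier t (x - y)) (t, y) =
    (\<Sum>i\<in>Basis. dir_deriv i (dir_deriv i (\<lambda>y. mollifier_primitive t (x - y))) y)"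
proof -
  define c N q where "c = mollifier_const TYPE('a)" and "N = real DIM('a)"
    and "q = (\<lambda>y::'a. 1 - exp (- (2 * t)) * (norm (x - y))\<^sup>2)"
  have nsq: "smooth (\<lambda>y. (norm (x - y))\<^sup>2)" by (rule smooth_reflect[OF smooth_norm_square])
  have q: "smooth q" unfolding q_def by (intro smooth_diff smooth_const smooth_cmult nsq)
  have dq: "dir_deriv i q y = 2 * exp (- (2 * t)) * ((x - y) \<bullet> i)" for i y
  proof -
    have "q = (\<lambda>y. 1 + - exp (- (2 * t)) * (norm (x - y))\<^sup>2)" by (simp add: q_def)
    then have "dir_deriv i q y = 0 + - exp (- (2 * t)) * dir_deriv i (\<lambda>y. (norm (x - y))\<^sup>2) y"
      using smooth_differentiable[OF nsq] smooth_differentiable[OF smooth_cmult[OF nsq]]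
      by (simp only: dir_deriv_add dir_deriv_cmult differentiable_const dir_deriv_const)
    then show ?thesis by (simp add: dir_deriv_norm_square)
  qed
  have d0: "(bump 0 has_real_derivative bump 2 s) (at s)" for s
    using bump_has_derivative[of 0 s] by (simp add: numeral_2_eq_2)
  have d2: "(bump 2 has_real_derivative bump 4 s - 2 * bump 3 s) (at s)" for s
    using bump_has_derivative[of 2 s] by simp
  have e: "exp (2 * t - N * t) * exp (- (2 * t)) = exp (- (N * t))"
    by (simp flip: exp_add)
  \<comment> \<open>The gradient of the primitive is \<open>(x - y)\<close> times the mollifier:
    \<open>bump 0\<close> differentiates to \<open>bump 2\<close>, and the inner derivative
    contributes the factor \<open>exp (- (2 * t))\<close>. The divergence of this field is the
    scaling derivative of the mollifier.\<close>
  have 1: "dir_deriv i (\<lambda>y. mollifier_primitive t (x - y)) =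
      (\<lambda>y. c * exp (- (N * t)) * (bump 2 (q y) * ((x - y) \<bullet> i)))" for i
  proof
    fix y
    have "dir_deriv i (\<lambda>y. c / 2 * exp (2 * t - N * t) * bump 0 (q y)) y =
        c / 2 * exp (2 * t - N * t) * (bump 2 (q y) * (2 * exp (- (2 * t)) * ((x - y) \<bullet> i)))"
      using smooth_differentiable[OF q] smooth_differentiable[OF smooth_compose_real[OF smooth_bump q]]
      by (simp only: dir_deriv_cmult dir_deriv_chain_real[OF d0] dq)
    also have "\<dots> = c * (exp (2 * t - N * t) * exp (- (2 * t))) * (bump 2 (q y) * ((x - y) \<bullet> i))" by simp
    finally show "dir_deriv i (\<lambda>y. mollifier_primitive t (x - y)) y =
        c * exp (- (N * t)) * (bump 2 (q y) * ((x - y) \<bullet> i))"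
      unfolding e by (simp add: mollifier_primitive_def c_def N_def q_def)
  qed
  have lin: "smooth (\<lambda>y. (x - y) \<bullet> i)" for i
    by (simp add: inner_diff_left smooth_diff)
  have dlin: "dir_deriv i (\<lambda>y. (x - y) \<bullet> i) y = - (i \<bullet> i)" for i y
    by (rule dir_deriv_eq[where f'="\<lambda>h. - (h \<bullet> i)"]) (auto intro!: derivative_eq_intros)
  have 2: "dir_deriv i (dir_deriv i (\<lambda>y. mollifier_primitive t (x - y))) y =
      c * exp (- (N * t)) * (bump 2 (q y) * - (i \<bullet> i) +
        (bump 4 (q y) - 2 * bump 3 (q y)) * (2 * exp (- (2 * t)) * ((x - y) \<bullet> i)) * ((x - y) \<bullet> i))" for i
    unfolding 1
    using smooth_differentiable[OF q] smooth_differentiable[OF smooth_compose_real[OF smooth_bump q]]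
      smooth_differentiable[OF lin] smooth_differentiable[OF smooth_mult[OF smooth_compose_real[OF smooth_bump q] lin]]
    by (simp only: dir_deriv_cmult dir_deriv_mult dir_deriv_chain_real[OF d2] dq dlin)
  have "(\<Sum>i\<in>Basis. dir_deriv i (dir_deriv i (\<lambda>y. mollifier_primitive t (x - y))) y) =
      (\<Sum>i\<in>Basis. - (c * exp (- (N * t)) * bump 2 (q y)) +
        c * exp (- (N * t)) * ((bump 4 (q y) - 2 * bump 3 (q y)) * (2 * exp (- (2 * t)))) * (((x - y) \<bullet> i) * ((x - y) \<bullet> i)))"
    unfolding 2 by (intro sum.cong refl) (simp add: algebra_simps)
  also have "\<dots> = - (N * c * exp (- (N * t)) * bump 2 (q y)) +
      c * exp (- (N * t)) * ((bump 4 (q y) - 2 * bump 3 (q y)) * (2 * exp (- (2 * t)))) * (norm (x - y))\<^sup>2"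
    by (simp only: sum.distrib sum_distrib_left[symmetric] sum_constant power2_norm_eq_inner
        euclidean_inner[of "x - y" "x - y", symmetric]) (simp add: N_def)
  also have "\<dots> = dir_deriv (1, 0) (\<lambda>(t, y). mollifier t (x - y)) (t, y)"
  proof -
    define F where "F = (\<lambda>p::real \<times> 'a. c * exp (- (N * fst p)) * bump 2 (1 - exp (- (2 * fst p)) * (norm (x - snd p))\<^sup>2))"
    have F: "smooth F" unfolding F_def
      by (intro smooth_mult smooth_cmult smooth_compose_real[OF smooth_bump] smooth_compose_real[OF smooth_exp]
          smooth_diff smooth_const smooth_minus smooth_fst[OF smooth_ident] smooth_snd[OF nsq])
    have "((\<lambda>s. F ((0, y) + s *\<^sub>R (1, 0))) has_real_derivative
        (- (N * c * exp (- (N * t)) * bump 2 (q y)) +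
         c * exp (- (N * t)) * ((bump 4 (q y) - 2 * bump 3 (q y)) * (2 * exp (- (2 * t)))) * (norm (x - y))\<^sup>2)) (at t)"
      unfolding F_def
      by (auto intro!: derivative_eq_intros DERIV_chain2[OF d2] simp: q_def algebra_simps)
    moreover have "((\<lambda>s. F ((0, y) + s *\<^sub>R (1, 0))) has_real_derivative dir_deriv (1, 0) F (t, y)) (at t)"
      using has_derivative_along_line[OF smooth_differentiable[OF F], where x="(0, y)" and s=t and v="(1, 0)"] by simp
    moreover have "(\<lambda>(t, y). mollifier t (x - y)) = F"
      by (auto simp: F_def mollifier_def c_def N_def)
    ultimately show ?thesis using DERIV_unique by metis
  qed
  finally show ?thesis ..
qed

lemma smooth_mollifier_joint:
  fixes x :: "'a::euclidean_space"
  shows "smooth (\<lambda>(t, y). mollifier t (x - y))"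
proof -
  have "smooth (\<lambda>p::real \<times> 'a. mollifier_const TYPE('a) * exp (- (real DIM('a) * fst p)) * bump 2 (1 - exp (- (2 * fst p)) * (norm (x - snd p))\<^sup>2))"
    by (intro smooth_mult smooth_cmult smooth_compose_real[OF smooth_bump] smooth_compose_real[OF smooth_exp]
          smooth_diff smooth_const smooth_minus smooth_fst[OF smooth_ident] smooth_snd[OF smooth_reflect[OF smooth_norm_square]])
  then show ?thesis by (simp add: mollifier_def case_prod_beta')
qed

text \<open>The derivative in \<open>t\<close> is the Laplacian of \<open>T\<close> tested against
  the nonnegative primitive. The condition \<open>exp t1 < r\<close> keeps the supports in the
  closed ball for all parameters up to \<open>t1\<close> and for slightly larger ones, as needed to
  differentiate at \<open>t1\<close>.\<close>

lemma mollification_mono: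
  fixes U :: "'a::euclidean_space set"
  assumes T: "T \<in> distributions U"
    and pos: "\<And>\<phi>. \<phi> \<in> test_functions U \<Longrightarrow> (\<And>x. 0 \<le> \<phi> x) \<Longrightarrow> 0 \<le> (\<Sum>i\<in>Basis. T (dir_deriv i (dir_deriv i \<phi>)))"
    and t: "t0 \<le> t1" "exp t1 < r" "cball x r \<subseteq> U"
  shows "T (\<lambda>y. mollifier t0 (x - y)) \<le> T (\<lambda>y. mollifier t1 (x - y))"
proof -
  define F where "F = (\<lambda>(t, y). mollifier t (x - y))"
  have F: "smooth F" unfolding F_def by (rule smooth_mollifier_joint)
  have V: "y \<in> cball x r" if "t \<in> {t. exp t < r}" "F (t, y) \<noteq> 0" for t :: real and y
    using that mollifier_nonzeroD[of t "x - y"] by (auto simp: F_def dist_norm)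
  have openV: "open {t::real. exp t < r}" by (intro open_Collect_less continuous_intros)
  have D: "((\<lambda>t. T (\<lambda>y. F (t, y))) has_real_derivative T (\<lambda>y. dir_deriv (1, 0) F (t, y))) (at t)"
    if "exp t < r" for t
    using distribution_param_derivative[OF T compact_cball t(3) F openV V, where ?p0.0=0 and t=t and v=1] that by simp
  have "T (\<lambda>y. F (t0, y)) \<le> T (\<lambda>y. F (t1, y))"
  proof (rule DERIV_nonneg_imp_nondecreasing[OF t(1)])
    fix t assume "t0 \<le> t" "t \<le> t1"
    then have "exp t \<le> exp t1" by simp
    with t have tr: "exp t < r" by linarith
    define H where "H = (\<lambda>y. mollifier_primitive t (x - y))"
    have H: "H \<in> test_functions U"
    proof (rule test_functionsI)
      show "smooth H" unfolding H_def by (rule smooth_reflect[OF smooth_mollifier_primitive])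
      show "y \<in> cball x r" if "H y \<noteq> 0" for y
        using that mollifier_primitive_nonzeroD[of t "x - y"] tr by (auto simp: H_def dist_norm)
    qed (use t in auto)
    have "(\<lambda>y. dir_deriv (1, 0) F (t, y)) = (\<lambda>y. \<Sum>i\<in>Basis. dir_deriv i (dir_deriv i H) y)"
      unfolding F_def H_def mollifier_time_derivative ..
    then have "T (\<lambda>y. dir_deriv (1, 0) F (t, y)) = (\<Sum>i\<in>Basis. T (dir_deriv i (dir_deriv i H)))"
      by (simp add: distribution_linear(4)[OF T] test_functions_dir_deriv H)
    with D[OF tr] pos[OF H] show "\<exists>d. ((\<lambda>t. T (\<lambda>y. F (t, y))) has_real_derivative d) (at t) \<and> 0 \<le> d"
      by (auto simp: H_def mollifier_primitive_nonneg)
  qed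
  then show ?thesis by (simp add: F_def)
qed

subsection \<open>The mean value inequality for mollifications\<close>

text \<open>In the logarithmic polar coordinate \<open>s\<close> the circle means of a subharmonic function are convex
  and bounded near \<open>-\<infinity>\<close>, hence increasing.\<close>

lemma log_polar_mean_value:
  fixes v :: "real \<Rightarrow> real \<Rightarrow> real"
  assumes s1: "0 < s1"
    and vs: "\<And>s \<theta>. s < s1 \<Longrightarrow> ((\<lambda>s. v s \<theta>) has_real_derivative vs s \<theta>) (at s)"
    and vss: "\<And>s \<theta>. s < s1 \<Longrightarrow> ((\<lambda>s. vs s \<theta>) has_real_derivative vss s \<theta>) (at s)"
    and vtt: "\<And>s \<theta>. s < s1 \<Longrightarrow> (vt s has_real_derivative vtt s \<theta>) (at \<theta>)"
    and per: "\<And>s. s < s1 \<Longrightarrow> vt s (2 * pi) = vt s 0"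
    and cont: "continuous_on ({..<s1} \<times> UNIV) (\<lambda>(s, \<theta>). v s \<theta>)"
      "continuous_on ({..<s1} \<times> UNIV) (\<lambda>(s, \<theta>). vs s \<theta>)"
      "continuous_on ({..<s1} \<times> UNIV) (\<lambda>(s, \<theta>). vss s \<theta>)"
    and lap: "\<And>s \<theta>. s < s1 \<Longrightarrow> c * exp (2 * s) \<le> vss s \<theta> + vtt s \<theta>"
    and lim: "\<And>e. 0 < e \<Longrightarrow> \<exists>S. \<forall>s\<le>S. \<forall>\<theta>. \<bar>v s \<theta> - v0\<bar> \<le> e"
  shows "2 * pi * (v0 + c / 4) \<le> integral {0..2 * pi} (v 0)"
proof -
  let ?C = "{0..2 * pi}"
  have slice: "continuous_on S (f s)" if "continuous_on ({..<s1} \<times> UNIV) (\<lambda>(s, \<theta>). f s \<theta>)" "s < s1"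
    for f :: "real \<Rightarrow> real \<Rightarrow> real" and s S
    using that by (auto intro!: continuous_on_compose2[OF that(1), of S "Pair s", simplified] continuous_intros)
  note int = integrable_continuous_real[OF slice[OF cont(1)]] integrable_continuous_real[OF slice[OF cont(2)]]
    integrable_continuous_real[OF slice[OF cont(3)]]
  define M where "M = (\<lambda>s. integral ?C (v s))"
  define M1 where "M1 = (\<lambda>s. integral ?C (vs s))"
  define M2 where "M2 = (\<lambda>s. integral ?C (vss s))"
  have at: "at s within {..<s1} = at s" if "s < s1" for s
    using that by (intro at_within_open) auto
  have M: "(M has_real_derivative M1 s) (at s)" if "s < s1" for s
    using leibniz_rule_field_derivative[of "{..<s1}" 0 "2 * pi" v vs s] that vs int(1)
      continuous_on_subset[OF cont(2), of "{..<s1} \<times> ?C"]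
    unfolding M_def M1_def by (auto simp: at)
  have M1: "(M1 has_real_derivative M2 s) (at s)" if "s < s1" for s
    using leibniz_rule_field_derivative[of "{..<s1}" 0 "2 * pi" vs vss s] that vss int(2)
      continuous_on_subset[OF cont(3), of "{..<s1} \<times> ?C"]
    unfolding M1_def M2_def by (auto simp: at)
  \<comment> \<open>Integrated over a full period the angular second derivative vanishes, so the
    lower bound for the Laplacian becomes one for the second derivative of \<open>M\<close>.\<close>
  have M2: "2 * pi * c * exp (2 * s) \<le> M2 s" if s: "s < s1" for s
  proof -
    have vtt0: "(vtt s has_integral 0) ?C"
      using fundamental_theorem_of_calculus[of 0 "2 * pi" "vt s" "vtt s"] vtt[OF s] per[OF s]
      by (auto simp: has_real_derivative_iff_has_vector_derivative[symmetric]
          intro: has_field_derivative_at_within)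
    have i1: "((\<lambda>\<theta>. vss s \<theta> + vtt s \<theta>) has_integral (M2 s + 0)) ?C"
      unfolding M2_def using int(3)[OF s] vtt0 by (intro has_integral_add integrable_integral)
    have i2: "((\<lambda>\<theta>. c * exp (2 * s)) has_integral (2 * pi) *\<^sub>R (c * exp (2 * s))) ?C"
      using has_integral_const_real[of "c * exp (2 * s)" 0 "2 * pi"] by simp
    have "(2 * pi) *\<^sub>R (c * exp (2 * s)) \<le> M2 s + 0"
      using lap[OF s] by (intro has_integral_le[OF i2 i1])
    then show ?thesis by (simp add: mult_ac)
  qed
  \<comment> \<open>The subtracted term has second derivative
    \<open>2 * pi * c * exp (2 * s)\<close>, exactly the lower bound for that of \<open>M\<close>.
    Hence \<open>W\<close> is convex.\<close>
  define W where "W = (\<lambda>s. M s - pi * c / 2 * exp (2 * s))"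
  define W1 where "W1 = (\<lambda>s. M1 s - pi * c * exp (2 * s))"
  have W: "(W has_real_derivative W1 s) (at s)" if "s < s1" for s
    unfolding W_def W1_def using M[OF that] by (auto intro!: derivative_eq_intros)
  have W1: "(W1 has_real_derivative M2 s - 2 * pi * c * exp (2 * s)) (at s)" if "s < s1" for s
    unfolding W1_def using M1[OF that] by (auto intro!: derivative_eq_intros)
  have W1_mono: "W1 s \<le> W1 s'" if "s \<le> s'" "s' < s1" for s s'
    using that by (intro DERIV_nonneg_imp_nondecreasing[OF that(1)]) (meson M2 W1 diff_ge_0_iff_ge le_less_trans)
  have Mlim: "\<exists>S. \<forall>s\<le>S. \<bar>M s - 2 * pi * v0\<bar> \<le> e" if e: "0 < e" for e
  proof -
    obtain S where S: "\<And>s \<theta>. s \<le> S \<Longrightarrow> \<bar>v s \<theta> - v0\<bar> \<le> e / (2 * pi)"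
      using lim[of "e / (2 * pi)"] e by auto
    have "\<bar>M s - 2 * pi * v0\<bar> \<le> e" if "s \<le> min S 0" for s
    proof -
      have s: "s < s1" "s \<le> S" using that s1 by auto
      have *: "(v s has_integral M s) ?C" unfolding M_def using int(1)[OF s(1)] by (rule integrable_integral)
      have c: "((\<lambda>\<theta>. d) has_integral 2 * pi * d) ?C" for d :: real
        using has_integral_const_real[of d 0 "2 * pi"] by simp
      have b: "v0 - e / (2 * pi) \<le> v s \<theta>" "v s \<theta> \<le> v0 + e / (2 * pi)" for \<theta>
        using S[OF s(2), of \<theta>] by linarith+
      have "2 * pi * (v0 - e / (2 * pi)) \<le> M s"
        by (rule has_integral_le[OF c *]) (rule b)
      moreover have "M s \<le> 2 * pi * (v0 + e / (2 * pi))"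
        by (rule has_integral_le[OF * c]) (rule b)
      ultimately show ?thesis by (simp add: abs_le_iff algebra_simps)
    qed
    then show ?thesis by blast
  qed
  \<comment> \<open>A convex function with negative slope at \<open>s\<close> grows at least
    linearly towards \<open>-\<infinity>\<close>, but \<open>W\<close> stays bounded there.\<close>
  have W1_nonneg: "0 \<le> W1 s" if s: "s \<le> 0" for s
  proof (rule ccontr)
    assume neg: "\<not> 0 \<le> W1 s"
    obtain S where S: "\<And>s. s \<le> S \<Longrightarrow> \<bar>M s - 2 * pi * v0\<bar> \<le> 1" using Mlim[of 1] by auto
    define B where "B = 2 * pi * v0 + 1 + pi * \<bar>c\<bar> / 2"
    \<comment> \<open>So far to the left that the negative slope at \<open>s\<close> forces
      \<open>W r\<close> to be at least \<open>B + 1\<close>, while \<open>B\<close> bounds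
      \<open>W\<close> from above at all points left of both \<open>S\<close> and
      \<open>0\<close>.\<close>
    define r where "r = min S (s - (\<bar>B - W s\<bar> + 1) / (- W1 s))"
    have "(\<bar>B - W s\<bar> + 1) / (- W1 s) > 0" using neg by (intro divide_pos_pos) auto
    then have r: "r < s" "r \<le> S" by (auto simp: r_def min_less_iff_disj)
    have "\<exists>z. r < z \<and> z < s \<and> W s - W r = (s - r) * W1 z"
      by (rule MVT2[OF r(1)]) (use W s s1 in auto)
    then obtain z where z: "r < z" "z < s" "W s - W r = (s - r) * W1 z" by blast
    have "(s - r) * W1 z \<le> (s - r) * W1 s"
      using r z s s1 by (intro mult_left_mono W1_mono) auto
    also have "(\<bar>B - W s\<bar> + 1) / (- W1 s) \<le> s - r" by (simp add: r_def)
    then have "(s - r) * W1 s \<le> - (\<bar>B - W s\<bar> + 1)" using neg by (simp add: field_simps)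
    finally have "W r \<ge> B + 1" using z(3) by linarith
    moreover have "W r \<le> B"
    proof -
      have "M r \<le> 2 * pi * v0 + 1" using S[OF r(2)] by linarith
      moreover have "- (pi * c / 2) * exp (2 * r) \<le> pi * \<bar>c\<bar> / 2 * 1"
      proof (rule order_trans)
        show "- (pi * c / 2) * exp (2 * r) \<le> (pi * \<bar>c\<bar> / 2) * exp (2 * r)"
          by (intro mult_right_mono) (auto simp: abs_if)
        show "pi * \<bar>c\<bar> / 2 * exp (2 * r) \<le> pi * \<bar>c\<bar> / 2 * 1"
          using r s by (intro mult_left_mono) auto
      qed
      ultimately show ?thesis by (simp add: W_def B_def)
    qed
    ultimately show False by linarith
  qed
  have W_mono: "W s \<le> W 0" if "s \<le> 0" for s
    using that s1 by (intro DERIV_nonneg_imp_nondecreasing[OF that]) (meson W W1_nonneg le_less_trans)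
  have "2 * pi * v0 \<le> W 0"
  proof (rule field_le_epsilon)
    fix e :: real assume e: "0 < e"
    obtain S where S: "\<And>s. s \<le> S \<Longrightarrow> \<bar>M s - 2 * pi * v0\<bar> \<le> e / 2" using Mlim[of "e / 2"] e by auto
    \<comment> \<open>Once \<open>exp (2 * r)\<close> is at most \<open>d\<close>, the difference
      between \<open>W r\<close> and \<open>M r\<close> costs at most \<open>e / 2\<close>; the
      other half is spent on the limit of \<open>M\<close>.\<close>
    define d where "d = e / (pi * \<bar>c\<bar> + 1)"
    have pc: "pi * \<bar>c\<bar> + 1 > 0" by (simp add: add_nonneg_pos)
    have d: "d > 0" unfolding d_def using e pc by (rule divide_pos_pos)
    define r where "r = min (min S 0) (ln d / 2)"
    have "exp (2 * r) \<le> exp (ln d)" by (simp add: r_def)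
    then have er: "exp (2 * r) \<le> d" using d by simp
    have "(pi * c / 2) * exp (2 * r) \<le> (pi * \<bar>c\<bar> / 2) * exp (2 * r)"
      by (intro mult_right_mono) (auto simp: abs_if)
    also have "\<dots> \<le> (pi * \<bar>c\<bar> / 2) * d" using er by (intro mult_left_mono) auto
    also have "\<dots> \<le> e / 2" using e pc by (simp add: d_def field_simps)
    finally have "(pi * c / 2) * exp (2 * r) \<le> e / 2" .
    moreover have "W r \<le> W 0" by (rule W_mono) (simp add: r_def)
    moreover have "2 * pi * v0 - e / 2 \<le> M r"
    proof -
      have "r \<le> S" by (simp add: r_def)
      from S[OF this] show ?thesis by linarith
    qed
    ultimately show "2 * pi * v0 \<le> W 0 + e" unfolding W_def by linarith
  qed
  \<comment> \<open>At \<open>s = 0\<close> the subtracted term is \<open>pi * c / 2\<close>, which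
    is \<open>2 * pi\<close> times the gain \<open>c / 4\<close>.\<close>
  then show ?thesis by (simp add: W_def M_def algebra_simps)
qed

lemma mollification_continuous:
  fixes U :: "'a::euclidean_space set"
  assumes T: "T \<in> distributions U" and g: "smooth g" "\<And>z. g z \<noteq> 0 \<Longrightarrow> norm z \<le> \<rho>"
    and r: "cball a r \<subseteq> U" "\<rho> < r"
  shows "isCont (\<lambda>x. T (\<lambda>y. g (x - y))) a"
proof -
  have F: "smooth (\<lambda>p::'a \<times> 'a. g (fst p - snd p))"
  proof (rule smooth_compose[OF g(1)])
    show "smooth (\<lambda>p::'a \<times> 'a. (fst p - snd p) \<bullet> i)" for i :: 'a
      by (simp add: inner_diff_left smooth_diff smooth_fst[of "\<lambda>x. x \<bullet> i"] smooth_snd[of "\<lambda>x. x \<bullet> i"])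
  qed
  have "y \<in> cball a r" if "x \<in> ball a (r - \<rho>)" "g (x - y) \<noteq> 0" for x y
  proof -
    have "norm (x - y) \<le> \<rho>" using g(2) that(2) by blast
    then show ?thesis using dist_triangle[of a y x] that(1) by (simp add: dist_norm)
  qed
  then have "((\<lambda>x. T (\<lambda>y. g (fst (x, y) - snd (x, y)))) \<longlongrightarrow> T (\<lambda>y. g (fst (a, y) - snd (a, y)))) (at a within UNIV)"
    using r by (intro distribution_param_continuous[OF T compact_cball r(1) F, of "ball a (r - \<rho>)"]) auto
  then show ?thesis by (simp add: continuous_within)
qed

text \<open>In the coordinates \<open>a + exp s *\<^sub>R (cos \<theta> *\<^sub>R b + sin \<theta>
  *\<^sub>R b')\<close> the Laplacian in \<open>s\<close> and \<open>\<theta>\<close> is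
  \<open>exp (2 * s)\<close> times the sum of the second derivatives along \<open>b\<close> and
  \<open>b'\<close>. This puts \<open>T\<close> applied to the shifted \<open>g\<close> into the
  form of \<open>log_polar_mean_value\<close>. The vector \<open>b'\<close> will be
  \<open>\<i> *s b\<close>.\<close>

lemma distribution_mean_value:
  fixes U :: "'a::euclidean_space set"
  assumes T: "T \<in> distributions U" and g: "smooth g" "\<And>z. g z \<noteq> 0 \<Longrightarrow> norm z \<le> \<rho>"
    and R: "cball a (R + \<rho>) \<subseteq> U" "norm b < R"
    and b': "\<And>\<theta>. norm (cos \<theta> *\<^sub>R b + sin \<theta> *\<^sub>R b') \<le> norm b"
    and lap: "\<And>x. x \<in> cball a R \<Longrightarrow>
      c \<le> T (\<lambda>y. dir_deriv b (dir_deriv b g) (x - y)) + T (\<lambda>y. dir_deriv b' (dir_deriv b' g) (x - y))"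
  shows "2 * pi * (T (\<lambda>y. g (a - y)) + c / 4) \<le>
    integral {0..2 * pi} (\<lambda>\<theta>. T (\<lambda>y. g (a + (cos \<theta> *\<^sub>R b + sin \<theta> *\<^sub>R b') - y)))"
proof -
  define X where "X = (\<lambda>p :: (real \<times> real) \<times> 'a. a + exp (fst (fst p)) *\<^sub>R
      (cos (snd (fst p)) *\<^sub>R b + sin (snd (fst p)) *\<^sub>R b') - snd p)"
  \<comment> \<open>\<open>A\<close> and \<open>B\<close> are the Cartesian coordinates of the disc
    in logarithmic polar form. Both are fixed by the \<open>s\<close> derivative, and the
    \<open>\<theta>\<close> derivative sends \<open>A\<close> to \<open>- B\<close> and
    \<open>B\<close> to \<open>A\<close>.\<close>
  define A where "A = (\<lambda>p :: (real \<times> real) \<times> 'a. exp (fst (fst p)) * cos (snd (fst p)))"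
  define B where "B = (\<lambda>p :: (real \<times> real) \<times> 'a. exp (fst (fst p)) * sin (snd (fst p)))"
  define e1 e2 :: "real \<times> real" where "e1 = (1, 0)" and "e2 = (0, 1)"
  have sm_s: "smooth (\<lambda>p :: (real \<times> real) \<times> 'a. fst (fst p))"
    and sm_t: "smooth (\<lambda>p :: (real \<times> real) \<times> 'a. snd (fst p))"
    by (rule smooth_fst[OF smooth_fst[OF smooth_ident]], rule smooth_fst[OF smooth_snd[OF smooth_ident]])
  have smA: "smooth A" and smB: "smooth B"
    unfolding A_def B_def
    by (intro smooth_mult smooth_compose_real[OF smooth_exp sm_s]
        smooth_compose_real[OF smooth_sin_cos(1) sm_t] smooth_compose_real[OF smooth_sin_cos(2) sm_t])+
  have X_alt: "X p = a + A p *\<^sub>R b + B p *\<^sub>R b' - snd p" for p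
    by (simp add: X_def A_def B_def scaleR_add_right)
  have smX: "smooth (\<lambda>p. h (X p))" if "smooth h" for h :: "'a \<Rightarrow> real"
  proof (rule smooth_compose[OF that])
    fix i :: 'a
    have "(\<lambda>p. X p \<bullet> i) = (\<lambda>p. a \<bullet> i + (b \<bullet> i) * A p + (b' \<bullet> i) * B p - snd p \<bullet> i)"
      by (simp add: X_alt inner_add_left inner_diff_left mult.commute)
    then show "smooth (\<lambda>p. X p \<bullet> i)"
      by (auto intro!: smooth_add smooth_diff smooth_cmult smA smB smooth_snd[of "\<lambda>x. x \<bullet> i"])
  qed
  have line: "dir_deriv w G p = d"
    if "smooth G" "((\<lambda>\<tau>. G (p + \<tau> *\<^sub>R w)) has_real_derivative d) (at 0)" for G :: "(real \<times> real) \<times> 'a \<Rightarrow> real" and w p d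
    using has_derivative_along_line[of G p 0 w] smooth_differentiable[OF that(1)] by (intro DERIV_unique[OF _ that(2)]) simp
  have AB: "A (((s, \<theta>), y) + \<tau> *\<^sub>R (e1, 0)) = exp (s + \<tau>) * cos \<theta>"
      "B (((s, \<theta>), y) + \<tau> *\<^sub>R (e1, 0)) = exp (s + \<tau>) * sin \<theta>"
      "A (((s, \<theta>), y) + \<tau> *\<^sub>R (e2, 0)) = exp s * cos (\<theta> + \<tau>)"
      "B (((s, \<theta>), y) + \<tau> *\<^sub>R (e2, 0)) = exp s * sin (\<theta> + \<tau>)"
    and AB0: "A ((s, \<theta>), y) = exp s * cos \<theta>" "B ((s, \<theta>), y) = exp s * sin \<theta>" for s \<theta> \<tau> y
    by (simp_all add: A_def B_def e1_def e2_def)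
  have derA: "((\<lambda>\<tau>. A (p + \<tau> *\<^sub>R (e1, 0))) has_real_derivative A p) (at 0)"
      "((\<lambda>\<tau>. A (p + \<tau> *\<^sub>R (e2, 0))) has_real_derivative - B p) (at 0)"
    and derB: "((\<lambda>\<tau>. B (p + \<tau> *\<^sub>R (e1, 0))) has_real_derivative B p) (at 0)"
      "((\<lambda>\<tau>. B (p + \<tau> *\<^sub>R (e2, 0))) has_real_derivative A p) (at 0)" for p
  proof -
    obtain s \<theta> y where p: "p = ((s, \<theta>), y)" by (metis prod.collapse)
    show "((\<lambda>\<tau>. A (p + \<tau> *\<^sub>R (e1, 0))) has_real_derivative A p) (at 0)"
      "((\<lambda>\<tau>. A (p + \<tau> *\<^sub>R (e2, 0))) has_real_derivative - B p) (at 0)"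
      "((\<lambda>\<tau>. B (p + \<tau> *\<^sub>R (e1, 0))) has_real_derivative B p) (at 0)"
      "((\<lambda>\<tau>. B (p + \<tau> *\<^sub>R (e2, 0))) has_real_derivative A p) (at 0)"
      unfolding p AB AB0 by (auto intro!: derivative_eq_intros)
  qed
  note A1 = line[OF smA derA(1)] and A2 = line[OF smA derA(2)]
    and B1 = line[OF smB derB(1)] and B2 = line[OF smB derB(2)]
  have X1: "dir_deriv (e1, 0) (\<lambda>p. h (X p)) = (\<lambda>p. A p * dir_deriv b h (X p) + B p * dir_deriv b' h (X p))"
    and X2: "dir_deriv (e2, 0) (\<lambda>p. h (X p)) = (\<lambda>p. - B p * dir_deriv b h (X p) + A p * dir_deriv b' h (X p))"
    if h: "smooth h" for h :: "'a \<Rightarrow> real"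
  proof -
    have der: "dir_deriv (e, 0) (\<lambda>p. h (X p)) p = \<alpha> * dir_deriv b h (X p) + \<beta> * dir_deriv b' h (X p)"
      if "((\<lambda>\<tau>. X (p + \<tau> *\<^sub>R (e, 0))) has_derivative (\<lambda>k. k *\<^sub>R (\<alpha> *\<^sub>R b + \<beta> *\<^sub>R b'))) (at 0)" for e p \<alpha> \<beta>
    proof (rule line[OF smX[OF h]])
      have "(h has_derivative (\<lambda>v. dir_deriv v h (X p))) (at (X (p + 0 *\<^sub>R (e, 0))))"
        unfolding scaleR_zero_left add_0_right by (rule has_derivative_dir_deriv[OF smooth_differentiable[OF h]])
      from has_derivative_compose[OF that this]
      show "((\<lambda>\<tau>. h (X (p + \<tau> *\<^sub>R (e, 0)))) has_real_derivative \<alpha> * dir_deriv b h (X p) + \<beta> * dir_deriv b' h (X p)) (at 0)"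
        using smooth_differentiable[OF h]
        by (simp add: has_field_derivative_def dir_deriv_scale_direction dir_deriv_add_direction mult_commute_abs)
    qed
    have derX: "((\<lambda>\<tau>. X (p + \<tau> *\<^sub>R (e, 0))) has_derivative (\<lambda>k. k *\<^sub>R (\<alpha> *\<^sub>R b + \<beta> *\<^sub>R b'))) (at 0)"
      if "((\<lambda>\<tau>. A (p + \<tau> *\<^sub>R (e, 0))) has_real_derivative \<alpha>) (at 0)"
        "((\<lambda>\<tau>. B (p + \<tau> *\<^sub>R (e, 0))) has_real_derivative \<beta>) (at 0)" for e p \<alpha> \<beta>
    proof -
      have "((\<lambda>\<tau>. a + A (p + \<tau> *\<^sub>R (e, 0)) *\<^sub>R b + B (p + \<tau> *\<^sub>R (e, 0)) *\<^sub>R b' - snd p) has_derivative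
          (\<lambda>k. 0 + (\<alpha> * k) *\<^sub>R b + (\<beta> * k) *\<^sub>R b' - 0)) (at 0)"
        using that unfolding has_field_derivative_def
        by (intro has_derivative_add has_derivative_diff has_derivative_const has_derivative_scaleR_left) auto
      moreover have "X (p + \<tau> *\<^sub>R (e, 0)) = a + A (p + \<tau> *\<^sub>R (e, 0)) *\<^sub>R b + B (p + \<tau> *\<^sub>R (e, 0)) *\<^sub>R b' - snd p" for \<tau>
        by (simp add: X_alt)
      ultimately show ?thesis by (simp add: scaleR_add_right mult.commute)
    qed
    show "dir_deriv (e1, 0) (\<lambda>p. h (X p)) = (\<lambda>p. A p * dir_deriv b h (X p) + B p * dir_deriv b' h (X p))"
      by (intro ext der derX derA derB)
    show "dir_deriv (e2, 0) (\<lambda>p. h (X p)) = (\<lambda>p. - B p * dir_deriv b h (X p) + A p * dir_deriv b' h (X p))"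
      by (intro ext der derX derA derB)
  qed
  define F where "F = (\<lambda>p. g (X p))"
  have F: "smooth F" unfolding F_def by (rule smX[OF g(1)])
  note smg = smooth_dir_deriv[OF g(1)]
  \<comment> \<open>The first-order terms of the two second derivatives have opposite signs, and so
    do the mixed terms with factor \<open>A * B\<close>. What remains carries the factor
    \<open>A * A + B * B\<close>.\<close>
  have laplace: "dir_deriv (e1, 0) (dir_deriv (e1, 0) F) p + dir_deriv (e2, 0) (dir_deriv (e2, 0) F) p =
      exp (2 * fst (fst p)) * (dir_deriv b (dir_deriv b g) (X p) + dir_deriv b' (dir_deriv b' g) (X p))" for p
  proof -
    note dd = smooth_differentiable[OF smX[OF smg]] smooth_differentiable[OF smA] smooth_differentiable[OF smB]
      smooth_differentiable[OF smooth_minus[OF smB]] smooth_differentiable[OF smooth_mult[OF smA smX[OF smg]]]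
      smooth_differentiable[OF smooth_mult[OF smB smX[OF smg]]]
      smooth_differentiable[OF smooth_mult[OF smooth_minus[OF smB] smX[OF smg]]]
    have mB: "dir_deriv (e2, 0) (\<lambda>p. - B p) p = - A p"
      using dir_deriv_cmult[OF smooth_differentiable[OF smB], of "(e2, 0)" "-1"] by (simp add: B2)
    have "exp (2 * fst (fst p)) = A p * A p + B p * B p"
    proof -
      have "A p * A p + B p * B p = exp (fst (fst p)) * exp (fst (fst p)) * ((cos (snd (fst p)))\<^sup>2 + (sin (snd (fst p)))\<^sup>2)"
        unfolding A_def B_def by algebra
      then show ?thesis by (simp flip: exp_add)
    qed
    then show ?thesis
      unfolding F_def X1[OF g(1)] X2[OF g(1)]
      by (simp only: dir_deriv_add[OF dd(5,6)] dir_deriv_add[OF dd(7,5)] dir_deriv_mult[OF dd(2,1)]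
          dir_deriv_mult[OF dd(3,1)] dir_deriv_mult[OF dd(4,1)] A1 A2 B1 B2 mB X1[OF smg] X2[OF smg])
         (simp add: algebra_simps)
  qed
  define K where "K = cball a (R + \<rho>)"
  have K: "compact K" "K \<subseteq> U" using R by (auto simp: K_def)
  define V where "V = {p :: real \<times> real. exp (fst p) * norm b < R}"
  have V: "open V" unfolding V_def by (intro open_Collect_less continuous_intros)
  have disc: "a + exp s *\<^sub>R (cos \<theta> *\<^sub>R b + sin \<theta> *\<^sub>R b') \<in> cball a R" if "(s, \<theta>) \<in> V" for s \<theta>
  proof -
    have "exp s * norm (cos \<theta> *\<^sub>R b + sin \<theta> *\<^sub>R b') \<le> exp s * norm b"
      by (intro mult_left_mono b') auto
    also have "\<dots> < R" using that by (simp add: V_def)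
    finally show ?thesis by (simp add: dist_norm)
  qed
  have supp_x: "y \<in> K" if "x \<in> cball a R" "norm (x - y) \<le> \<rho>" for x y
    using that dist_triangle[of a y x] by (simp add: K_def dist_norm)
  have supp_F: "y \<in> K" if "p \<in> V" "F (p, y) \<noteq> 0" for p y
    using that supp_x[OF disc[of "fst p" "snd p"], of y] g(2) by (auto simp: F_def X_def)
  note F1 = smooth_dir_deriv[OF F]
  note supp_F1 = dir_deriv_param_support[OF F V supp_F]
  have supp_F2: "y \<in> K" if "p \<in> V" "dir_deriv (w, 0) (dir_deriv (v, 0) F) (p, y) \<noteq> 0" for p y v w
    using dir_deriv_param_support[OF F1 V supp_F1 that] .
  define v where "v = (\<lambda>s \<theta>. T (\<lambda>y. F ((s, \<theta>), y)))"
  define vs where "vs = (\<lambda>s \<theta>. T (\<lambda>y. dir_deriv (e1, 0) F ((s, \<theta>), y)))"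
  define vt where "vt = (\<lambda>s \<theta>. T (\<lambda>y. dir_deriv (e2, 0) F ((s, \<theta>), y)))"
  define vss where "vss = (\<lambda>s \<theta>. T (\<lambda>y. dir_deriv (e1, 0) (dir_deriv (e1, 0) F) ((s, \<theta>), y)))"
  define vtt where "vtt = (\<lambda>s \<theta>. T (\<lambda>y. dir_deriv (e2, 0) (dir_deriv (e2, 0) F) ((s, \<theta>), y)))"
  \<comment> \<open>Positive because \<open>norm b < R\<close>, and
    \<open>exp s1 * norm b < R\<close>: the circles may be enlarged slightly beyond
    \<open>s = 0\<close> without leaving the ball where the Laplacian bound holds. The formula also
    makes sense for \<open>b = 0\<close>.\<close>
  define s1 where "s1 = ln (2 * R / (R + norm b))"
  have Rpos: "R > 0" using R(2) norm_ge_zero[of b] by linarith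
  have s1: "s1 > 0" unfolding s1_def using R(2) Rpos by (intro ln_gt_zero) (simp add: field_simps add_pos_nonneg)
  have inV: "(s, \<theta>) \<in> V" if "s < s1" for s \<theta>
  proof -
    have "exp s < exp s1" using that by simp
    also have "exp s1 = 2 * R / (R + norm b)"
      unfolding s1_def using Rpos by (intro exp_ln) (simp add: add_pos_nonneg)
    finally have "exp s * norm b \<le> 2 * R / (R + norm b) * norm b" by (intro mult_right_mono) auto
    also have "\<dots> < R" using Rpos R(2) by (simp add: field_simps add_pos_nonneg)
    finally show ?thesis by (simp add: V_def)
  qed
  have cont: "continuous_on ({..<s1} \<times> UNIV) (\<lambda>(s, \<theta>). T (\<lambda>y. G ((s, \<theta>), y)))"
    if "smooth G" and gsupp: "\<And>p y. p \<in> V \<Longrightarrow> G (p, y) \<noteq> 0 \<Longrightarrow> y \<in> K" for G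
  proof -
    have "((\<lambda>q. T (\<lambda>y. G (q, y))) \<longlongrightarrow> T (\<lambda>y. G (q, y))) (at q within S)" if "q \<in> V" for q S
      using \<open>smooth G\<close> by (rule distribution_param_continuous[OF T K _ V _ that]) (rule gsupp)
    then show ?thesis using inV by (auto simp: continuous_on_def case_prod_beta)
  qed
  have der1: "((\<lambda>s. T (\<lambda>y. G ((s, \<theta>), y))) has_real_derivative T (\<lambda>y. dir_deriv (e1, 0) G ((s, \<theta>), y))) (at s)"
    and der2: "((\<lambda>\<theta>. T (\<lambda>y. G ((s, \<theta>), y))) has_real_derivative T (\<lambda>y. dir_deriv (e2, 0) G ((s, \<theta>), y))) (at \<theta>)"
    if "smooth G" "\<And>p y. p \<in> V \<Longrightarrow> G (p, y) \<noteq> 0 \<Longrightarrow> y \<in> K" "s < s1" for G s \<theta>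
    using distribution_param_derivative[OF T K that(1) V that(2), where ?p0.0="(0, \<theta>)" and t=s and v=e1]
      distribution_param_derivative[OF T K that(1) V that(2), where ?p0.0="(s, 0)" and t=\<theta> and v=e2]
      inV[OF that(3)] by (simp_all add: e1_def e2_def)
  have "2 * pi * (T (\<lambda>y. g (a - y)) + c / 4) \<le> integral {0..2 * pi} (v 0)"
  proof (rule log_polar_mean_value[OF s1])
    show "((\<lambda>s. v s \<theta>) has_real_derivative vs s \<theta>) (at s)" if "s < s1" for s \<theta>
      unfolding v_def vs_def by (rule der1[OF F supp_F that])
    show "((\<lambda>s. vs s \<theta>) has_real_derivative vss s \<theta>) (at s)" if "s < s1" for s \<theta>
      unfolding vs_def vss_def by (rule der1[OF F1 supp_F1 that])
    show "(vt s has_real_derivative vtt s \<theta>) (at \<theta>)" if "s < s1" for s \<theta>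
      unfolding vt_def vtt_def by (rule der2[OF F1 supp_F1 that])
    show "vt s (2 * pi) = vt s 0" for s
      unfolding vt_def F_def X2[OF g(1)] by (simp add: A_def B_def X_def)
    show "continuous_on ({..<s1} \<times> UNIV) (\<lambda>(s, \<theta>). v s \<theta>)" unfolding v_def by (rule cont[OF F supp_F])
    show "continuous_on ({..<s1} \<times> UNIV) (\<lambda>(s, \<theta>). vs s \<theta>)" unfolding vs_def by (rule cont[OF F1 supp_F1])
    show "continuous_on ({..<s1} \<times> UNIV) (\<lambda>(s, \<theta>). vss s \<theta>)"
      unfolding vss_def by (rule cont[OF smooth_dir_deriv[OF F1] supp_F2])
    show "c * exp (2 * s) \<le> vss s \<theta> + vtt s \<theta>" if s: "s < s1" for s \<theta>
    proof -
      define x where "x = a + exp s *\<^sub>R (cos \<theta> *\<^sub>R b + sin \<theta> *\<^sub>R b')"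
      have x: "x \<in> cball a R" unfolding x_def by (rule disc[OF inV[OF s]])
      have test: "(\<lambda>y. G ((s, \<theta>), y)) \<in> test_functions U"
        if "smooth G" "\<And>p y. p \<in> V \<Longrightarrow> G (p, y) \<noteq> 0 \<Longrightarrow> y \<in> K" for G
        by (rule test_functionsI[OF smooth_slice[OF that(1)] K]) (rule that(2)[OF inV[OF s]])
      have test_g: "(\<lambda>y. dir_deriv w (dir_deriv w g) (x - y)) \<in> test_functions U" for w
      proof (rule test_functionsI[OF smooth_reflect[OF smooth_dir_deriv[OF smg]] K])
        fix y assume "dir_deriv w (dir_deriv w g) (x - y) \<noteq> 0"
        then have "x - y \<in> supp (dir_deriv w (dir_deriv w g))"
          using not_in_supp[of "x - y" "dir_deriv w (dir_deriv w g)"] by blast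
        moreover have "supp g \<subseteq> cball 0 \<rho>" by (rule supp_subsetI) (use g(2) in auto)
        ultimately have "x - y \<in> cball 0 \<rho>"
          using supp_dir_deriv[of w "dir_deriv w g"] supp_dir_deriv[of w g] by blast
        then have "norm (x - y) \<le> \<rho>" by simp
        then show "y \<in> K" by (rule supp_x[OF x])
      qed
      have "vss s \<theta> + vtt s \<theta> = T (\<lambda>y. dir_deriv (e1, 0) (dir_deriv (e1, 0) F) ((s, \<theta>), y) +
          dir_deriv (e2, 0) (dir_deriv (e2, 0) F) ((s, \<theta>), y))"
        unfolding vss_def vtt_def
        by (rule distribution_linear(1)[OF T test[OF smooth_dir_deriv[OF F1] supp_F2] test[OF smooth_dir_deriv[OF F1] supp_F2], symmetric])
      also have "\<dots> = T (\<lambda>y. exp (2 * s) * (dir_deriv b (dir_deriv b g) (x - y) + dir_deriv b' (dir_deriv b' g) (x - y)))"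
        unfolding laplace by (simp add: X_def x_def)
      also have "\<dots> = exp (2 * s) * (T (\<lambda>y. dir_deriv b (dir_deriv b g) (x - y)) + T (\<lambda>y. dir_deriv b' (dir_deriv b' g) (x - y)))"
        by (simp only: distribution_linear(1,2)[OF T] test_g test_functions_add)
      also have "\<dots> \<ge> exp (2 * s) * c" using lap[OF x] by (intro mult_left_mono) auto
      finally show ?thesis by (simp add: mult.commute)
    qed
    fix e :: real assume e: "0 < e"
    have "isCont (\<lambda>x. T (\<lambda>y. g (x - y))) a"
      by (rule mollification_continuous[OF T g R(1)]) (use Rpos in auto)
    then obtain d where d: "d > 0" "\<And>x. dist x a < d \<Longrightarrow> \<bar>T (\<lambda>y. g (x - y)) - T (\<lambda>y. g (a - y))\<bar> < e"
      using e unfolding continuous_at_eps_delta dist_real_def by meson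
    \<comment> \<open>For \<open>s \<le> S\<close> the circle lies in the ball of radius
      \<open>d\<close> where continuity at the centre applies; adding \<open>1\<close> covers
      \<open>b = 0\<close>.\<close>
    define S where "S = ln (d / (norm b + 1))"
    have bp: "norm b + 1 > 0" by (simp add: add_nonneg_pos)
    have "\<bar>v s \<theta> - T (\<lambda>y. g (a - y))\<bar> \<le> e" if "s \<le> S" for s \<theta>
    proof -
      have "exp s \<le> d / (norm b + 1)"
        proof -
        have "exp s \<le> exp S" using that by simp
        also have "exp S = d / (norm b + 1)" unfolding S_def using d(1) bp by simp
        finally show ?thesis .
      qed
      have "exp s * norm (cos \<theta> *\<^sub>R b + sin \<theta> *\<^sub>R b') \<le> exp s * norm b"
        by (intro mult_left_mono b') auto
      also have "\<dots> \<le> d / (norm b + 1) * norm b" using \<open>exp s \<le> _\<close> by (intro mult_right_mono) auto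
      also have "\<dots> < d" using d(1) bp by (simp add: field_simps)
      finally show ?thesis
        using d(2)[of "a + exp s *\<^sub>R (cos \<theta> *\<^sub>R b + sin \<theta> *\<^sub>R b')"]
        by (simp add: v_def F_def X_def dist_norm less_imp_le)
    qed
    then show "\<exists>S. \<forall>s\<le>S. \<forall>\<theta>. \<bar>v s \<theta> - T (\<lambda>y. g (a - y))\<bar> \<le> e" by blast
  qed
  then show ?thesis by (simp add: v_def F_def X_def[abs_def])
qed

subsection \<open>Convergence of mollifications\<close>

lemma integrable_test_function:
  assumes "f \<in> test_functions U"
  shows "integrable lborel f"
  by (rule integrable_continuous_compact_support[of "supp f"])
     (use assms not_in_supp[of _ f] in \<open>auto simp: test_functions_def smooth_continuous_on\<close>)

lemma integral_translate:
  fixes f :: "'a::euclidean_space \<Rightarrow> real"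
  assumes [measurable]: "f \<in> borel_measurable borel"
  shows "(LINT x|lborel. f (c + x)) = (LINT x|lborel. f x)"
    and "integrable lborel (\<lambda>x. f (c + x)) \<longleftrightarrow> integrable lborel f"
proof -
  have "(LINT x|lborel. f x) = (LINT x|distr lborel borel ((+) c). f x)"
    by (simp only: lborel_distr_plus)
  also have "\<dots> = (LINT x|lborel. f (c + x))" by (rule integral_distr) auto
  finally show "(LINT x|lborel. f (c + x)) = (LINT x|lborel. f x)" ..
  have "integrable lborel f \<longleftrightarrow> integrable (distr lborel borel ((+) c)) f"
    by (simp only: lborel_distr_plus)
  also have "\<dots> \<longleftrightarrow> integrable lborel (\<lambda>x. f (c + x))" by (rule integrable_distr_eq) auto
  finally show "integrable lborel (\<lambda>x. f (c + x)) \<longleftrightarrow> integrable lborel f" ..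
qed

lemma integral_reflect_lborel:
  fixes f :: "'a::euclidean_space \<Rightarrow> real"
  assumes [measurable]: "f \<in> borel_measurable borel"
  shows "(LINT x|lborel. f (c - x)) = (LINT x|lborel. f x)"
    and "integrable lborel (\<lambda>x. f (c - x)) \<longleftrightarrow> integrable lborel f"
proof -
  have "lborel = density (distr lborel borel (\<lambda>x::'a. c + (-1) *\<^sub>R x)) (\<lambda>_. ennreal (\<bar>-1\<bar> ^ DIM('a)))"
    by (rule lborel_affine) simp
  then have eq: "distr lborel borel (\<lambda>x. c - x) = (lborel :: 'a measure)"
    by (simp add: density_1)
  have "(LINT x|lborel. f x) = (LINT x|distr lborel borel (\<lambda>x. c - x). f x)"
    by (simp only: eq)
  also have "\<dots> = (LINT x|lborel. f (c - x))" by (rule integral_distr) auto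
  finally show "(LINT x|lborel. f (c - x)) = (LINT x|lborel. f x)" ..
  have "integrable lborel f \<longleftrightarrow> integrable (distr lborel borel (\<lambda>x. c - x)) f"
    by (simp only: eq)
  also have "\<dots> \<longleftrightarrow> integrable lborel (\<lambda>x. f (c - x))" by (rule integrable_distr_eq) auto
  finally show "integrable lborel (\<lambda>x. f (c - x)) \<longleftrightarrow> integrable lborel f" ..
qed

text \<open>Difference quotients have integral \<open>0\<close> by translation invariance, and they
  converge to the derivative under a bounded, compactly supported majorant.\<close>

lemma integral_dir_deriv:
  fixes f :: "'a::euclidean_space \<Rightarrow> real"
  assumes f: "f \<in> test_functions UNIV"
  shows "(LINT x|lborel. dir_deriv v f x) = 0"
proof -
  note sf = test_functionsD(1)[OF f]
  have [measurable]: "f \<in> borel_measurable borel" by (rule smooth_measurable[OF sf])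
  have [measurable]: "dir_deriv v f \<in> borel_measurable borel"
    by (rule smooth_measurable[OF smooth_dir_deriv[OF sf]])
  obtain B where B: "B > 0" "\<And>x. \<bar>dir_deriv v f x\<bar> \<le> B"
    using test_functions_bounded[OF test_functions_dir_deriv[OF f, of v]] by blast
  obtain r where r: "\<And>x. x \<in> supp f \<Longrightarrow> norm x \<le> r"
    using compact_imp_bounded[OF test_functionsD(2)[OF f]] unfolding bounded_iff by blast
  \<comment> \<open>Steps of size at most \<open>1\<close> move points by at most
    \<open>norm v\<close>, so all quotients vanish outside the ball of radius
    \<open>r + norm v\<close>.\<close>
  define h where "h = (\<lambda>n. 1 / real (Suc n))"
  have h: "0 < h n" "h n \<le> 1" for n by (auto simp: h_def)
  define q where "q = (\<lambda>n x. (f (x + h n *\<^sub>R v) - f x) / h n)"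
  have q0: "(LINT x|lborel. q n x) = 0" for n
  proof -
    have "integrable lborel f" by (rule integrable_test_function[OF f])
    then show ?thesis
      unfolding q_def using integral_translate[of f "h n *\<^sub>R v"] by (simp add: add.commute)
  qed
  have "(\<lambda>n. LINT x|lborel. q n x) \<longlonglongrightarrow> (LINT x|lborel. dir_deriv v f x)"
  proof (rule integral_dominated_convergence)
    show "dir_deriv v f \<in> borel_measurable lborel" by simp
    show "q n \<in> borel_measurable lborel" for n unfolding q_def by measurable
    show "integrable lborel (\<lambda>x::'a. B * indicator (cball 0 (r + norm v)) x)"
      by (intro integrable_mult_right integrable_real_indicator emeasure_compact_finite) auto
    have "(\<lambda>n. q n x) \<longlonglongrightarrow> dir_deriv v f x" for x
    proof -
      have "((\<lambda>s. (f (x + s *\<^sub>R v) - f x) / s) \<longlongrightarrow> dir_deriv v f x) (at 0)"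
        using has_derivative_along_line[of f x 0 v] smooth_differentiable[OF sf]
        by (simp add: has_field_derivative_iff)
      moreover have "filterlim h (at 0) sequentially"
        unfolding h_def filterlim_at using LIMSEQ_inverse_real_of_nat by (auto simp: inverse_eq_divide)
      ultimately show ?thesis unfolding q_def by (rule filterlim_compose)
    qed
    then show "AE x in lborel. (\<lambda>n. q n x) \<longlonglongrightarrow> dir_deriv v f x" by simp
    have "norm (q n x) \<le> B * indicator (cball 0 (r + norm v)) x" for n x
    proof (cases "x \<in> cball 0 (r + norm v)")
      case True
      obtain \<xi> where "f (x + h n *\<^sub>R v) - f x = h n * dir_deriv v f (x + \<xi> *\<^sub>R v)"
        using mean_value_along_line[OF sf] by blast
      then show ?thesis using True B(2)[of "x + \<xi> *\<^sub>R v"] h(1)[of n] by (simp add: q_def abs_mult)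
    next
      case False
      then have x: "norm x > r + norm v" by simp
      have "h n * norm v \<le> norm v" using h[of n] by (simp add: mult_left_le_one_le)
      then have "norm (x + h n *\<^sub>R v) > r"
        using x norm_triangle_ineq[of "x + h n *\<^sub>R v" "- (h n *\<^sub>R v)"] h(1)[of n] by simp
      moreover have "norm x > r" using x norm_ge_zero[of v] by linarith
      ultimately have "x \<notin> supp f" "x + h n *\<^sub>R v \<notin> supp f" using r not_less by blast+
      then have "f x = 0" "f (x + h n *\<^sub>R v) = 0"
        using not_in_supp[of x f] not_in_supp[of "x + h n *\<^sub>R v" f] by blast+
      then show ?thesis by (simp add: q_def B(1) less_imp_le)
    qed
    then show "AE x in lborel. norm (q n x) \<le> B * indicator (cball 0 (r + norm v)) x" for n by simp
  qed
  then show ?thesis unfolding q0 using LIMSEQ_unique tendsto_const by blast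
qed

lemma test_functions_mult_smooth:
  assumes "f \<in> test_functions U" "smooth g"
  shows "(\<lambda>x. f x * g x) \<in> test_functions U"
proof (rule test_functionsI)
  show "x \<in> supp f" if "f x * g x \<noteq> 0" for x using that not_in_supp[of x f] by (cases "x \<in> supp f") auto
qed (use assms in \<open>auto simp: test_functions_def intro: smooth_mult\<close>)

lemma test_functions_mono: "f \<in> test_functions U \<Longrightarrow> U \<subseteq> V \<Longrightarrow> f \<in> test_functions V"
  by (auto simp: test_functions_def)

lemma test_functions_iter_deriv: "f \<in> test_functions U \<Longrightarrow> iter_deriv vs f \<in> test_functions U"
  by (induction vs) (auto simp: iter_deriv_Cons intro: test_functions_dir_deriv)

lemma integration_by_parts:
  fixes f :: "'a::euclidean_space \<Rightarrow> real"
  assumes f: "f \<in> test_functions U" and g: "smooth g"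
  shows "(LINT x|lborel. f x * dir_deriv v g x) = - (LINT x|lborel. dir_deriv v f x * g x)"
proof -
  note d = smooth_differentiable[OF test_functionsD(1)[OF f]] smooth_differentiable[OF g]
  have fg: "(\<lambda>x. f x * g x) \<in> test_functions UNIV"
    by (rule test_functions_mult_smooth[OF test_functions_mono[OF f] g]) simp
  have "0 = (LINT x|lborel. f x * dir_deriv v g x + dir_deriv v f x * g x)"
    using integral_dir_deriv[OF fg, of v] d by (simp add: dir_deriv_mult)
  also have "\<dots> = (LINT x|lborel. f x * dir_deriv v g x) + (LINT x|lborel. dir_deriv v f x * g x)"
    by (intro Bochner_Integration.integral_add integrable_test_function[of _ U] test_functions_mult_smooth
        test_functions_dir_deriv smooth_dir_deriv f g)
  finally show ?thesis by simp
qed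

text \<open>Reflection and integration by parts each contribute one sign per derivative, and these
  cancel. Thus every derivative of a mollified \<open>f\<close> is the mollification of a derivative
  of \<open>f\<close>.\<close>

lemma convolution_iter_deriv:
  fixes f g :: "'a::euclidean_space \<Rightarrow> real"
  assumes f: "f \<in> test_functions U" and g: "smooth g"
  shows "(LINT x|lborel. f x * iter_deriv vs (\<lambda>y. g (x - y)) y) = (LINT x|lborel. iter_deriv vs f x * g (x - y))"
proof -
  have *: "(LINT x|lborel. f x * iter_deriv vs G x) = (-1) ^ length vs * (LINT x|lborel. iter_deriv vs f x * G x)"
    if G: "smooth G" for G
    using f
  proof (induction vs arbitrary: f)
    case (Cons v vs)
    have "(LINT x|lborel. f x * iter_deriv (v # vs) G x) = - (LINT x|lborel. dir_deriv v f x * iter_deriv vs G x)"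
      unfolding iter_deriv_Cons by (rule integration_by_parts[OF Cons.prems smooth_iter_deriv[OF G]])
    also have "\<dots> = (-1) ^ length (v # vs) * (LINT x|lborel. iter_deriv vs (dir_deriv v f) x * G x)"
      using Cons.IH[OF test_functions_dir_deriv[OF Cons.prems]] by simp
    finally show ?case
      unfolding iter_deriv_dir_deriv_commute[OF test_functionsD(1)[OF Cons.prems]] by (simp add: iter_deriv_Cons)
  qed simp
  define G where "G = (\<lambda>x. g (- y + x))"
  have G: "smooth G" unfolding G_def by (rule smooth_translate[OF g])
  have tr: "iter_deriv vs G x = iter_deriv vs g (x - y)" for x
  proof -
    have "iter_deriv vs G = (\<lambda>x. iter_deriv vs g (- y + x))" unfolding G_def
      by (induction vs) (auto simp: iter_deriv_Cons dir_deriv_translate smooth_differentiable smooth_iter_deriv[OF g]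
          simp del: uminus_add_conv_diff)
    then show ?thesis by simp
  qed
  have "f x * iter_deriv vs (\<lambda>y. g (x - y)) y = (-1) ^ length vs * (f x * iter_deriv vs G x)" for x
    unfolding iter_deriv_reflect[OF g] tr by (rule mult.left_commute)
  then have "(LINT x|lborel. f x * iter_deriv vs (\<lambda>y. g (x - y)) y) = (-1) ^ length vs * (LINT x|lborel. f x * iter_deriv vs G x)"
    by (simp only: integral_mult_right_zero)
  also have "\<dots> = (LINT x|lborel. iter_deriv vs f x * G x)"
    unfolding *[OF G] by (simp flip: mult.assoc power_mult_distrib)
  finally show ?thesis by (simp add: G_def)
qed

text \<open>A finite cover by balls is made disjoint along an enumeration of the centres. The centre
  indexes its cell and serves as sample point of a Riemann sum: it is within \<open>d\<close> of
  every point of the cell.\<close>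

lemma finite_partition_small:
  fixes K :: "'a::euclidean_space set"
  assumes K: "compact K" and d: "0 < d"
  shows "\<exists>X A. finite X \<and> X \<subseteq> K \<and> disjoint_family_on A X \<and> (\<Union>x\<in>X. A x) = K \<and>
    (\<forall>x\<in>X. A x \<in> sets borel \<and> A x \<subseteq> ball x d)"
proof -
  obtain X where X: "finite X" "X \<subseteq> K" "K \<subseteq> (\<Union>x\<in>X. ball x d)"
    using compactE_image[OF K, of K "\<lambda>x. ball x d"] d by (metis (no_types, lifting) UN_I centre_in_ball open_ball subsetI)
  obtain xs where xs: "set xs = X" "distinct xs" using finite_distinct_list[OF X(1)] by blast
  define B where "B = (\<lambda>n. ball (xs ! n) d \<inter> K)"
  have inj: "inj_on ((!) xs) {..<length xs}" using xs(2) by (simp add: inj_on_nth)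
  define idx where "idx = inv_into {..<length xs} ((!) xs)"
  have X_eq: "X = (!) xs ` {..<length xs}" using xs(1) by (auto simp: set_conv_nth)
  have idx: "idx x < length xs" "xs ! idx x = x" if "x \<in> X" for x
    using inv_into_into[of x "(!) xs" "{..<length xs}"] f_inv_into_f[of x "(!) xs" "{..<length xs}"] that X_eq
    by (auto simp: idx_def)
  have idx_nth: "idx (xs ! n) = n" if "n < length xs" for n
    unfolding idx_def using inj that by simp
  show ?thesis
  proof (intro exI[of _ X] exI[of _ "\<lambda>x. disjointed B (idx x)"] conjI ballI)
    show "disjoint_family_on (\<lambda>x. disjointed B (idx x)) X"
      using disjoint_family_disjointed[of B] idx(2) unfolding disjoint_family_on_def by (metis UNIV_I)
    have "(\<Union>x\<in>X. disjointed B (idx x)) = (\<Union>n<length xs. disjointed B n)"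
      unfolding X_eq using idx_nth by auto
    also have "\<dots> = (\<Union>n<length xs. B n)"
      using finite_UN_disjointed_eq[of B "length xs"] by (simp add: atLeast0LessThan)
    also have "\<dots> = (\<Union>x\<in>X. ball x d \<inter> K)" unfolding B_def X_eq by auto
    also have "\<dots> = K" using X(3) by blast
    finally show "(\<Union>x\<in>X. disjointed B (idx x)) = K" .
    fix x assume x: "x \<in> X"
    have "range B \<subseteq> sets borel" using K by (auto simp: B_def intro!: sets.Int[OF borel_open borel_compact])
    then show "disjointed B (idx x) \<in> sets borel"
      using sets.range_disjointed_sets[of B borel] by blast
    show "disjointed B (idx x) \<subseteq> ball x d"
      using disjointed_subset[of B "idx x"] idx(2)[OF x] by (auto simp: B_def)
  qed (use X in auto)
qed

lemma riemann_sum_error: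
  fixes h :: "'a::euclidean_space \<Rightarrow> real"
  assumes K: "compact K" and h: "continuous_on K h"
    and X: "finite X" "disjoint_family_on A X" "(\<Union>x\<in>X. A x) = K" "\<And>x. x \<in> X \<Longrightarrow> A x \<in> sets borel"
    and e: "\<And>x z. x \<in> X \<Longrightarrow> z \<in> A x \<Longrightarrow> \<bar>h z - h x\<bar> \<le> e"
  shows "\<bar>(\<Sum>x\<in>X. measure lborel (A x) * h x) - (LINT z|lborel. indicator K z * h z)\<bar> \<le> e * measure lborel K"
proof -
  have fin: "emeasure lborel (A x) < \<infinity>" if "x \<in> X" for x
  proof -
    have "A x \<subseteq> K" using X(3) that by blast
    then have "emeasure lborel (A x) \<le> emeasure lborel K" using K by (intro emeasure_mono) (auto intro: borel_compact)
    then show ?thesis using emeasure_compact_finite[OF K] by (simp add: le_less_trans)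
  qed
  have intK: "integrable lborel (\<lambda>z. indicator K z * h z)"
    using borel_integrable_compact[OF K h] by simp
  have intA: "integrable lborel (\<lambda>z. indicator (A x) z * h z)" if x: "x \<in> X" for x
  proof -
    have "integrable lborel (\<lambda>z. indicator (A x) z * (indicator K z * h z))"
      using integrable_real_mult_indicator[OF _ intK, of "A x"] X(4)[OF x] by (simp add: mult.commute)
    moreover have "indicator (A x) z * (indicator K z * h z) = indicator (A x) z * h z" for z
      using X(3) x by (auto simp: indicator_def)
    ultimately show ?thesis by simp
  qed
  have split: "indicator K z * h z = (\<Sum>x\<in>X. indicator (A x) z * h z)" for z
  proof -
    have "indicat_real K z = (\<Sum>x\<in>X. indicator (A x) z)"
      unfolding X(3)[symmetric] by (rule indicator_UN_disjoint[OF X(1,2)])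
    then show ?thesis by (simp add: sum_distrib_right)
  qed
  have "(LINT z|lborel. indicator K z * h z) = (\<Sum>x\<in>X. LINT z|lborel. indicator (A x) z * h z)"
    unfolding split using intA by (rule Bochner_Integration.integral_sum)
  then have "\<bar>(\<Sum>x\<in>X. measure lborel (A x) * h x) - (LINT z|lborel. indicator K z * h z)\<bar> =
      \<bar>\<Sum>x\<in>X. measure lborel (A x) * h x - (LINT z|lborel. indicator (A x) z * h z)\<bar>"
    by (simp add: sum_subtractf)
  also have "\<dots> \<le> (\<Sum>x\<in>X. e * measure lborel (A x))"
  proof (rule order.trans[OF sum_abs], rule sum_mono)
    fix x assume x: "x \<in> X"
    have ind: "integrable lborel (\<lambda>z. indicator (A x) z * c)" for c :: real
      using X(4)[OF x] fin[OF x] by simp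
    have "measure lborel (A x) * h x - (LINT z|lborel. indicator (A x) z * h z) =
        (LINT z|lborel. indicator (A x) z * h x - indicator (A x) z * h z)"
      using ind intA[OF x] by simp
    also have "\<bar>\<dots>\<bar> \<le> (LINT z|lborel. indicator (A x) z * e)"
    proof (rule order.trans[OF integral_abs_bound], rule integral_mono)
      show "\<bar>indicator (A x) z * h x - indicator (A x) z * h z\<bar> \<le> indicator (A x) z * e" for z
        using e[OF x, of z] by (auto simp: indicator_def)
    qed (use ind intA[OF x] in auto)
    also have "\<dots> = e * measure lborel (A x)" by simp
    finally show "\<bar>measure lborel (A x) * h x - (LINT z|lborel. indicator (A x) z * h z)\<bar> \<le> e * measure lborel (A x)" .
  qed
  also have "\<dots> = e * measure lborel K"
    using measure_finite_Union[OF X(1) _ X(2), of lborel] X fin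
    by (simp add: sum_distrib_left[symmetric] less_top image_subset_iff)
  finally show ?thesis .
qed

lemma test_function_uniformly_continuous:
  assumes f: "f \<in> test_functions U" and e: "0 < e"
  shows "\<exists>d>0. \<forall>x y. dist x y < d \<longrightarrow> \<bar>f x - f y\<bar> \<le> e"
proof -
  obtain r where r: "\<And>x. x \<in> supp f \<Longrightarrow> norm x \<le> r"
    using compact_imp_bounded[OF test_functionsD(2)[OF f]] unfolding bounded_iff by blast
  have "uniformly_continuous_on (cball 0 (r + 1)) f"
    by (rule compact_uniformly_continuous) (use test_functionsD(1)[OF f] in \<open>auto simp: smooth_continuous_on\<close>)
  then obtain d where d: "d > 0" "\<And>x y. x \<in> cball 0 (r + 1) \<Longrightarrow> y \<in> cball 0 (r + 1) \<Longrightarrow>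
      dist y x < d \<Longrightarrow> dist (f y) (f x) < e"
    using e unfolding uniformly_continuous_on_def by meson
  \<comment> \<open>Capping the distance at \<open>1\<close> puts both points into the ball of
    radius \<open>r + 1\<close> as soon as one of them lies in the support; otherwise both values
    are \<open>0\<close>.\<close>
  have "\<bar>f x - f y\<bar> \<le> e" if xy: "dist x y < min d 1" for x y
  proof (cases "x \<in> supp f \<or> y \<in> supp f")
    case True
    have "norm x \<le> norm y + dist x y" "norm y \<le> norm x + dist x y"
      using norm_triangle_ineq2[of x y] norm_triangle_ineq2[of y x] by (simp_all add: dist_norm norm_minus_commute)
    then have "x \<in> cball 0 (r + 1)" "y \<in> cball 0 (r + 1)"
      using True r[of x] r[of y] xy by auto
    then show ?thesis using d(2)[of y x] xy by (simp add: dist_real_def)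
  next
    case False
    then have "f x = 0" "f y = 0" using not_in_supp[of x f] not_in_supp[of y f] by blast+
    then show ?thesis using e by simp
  qed
  then show ?thesis using d(1) by (intro exI[of _ "min d 1"]) auto
qed

lemma mollifier_test_function: "(mollifier t :: 'a::euclidean_space \<Rightarrow> real) \<in> test_functions UNIV"
proof (rule test_functionsI(1)[OF smooth_mollifier])
  show "z \<in> cball 0 (exp t)" if "mollifier t z \<noteq> 0" for z :: 'a
    using mollifier_nonzeroD[OF that] by simp
qed auto

lemma mollifier_integral_shift:
  fixes x y :: "'a::euclidean_space"
  shows "integrable lborel (\<lambda>x. mollifier t (x - y))" "(LINT x|lborel. mollifier t (x - y)) = 1"
    and "integrable lborel (\<lambda>y. mollifier t (x - y))" "(LINT y|lborel. mollifier t (x - y)) = 1"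
proof -
  have [measurable]: "(mollifier t :: 'a \<Rightarrow> real) \<in> borel_measurable borel"
    by (rule smooth_measurable[OF smooth_mollifier])
  have m: "integrable lborel (mollifier t :: 'a \<Rightarrow> real)" "(LINT z|lborel. mollifier t (z::'a)) = 1"
    using mollifier_integral[of t, where 'a='a] by (auto simp: has_bochner_integral_iff)
  then show "integrable lborel (\<lambda>x. mollifier t (x - y))" "(LINT x|lborel. mollifier t (x - y)) = 1"
    using integral_translate[of "mollifier t" "- y"] by simp_all
  show "integrable lborel (\<lambda>y. mollifier t (x - y))" "(LINT y|lborel. mollifier t (x - y)) = 1"
    using integral_reflect_lborel[of "mollifier t" x] m by simp_all
qed

lemma mollified_test_function_close:
  fixes f :: "'a::euclidean_space \<Rightarrow> real"
  assumes f: "f \<in> test_functions U" and e: "0 < e"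
  shows "\<forall>\<^sub>F t in at_bot. \<forall>y. \<bar>(LINT x|lborel. f x * mollifier t (x - y)) - f y\<bar> \<le> e"
proof -
  obtain d where d: "d > 0" "\<And>x y. dist x y < d \<Longrightarrow> \<bar>f x - f y\<bar> \<le> e"
    using test_function_uniformly_continuous[OF f e] by blast
  have "\<forall>\<^sub>F t in at_bot. exp t < d"
    using exp_at_bot d(1) by (rule order_tendstoD(2))
  then show ?thesis
  proof eventually_elim
    case (elim t)
    show ?case
    proof
      fix y
      note m = mollifier_integral_shift(1,2)[of t y]
      have fm: "integrable lborel (\<lambda>x. f x * mollifier t (x - y))"
        by (rule integrable_test_function[of _ U], rule test_functions_mult_smooth[OF f])
           (use smooth_translate[OF smooth_mollifier[of t], of "- y"] in simp)
      have "(LINT x|lborel. f x * mollifier t (x - y)) - f y =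
          (LINT x|lborel. f x * mollifier t (x - y) - f y * mollifier t (x - y))"
        by (subst Bochner_Integration.integral_diff[OF fm integrable_mult_right[OF m(1)]])
           (simp add: m(2))
      also have "\<bar>\<dots>\<bar> \<le> (LINT x|lborel. e * mollifier t (x - y))"
      proof (rule order.trans[OF integral_abs_bound], rule integral_mono)
        fix x
        have "\<bar>f x - f y\<bar> * mollifier t (x - y) \<le> e * mollifier t (x - y)"
        proof (cases "mollifier t (x - y) = 0")
          case False
          then have "dist x y < d" using mollifier_nonzeroD[OF False] elim by (simp add: dist_norm)
          then show ?thesis using d(2) by (intro mult_right_mono) auto
        qed simp
        then show "\<bar>f x * mollifier t (x - y) - f y * mollifier t (x - y)\<bar> \<le> e * mollifier t (x - y)"
          by (simp add: left_diff_distrib[symmetric] abs_mult)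
      qed (intro integrable_abs Bochner_Integration.integrable_diff integrable_mult_right fm m(1))+
      also have "\<dots> = e" by (simp add: m(2))
      finally show "\<bar>(LINT x|lborel. f x * mollifier t (x - y)) - f y\<bar> \<le> e" .
    qed
  qed
qed

text \<open>\<open>T\<close> and the integral are interchanged by means of Riemann sums that converge to
  \<open>\<rho>\<^sub>t * f\<close> together with all derivatives.\<close>

lemma mollification_tendsto:
  fixes U :: "'a::euclidean_space set"
  assumes T: "T \<in> distributions U" and U: "open U" and f: "f \<in> test_functions U"
  shows "((\<lambda>t. LINT x|lborel. f x * T (\<lambda>y. mollifier t (x - y))) \<longlongrightarrow> T f) at_bot"
proof (rule tendstoI)
  fix \<epsilon> :: real assume \<epsilon>: "0 < \<epsilon>"
  note sf = test_functionsD[OF f]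
  define K where "K = supp f"
  have K: "compact K" "K \<subseteq> U" using sf by (auto simp: K_def)
  have fK: "f x = 0" if "x \<notin> K" for x using not_in_supp[of x f] that by (simp add: K_def)
  obtain \<rho> where \<rho>: "\<rho> > 0" "(\<Union>x\<in>K. cball x \<rho>) \<subseteq> U"
    using compact_subset_open_imp_cball_epsilon_subset[OF K(1) U K(2)] by blast
  \<comment> \<open>A compact neighbourhood of the support of \<open>f\<close> in \<open>U\<close>
    which contains the supports of all mollifiers centred on that support, and hence of the Riemann
    sums.\<close>
  define K1 where "K1 = {x + z |x z. x \<in> K \<and> z \<in> cball 0 \<rho>}"
  have K1: "compact K1" unfolding K1_def by (intro compact_sums K compact_cball)
  have K1I: "y \<in> K1" if "x \<in> K" "dist x y \<le> \<rho>" for x y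
    using that unfolding K1_def
    by (intro CollectI exI[of _ x] exI[of _ "y - x"]) (auto simp: dist_norm norm_minus_commute)
  have K1U: "K1 \<subseteq> U"
  proof
    fix y assume "y \<in> K1"
    then obtain x z where "y = x + z" "x \<in> K" "norm z \<le> \<rho>" by (auto simp: K1_def)
    then have "x \<in> K" "y \<in> cball x \<rho>" by (simp_all add: dist_norm)
    then show "y \<in> U" using \<rho>(2) by blast
  qed
  obtain C L where C: "C > 0" "finite L" and bound: "\<And>\<phi> M. \<phi> \<in> test_functions U \<Longrightarrow> supp \<phi> \<subseteq> K1 \<Longrightarrow>
      \<forall>vs\<in>L. \<forall>x. \<bar>iter_deriv vs \<phi> x\<bar> \<le> M \<Longrightarrow> \<bar>T \<phi>\<bar> \<le> C * M"
    using distribution_bound[OF T K1 K1U] by blast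
  define D where "D = measure lborel K"
  have D: "D \<ge> 0" by (simp add: D_def)
  \<comment> \<open>The errors add up to
    \<open>C * (\<eta> * D + \<eta>) + \<eta> * D = \<eta> * Q\<close>: the Riemann error in each
    derivative and the mollification error, both seen through \<open>T\<close>, and the Riemann
    error of the outer integral. With \<open>\<eta>\<close> as chosen below this is
    \<open>\<epsilon> / 2\<close>.\<close>
  define Q where "Q = C * (D + 1) + D"
  define \<eta> where "\<eta> = \<epsilon> / (2 * Q)"
  have den: "Q > 0" using C D by (simp add: Q_def add_pos_nonneg)
  have \<eta>: "\<eta> > 0" using den \<epsilon> by (simp add: \<eta>_def)
  have close: "\<forall>\<^sub>F t in at_bot. \<forall>vs\<in>L. \<forall>y. \<bar>(LINT x|lborel. iter_deriv vs f x * mollifier t (x - y)) - iter_deriv vs f y\<bar> \<le> \<eta>"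
    using mollified_test_function_close[OF test_functions_iter_deriv[OF f] \<eta>] C(2)
    by (simp add: eventually_ball_finite_distrib)
  have "\<forall>\<^sub>F t in at_bot. exp t < \<rho>" using exp_at_bot \<rho>(1) by (rule order_tendstoD(2))
  with close show "\<forall>\<^sub>F t in at_bot. dist (LINT x|lborel. f x * T (\<lambda>y. mollifier t (x - y))) (T f) < \<epsilon>"
  proof eventually_elim
    case (elim t)
    define g :: "'a \<Rightarrow> real" where "g = mollifier t"
    have g: "smooth g" "g \<in> test_functions UNIV" by (simp_all add: g_def smooth_mollifier mollifier_test_function)
    have gK1: "(\<lambda>y. g (x - y)) \<in> test_functions U" "supp (\<lambda>y. g (x - y)) \<subseteq> K1" if "x \<in> K" for x
    proof -
      have "y \<in> K1" if "g (x - y) \<noteq> 0" for y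
      proof -
        have "norm (x - y) < exp t" using that mollifier_nonzeroD unfolding g_def by blast
        then show ?thesis using \<open>x \<in> K\<close> elim by (intro K1I[of x]) (auto simp: dist_norm)
      qed
      then show "(\<lambda>y. g (x - y)) \<in> test_functions U" "supp (\<lambda>y. g (x - y)) \<subseteq> K1"
        using test_functionsI[OF smooth_reflect[OF g(1)] K1 K1U, of x] by blast+
    qed
    define w where "w = (\<lambda>x. f x * T (\<lambda>y. g (x - y)))"
    have w: "continuous_on K w" unfolding w_def
    proof (intro continuous_intros smooth_continuous_on[OF sf(1)])
      have "isCont (\<lambda>x. T (\<lambda>y. g (x - y))) x" if "x \<in> K" for x
      proof (rule mollification_continuous[OF T g(1)])
        show "norm z \<le> exp t" if "g z \<noteq> 0" for z using that mollifier_nonzeroD[of t z] by (simp add: g_def)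
        show "cball x \<rho> \<subseteq> U" using \<rho>(2) that by blast
      qed (use elim in auto)
      then show "continuous_on K (\<lambda>x. T (\<lambda>y. g (x - y)))" by (simp add: continuous_at_imp_continuous_on)
    qed
    \<comment> \<open>The integrand, in the variable \<open>x\<close>, of the derivative
      \<open>vs\<close> of the mollified \<open>f\<close> at \<open>y\<close>.\<close>
    define h where "h = (\<lambda>vs x y. f x * iter_deriv vs (\<lambda>y. g (x - y)) y)"
    have h_alt: "h vs x y = (-1) ^ length vs * (f x * iter_deriv vs g (x - y))" for vs x y
      unfolding h_def iter_deriv_reflect[OF g(1)] by simp
    have "\<forall>\<^sub>F d in at_right 0. \<forall>x\<in>K. \<forall>z\<in>K. dist x z < d \<longrightarrow> \<bar>w z - w x\<bar> \<le> \<eta>"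
    proof -
      have "uniformly_continuous_on K w" using w K(1) by (rule compact_uniformly_continuous)
      then obtain d where d: "d > 0" "\<And>x z. x \<in> K \<Longrightarrow> z \<in> K \<Longrightarrow> dist z x < d \<Longrightarrow> dist (w z) (w x) < \<eta>"
        using \<eta> unfolding uniformly_continuous_on_def by meson
      have "\<forall>\<^sub>F d' in at_right 0. d' < d"
        using d(1) unfolding eventually_at_right_field by blast
      then show ?thesis
      proof eventually_elim
        case (elim d')
        show ?case
        proof (intro ballI impI)
          fix x z assume "x \<in> K" "z \<in> K" "dist x z < d'"
          then have "dist (w z) (w x) < \<eta>" using elim by (intro d(2)) (auto simp: dist_commute)
          then show "\<bar>w z - w x\<bar> \<le> \<eta>" by (simp add: dist_real_def)
        qed
      qed
    qed
    \<comment> \<open>The mesh has to be uniform in \<open>y\<close>, since the Riemann sums must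
      approximate every derivative in the supremum norm. Uniform continuity of both factors on the
      whole space provides it.\<close>
    moreover have "\<forall>\<^sub>F d in at_right 0. \<forall>vs\<in>L. \<forall>x z y. dist x z < d \<longrightarrow> \<bar>h vs z y - h vs x y\<bar> \<le> \<eta>"
    proof (subst eventually_ball_finite_distrib[OF C(2)], rule ballI)
      fix vs assume "vs \<in> L"
      define G where "G = iter_deriv vs g"
      have G: "G \<in> test_functions UNIV" unfolding G_def by (rule test_functions_iter_deriv[OF g(2)])
      obtain BG where BG: "BG > 0" "\<And>x. \<bar>G x\<bar> \<le> BG" using test_functions_bounded[OF G] by blast
      obtain Bf where Bf: "Bf > 0" "\<And>x. \<bar>f x\<bar> \<le> Bf" using test_functions_bounded[OF f] by blast
      obtain d1 where d1: "d1 > 0" "\<And>x y. dist x y < d1 \<Longrightarrow> \<bar>f x - f y\<bar> \<le> \<eta> / (2 * BG)"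
        using test_function_uniformly_continuous[OF f, of "\<eta> / (2 * BG)"] \<eta> BG(1) by auto
      obtain d2 where d2: "d2 > 0" "\<And>x y. dist x y < d2 \<Longrightarrow> \<bar>G x - G y\<bar> \<le> \<eta> / (2 * Bf)"
        using test_function_uniformly_continuous[OF G, of "\<eta> / (2 * Bf)"] \<eta> Bf(1) by auto
      have est: "\<bar>h vs z y - h vs x y\<bar> \<le> \<eta>" if "dist x z < min d1 d2" for x y z
      proof -
        have "\<bar>h vs z y - h vs x y\<bar> = \<bar>f z * G (z - y) - f x * G (x - y)\<bar>"
          unfolding h_alt G_def[symmetric] by (simp add: right_diff_distrib[symmetric] abs_mult power_abs)
        also have "\<dots> = \<bar>(f z - f x) * G (z - y) + f x * (G (z - y) - G (x - y))\<bar>" by (simp add: algebra_simps)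
        also have "\<dots> \<le> \<bar>f z - f x\<bar> * \<bar>G (z - y)\<bar> + \<bar>f x\<bar> * \<bar>G (z - y) - G (x - y)\<bar>"
          using abs_triangle_ineq by (simp add: abs_mult[symmetric])
        also have "\<dots> \<le> \<eta> / (2 * BG) * BG + Bf * (\<eta> / (2 * Bf))"
          using that d1(2)[of z x] d2(2)[of "z - y" "x - y"] BG Bf \<eta>
          by (intro add_mono mult_mono) (auto simp: dist_commute dist_norm norm_minus_commute)
        also have "\<dots> = \<eta>" using BG(1) Bf(1) by simp
        finally show ?thesis .
      qed
      have "\<forall>\<^sub>F d in at_right 0. d < min d1 d2"
        using d1(1) d2(1) unfolding eventually_at_right_field by (intro exI[of _ "min d1 d2"]) auto
      then show "\<forall>\<^sub>F d in at_right 0. \<forall>x z y. dist x z < d \<longrightarrow> \<bar>h vs z y - h vs x y\<bar> \<le> \<eta>"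
      proof eventually_elim
        case (elim d)
        show ?case
        proof (intro allI impI)
          fix x z y :: 'a assume "dist x z < d"
          then have "dist x z < min d1 d2" using elim by linarith
          then show "\<bar>h vs z y - h vs x y\<bar> \<le> \<eta>" by (rule est)
        qed
      qed
    qed
    moreover have "\<forall>\<^sub>F d in at_right 0. 0 < (d::real)" by (rule eventually_at_right_less)
    ultimately have "\<forall>\<^sub>F d in at_right 0. 0 < d \<and> (\<forall>x\<in>K. \<forall>z\<in>K. dist x z < d \<longrightarrow> \<bar>w z - w x\<bar> \<le> \<eta>) \<and>
        (\<forall>vs\<in>L. \<forall>x z y. dist x z < d \<longrightarrow> \<bar>h vs z y - h vs x y\<bar> \<le> \<eta>)"
      by eventually_elim (intro conjI)
    from eventually_happens'[OF trivial_limit_at_right_real this]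
    obtain d where d: "d > 0" "\<And>x z. x \<in> K \<Longrightarrow> z \<in> K \<Longrightarrow> dist x z < d \<Longrightarrow> \<bar>w z - w x\<bar> \<le> \<eta>"
        "\<And>vs x z y. vs \<in> L \<Longrightarrow> dist x z < d \<Longrightarrow> \<bar>h vs z y - h vs x y\<bar> \<le> \<eta>"
      by blast
    obtain X A where X: "finite X" "X \<subseteq> K" "disjoint_family_on A X" "(\<Union>x\<in>X. A x) = K"
        "\<And>x. x \<in> X \<Longrightarrow> A x \<in> sets borel" "\<And>x. x \<in> X \<Longrightarrow> A x \<subseteq> ball x d"
      using finite_partition_small[OF K(1) d(1)] by blast
    have AK: "A x \<subseteq> K" if "x \<in> X" for x using X(4) that by blast
    define \<Phi> where "\<Phi> = (\<lambda>y. \<Sum>x\<in>X. (measure lborel (A x) * f x) * g (x - y))"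
    have \<Phi>_test: "\<Phi> \<in> test_functions U" unfolding \<Phi>_def
      by (intro test_functions_sum test_functions_cmult gK1) (use X(2) in auto)
    have \<Phi>_supp: "y \<in> K1" if y: "\<Phi> y \<noteq> 0" for y
    proof (rule ccontr)
      assume "y \<notin> K1"
      then have "g (x - y) = 0" if "x \<in> X" for x
        using gK1(2)[of x] X(2) that not_in_supp[of y "\<lambda>y. g (x - y)"] by blast
      then show False using y by (simp add: \<Phi>_def)
    qed
    have T\<Phi>: "T \<Phi> = (\<Sum>x\<in>X. measure lborel (A x) * w x)"
    proof -
      have "T \<Phi> = (\<Sum>x\<in>X. T (\<lambda>y. (measure lborel (A x) * f x) * g (x - y)))"
        unfolding \<Phi>_def by (rule distribution_linear(4)[OF T], rule test_functions_cmult, rule gK1) (use X(2) in auto)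
      also have "\<dots> = (\<Sum>x\<in>X. measure lborel (A x) * w x)"
        using X(2) gK1(1) by (intro sum.cong refl) (auto simp: distribution_linear(2)[OF T] w_def)
      finally show ?thesis .
    qed
    have int_w: "(LINT z|lborel. indicator K z * w z) = (LINT x|lborel. f x * T (\<lambda>y. g (x - y)))"
      by (rule Bochner_Integration.integral_cong) (auto simp: w_def indicator_def fK)
    \<comment> \<open>By linearity \<open>T \<Phi>\<close> is a Riemann sum of the continuous
      function \<open>w\<close>. This compares it with the integral of mollifications, whereas
      \<open>err2\<close> compares \<open>\<Phi>\<close> with \<open>f\<close> itself.\<close>
    have err1: "\<bar>T \<Phi> - (LINT x|lborel. f x * T (\<lambda>y. g (x - y)))\<bar> \<le> \<eta> * D"
      unfolding T\<Phi> int_w[symmetric] D_def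
    proof (rule riemann_sum_error[OF K(1) w X(1,3,4,5)])
      show "\<bar>w z - w x\<bar> \<le> \<eta>" if "x \<in> X" "z \<in> A x" for x z
        using that X(2) X(6)[OF that(1)] AK[OF that(1)] by (intro d(2)) auto
    qed
    have err2: "\<bar>iter_deriv vs (\<lambda>y. \<Phi> y - f y) y\<bar> \<le> \<eta> * D + \<eta>" if vs: "vs \<in> L" for vs y
    proof -
      have "iter_deriv vs \<Phi> y = (\<Sum>x\<in>X. iter_deriv vs (\<lambda>y. (measure lborel (A x) * f x) * g (x - y)) y)"
        unfolding \<Phi>_def by (subst iter_deriv_sum) (auto intro!: smooth_cmult smooth_reflect g)
      also have "\<dots> = (\<Sum>x\<in>X. measure lborel (A x) * h vs x y)"
        unfolding h_def iter_deriv_cmult[OF smooth_reflect[OF g(1)]] by (simp only: mult.assoc)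
      finally have 1: "iter_deriv vs \<Phi> y = (\<Sum>x\<in>X. measure lborel (A x) * h vs x y)" .
      have "(LINT z|lborel. indicator K z * h vs z y) = (LINT x|lborel. f x * iter_deriv vs (\<lambda>y. g (x - y)) y)"
        by (rule Bochner_Integration.integral_cong) (auto simp: h_def indicator_def fK)
      also have "\<dots> = (LINT x|lborel. iter_deriv vs f x * g (x - y))"
        by (rule convolution_iter_deriv[OF f g(1)])
      finally have 2: "(LINT z|lborel. indicator K z * h vs z y) = (LINT x|lborel. iter_deriv vs f x * g (x - y))" .
      have "\<bar>(\<Sum>x\<in>X. measure lborel (A x) * h vs x y) - (LINT z|lborel. indicator K z * h vs z y)\<bar> \<le> \<eta> * measure lborel K"
      proof (rule riemann_sum_error[OF K(1) _ X(1,3,4,5)])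
        have "smooth (\<lambda>x. iter_deriv vs g (x - y))"
          using smooth_translate[OF smooth_iter_deriv[OF g(1), of vs], of "- y"] by simp
        then show "continuous_on K (\<lambda>x. h vs x y)"
          unfolding h_alt by (intro smooth_continuous_on smooth_cmult smooth_mult sf)
        show "\<bar>h vs z y - h vs x y\<bar> \<le> \<eta>" if "x \<in> X" "z \<in> A x" for x z
          using that X(6)[OF that(1)] by (intro d(3)[OF vs]) auto
      qed
      moreover have "\<bar>(LINT x|lborel. iter_deriv vs f x * g (x - y)) - iter_deriv vs f y\<bar> \<le> \<eta>"
        using elim(1) vs by (simp add: g_def)
      moreover have "iter_deriv vs (\<lambda>y. \<Phi> y - f y) y = iter_deriv vs \<Phi> y - iter_deriv vs f y"
        by (simp add: iter_deriv_diff[OF test_functionsD(1)[OF \<Phi>_test] sf(1)])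
      ultimately show ?thesis unfolding 1 2 D_def by linarith
    qed
    have "\<bar>T (\<lambda>y. \<Phi> y - f y)\<bar> \<le> C * (\<eta> * D + \<eta>)"
    proof (rule bound)
      show "(\<lambda>y. \<Phi> y - f y) \<in> test_functions U" by (rule test_functions_diff[OF \<Phi>_test f])
      show "supp (\<lambda>y. \<Phi> y - f y) \<subseteq> K1"
      proof (rule supp_subsetI[OF compact_imp_closed[OF K1]])
        fix y assume "\<Phi> y - f y \<noteq> 0"
        then have "\<Phi> y \<noteq> 0 \<or> y \<in> K" using fK[of y] by (cases "y \<in> K") auto
        then show "y \<in> K1" using \<Phi>_supp K1I[of y y] \<rho>(1) by auto
      qed
    qed (use err2 in blast)
    then have "\<bar>T \<Phi> - T f\<bar> \<le> C * (\<eta> * D + \<eta>)"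
      by (simp add: distribution_linear(3)[OF T \<Phi>_test f])
    with err1 have "\<bar>(LINT x|lborel. f x * T (\<lambda>y. g (x - y))) - T f\<bar> \<le> C * (\<eta> * D + \<eta>) + \<eta> * D"
      by linarith
    also have "\<dots> = \<eta> * Q" by (simp add: Q_def algebra_simps)
    also have "\<dots> = \<epsilon> / 2" unfolding \<eta>_def using den by simp
    also have "\<dots> < \<epsilon>" using \<epsilon> by simp
    finally show ?case by (simp add: g_def dist_real_def)
  qed
qed

subsection \<open>Lebesgue measure is invariant under linear isometries\<close>

lemma nn_integral_translate_reflect:
  fixes f :: "'a::euclidean_space \<Rightarrow> ennreal"
  assumes [measurable]: "f \<in> borel_measurable borel"
  shows "(\<integral>\<^sup>+x. f (c + x) \<partial>lborel) = (\<integral>\<^sup>+x. f x \<partial>lborel)"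
    and "(\<integral>\<^sup>+x. f (c - x) \<partial>lborel) = (\<integral>\<^sup>+x. f x \<partial>lborel)"
proof -
  have "(\<integral>\<^sup>+x. f x \<partial>lborel) = (\<integral>\<^sup>+x. f x \<partial>distr lborel borel ((+) c))"
    by (simp only: lborel_distr_plus)
  also have "\<dots> = (\<integral>\<^sup>+x. f (c + x) \<partial>lborel)" by (rule nn_integral_distr) auto
  finally show "(\<integral>\<^sup>+x. f (c + x) \<partial>lborel) = (\<integral>\<^sup>+x. f x \<partial>lborel)" ..
  have "lborel = density (distr lborel borel (\<lambda>x::'a. c + (-1) *\<^sub>R x)) (\<lambda>_. ennreal (\<bar>-1\<bar> ^ DIM('a)))"
    by (rule lborel_affine) simp
  then have eq: "distr lborel borel (\<lambda>x. c - x) = (lborel :: 'a measure)"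
    by (simp add: density_1)
  have "(\<integral>\<^sup>+x. f x \<partial>lborel) = (\<integral>\<^sup>+x. f x \<partial>distr lborel borel (\<lambda>x. c - x))"
    by (simp only: eq)
  also have "\<dots> = (\<integral>\<^sup>+x. f (c - x) \<partial>lborel)" by (rule nn_integral_distr) auto
  finally show "(\<integral>\<^sup>+x. f (c - x) \<partial>lborel) = (\<integral>\<^sup>+x. f x \<partial>lborel)" ..
qed

lemma emeasure_unit_ball: "0 < emeasure lborel (ball (0::'a::euclidean_space) 1)" "emeasure lborel (ball (0::'a) 1) < \<infinity>"
proof -
  have "emeasure lborel (ball (0::'a) 1) \<noteq> 0"
  proof
    assume "emeasure lborel (ball (0::'a) 1) = 0"
    then have "ball (0::'a) 1 \<in> null_sets lborel" by auto
    then have "negligible (ball (0::'a) 1)"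
      by (simp add: negligible_iff_null_sets null_sets_completionI)
    then show False using open_not_negligible[of "ball (0::'a) 1"] by simp
  qed
  then show "0 < emeasure lborel (ball (0::'a) 1)" by (simp add: zero_less_iff_neq_zero)
  have "emeasure lborel (ball (0::'a) 1) \<le> emeasure lborel (cball (0::'a) 1)"
    by (intro emeasure_mono) auto
  also have "\<dots> < \<infinity>" by (rule emeasure_compact_finite) simp
  finally show "emeasure lborel (ball (0::'a) 1) < \<infinity>" .
qed

text \<open>Both sides of the equation, multiplied by the volume of the unit ball \<open>B\<close>, are equal to
  \<open>\<integral>\<integral> 1\<^sub>A(L x + y) 1\<^sub>B(y) dx dy\<close>, since \<open>L\<close> preserves \<open>B\<close>.\<close>

lemma lborel_distr_isometry:
  fixes L L' :: "'a::euclidean_space \<Rightarrow> 'a"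
  assumes L: "linear L" "\<And>x. norm (L x) = norm x" and L': "\<And>y. L (L' y) = y"
  shows "distr lborel borel L = lborel"
proof (rule measure_eqI)
  have contL: "continuous_on UNIV L" using L(1) by (simp add: linear_continuous_on linear_conv_bounded_linear)
  then have [measurable]: "L \<in> borel_measurable borel" by (rule borel_measurable_continuous_onI)
  fix A assume "A \<in> sets (distr lborel borel L)"
  then have A [measurable]: "A \<in> sets borel" by simp
  let ?B = "ball (0::'a) 1"
  have [measurable]: "?B \<in> sets borel" by simp
  let ?F = "\<lambda>x y. indicator A (L x + y) * indicator ?B y :: ennreal"
  have "(\<integral>\<^sup>+y. \<integral>\<^sup>+x. ?F x y \<partial>lborel \<partial>lborel) = emeasure (distr lborel borel L) A * emeasure lborel ?B"
  proof -
    have "(\<integral>\<^sup>+x. ?F x y \<partial>lborel) = emeasure (distr lborel borel L) A * indicator ?B y" for y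
    proof -
      have "(\<integral>\<^sup>+x. indicator A (L x + y) \<partial>lborel) = (\<integral>\<^sup>+x. indicator A (L (L' y + x)) \<partial>lborel)"
        by (simp add: linear_add[OF L(1)] L' add.commute)
      also have "\<dots> = (\<integral>\<^sup>+x. indicator A (L x) \<partial>lborel)"
        by (rule nn_integral_translate_reflect(1)) measurable
      also have "\<dots> = (\<integral>\<^sup>+x. indicator A x \<partial>distr lborel borel L)"
        by (rule nn_integral_distr[symmetric]) auto
      finally show ?thesis by (simp add: nn_integral_multc)
    qed
    then show ?thesis by (simp only: nn_integral_cmult_indicator borel_open open_ball sets_lborel)
  qed
  moreover have "(\<integral>\<^sup>+x. \<integral>\<^sup>+y. ?F x y \<partial>lborel \<partial>lborel) = emeasure lborel A * emeasure lborel ?B"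
  proof -
    have "(\<integral>\<^sup>+y. ?F x y \<partial>lborel) = (\<integral>\<^sup>+y. indicator A y * indicator ?B (y - L x) \<partial>lborel)" for x
    proof -
      have "(\<integral>\<^sup>+y. ?F x (- L x + y) \<partial>lborel) = (\<integral>\<^sup>+y. ?F x y \<partial>lborel)"
        by (rule nn_integral_translate_reflect(1)) measurable
      then show ?thesis by (simp add: algebra_simps)
    qed
    then have "(\<integral>\<^sup>+x. \<integral>\<^sup>+y. ?F x y \<partial>lborel \<partial>lborel) =
        (\<integral>\<^sup>+x. \<integral>\<^sup>+y. indicator A y * indicator ?B (y - L x) \<partial>lborel \<partial>lborel)" by simp
    also have "\<dots> = (\<integral>\<^sup>+y. \<integral>\<^sup>+x. indicator A y * indicator ?B (y - L x) \<partial>lborel \<partial>lborel)"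
      by (rule lborel_pair.Fubini') measurable
    also have "\<dots> = (\<integral>\<^sup>+y. indicator A y * emeasure lborel ?B \<partial>lborel)"
    proof (rule nn_integral_cong)
      fix y
      \<comment> \<open>This is where the isometry enters: the ball condition on
        \<open>y - L x\<close> becomes one on a reflected translate of \<open>x\<close>, whose
        measure is that of the unit ball.\<close>
      have "norm (y - L x) = norm (L' y - x)" for x
        using L(2)[of "L' y - x"] by (simp add: linear_diff[OF L(1)] L')
      then have "(\<integral>\<^sup>+x. indicator ?B (y - L x) \<partial>lborel) = (\<integral>\<^sup>+x. indicator ?B (L' y - x) \<partial>lborel)"
        by (simp add: indicator_def)
      also have "\<dots> = (\<integral>\<^sup>+x. indicator ?B x \<partial>lborel)"
        by (rule nn_integral_translate_reflect(2)) measurable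
      finally show "(\<integral>\<^sup>+x. indicator A y * indicator ?B (y - L x) \<partial>lborel) = indicator A y * emeasure lborel ?B"
        by (simp add: nn_integral_cmult)
    qed
    also have "\<dots> = emeasure lborel A * emeasure lborel ?B" by (simp add: nn_integral_multc)
    finally show ?thesis .
  qed
  moreover have "(\<integral>\<^sup>+y. \<integral>\<^sup>+x. ?F x y \<partial>lborel \<partial>lborel) = (\<integral>\<^sup>+x. \<integral>\<^sup>+y. ?F x y \<partial>lborel \<partial>lborel)"
    by (rule lborel_pair.Fubini') measurable
  ultimately have "emeasure (distr lborel borel L) A * emeasure lborel ?B = emeasure lborel A * emeasure lborel ?B"
    by simp
  then show "emeasure (distr lborel borel L) A = emeasure lborel A"
    using emeasure_unit_ball[where 'a='a]
    by (auto simp: mult.commute[of _ "emeasure lborel ?B"] ennreal_mult_cancel_left)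
qed simp

lemma norm_vector_scalar: "norm (c *s (v :: complex ^ 'n::finite)) = norm c * norm v"
  by (simp add: norm_vec_def norm_mult L2_set_right_distrib[symmetric])

lemma bounded_linear_vector_scalar: "bounded_linear (\<lambda>v :: complex ^ 'n::finite. c *s v)"
proof (rule bounded_linearI')
  show "c *s (x + y) = c *s x + c *s y" for x y :: "complex ^ 'n" by (simp add: vec_eq_iff distrib_left)
  show "c *s (r *\<^sub>R x) = r *\<^sub>R (c *s x)" for r and x :: "complex ^ 'n" by (simp add: vec_eq_iff)
qed

lemma cis_vector_scalar: "cis \<theta> *s b = cos \<theta> *\<^sub>R b + sin \<theta> *\<^sub>R (\<i> *s b)"
  by (simp add: vec_eq_iff complex_eq_iff)

lemma nn_integral_rotate:
  fixes f :: "complex ^ 'n::finite \<Rightarrow> ennreal"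
  assumes [measurable]: "f \<in> borel_measurable borel"
  shows "(\<integral>\<^sup>+x. f (a + cis \<theta> *s x) \<partial>lborel) = (\<integral>\<^sup>+x. f x \<partial>lborel)"
proof -
  let ?L = "\<lambda>x :: complex ^ 'n. cis \<theta> *s x"
  have lin: "linear ?L" using bounded_linear_vector_scalar by (rule bounded_linear.linear)
  have inv: "?L (cis (- \<theta>) *s y) = y" for y by (simp add: vec_eq_iff cis_mult mult.assoc[symmetric])
  have [measurable]: "?L \<in> borel_measurable borel"
    by (intro borel_measurable_continuous_onI linear_continuous_on bounded_linear_vector_scalar)
  have "(\<integral>\<^sup>+x. f (a + cis \<theta> *s x) \<partial>lborel) = (\<integral>\<^sup>+x. f (a + x) \<partial>distr lborel borel ?L)"
    by (rule nn_integral_distr[symmetric]) auto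
  also have "distr lborel borel ?L = lborel"
    by (rule lborel_distr_isometry[OF lin _ inv]) (simp add: norm_vector_scalar)
  also have "(\<integral>\<^sup>+x. f (a + x) \<partial>lborel) = (\<integral>\<^sup>+x. f x \<partial>lborel)"
    by (rule nn_integral_translate_reflect(1)) fact
  finally show ?thesis .
qed

subsection \<open>Extended real integrals and circle means\<close>

lemma e2ennreal_abs_less_top: "e2ennreal \<bar>h\<bar> < top \<Longrightarrow> h = ereal (real_of_ereal h)"
  by (cases h) auto

text \<open>The exit from extended real arithmetic: a finite absolute integral makes
  \<open>h\<close> real almost everywhere, and both parts of \<open>ereal_integral\<close> are
  finite.\<close>

lemma ereal_integral_finite:
  assumes h [measurable]: "h \<in> borel_measurable M" and fin: "(\<integral>\<^sup>+x. e2ennreal \<bar>h x\<bar> \<partial>M) < \<infinity>"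
  shows "AE x in M. h x = ereal (real_of_ereal (h x))"
    and "integrable M (\<lambda>x. real_of_ereal (h x))"
    and "ereal_integral M h = ereal (LINT x|M. real_of_ereal (h x))"
proof -
  have "AE x in M. e2ennreal \<bar>h x\<bar> \<noteq> \<infinity>"
    using fin by (intro nn_integral_PInf_AE) auto
  then show ae: "AE x in M. h x = ereal (real_of_ereal (h x))"
    by eventually_elim (rule e2ennreal_abs_less_top, simp add: less_top)
  have "(\<integral>\<^sup>+x. ennreal (norm (real_of_ereal (h x))) \<partial>M) = (\<integral>\<^sup>+x. e2ennreal \<bar>h x\<bar> \<partial>M)"
  proof (rule nn_integral_cong_AE)
    from ae show "AE x in M. ennreal (norm (real_of_ereal (h x))) = e2ennreal \<bar>h x\<bar>"
    proof eventually_elim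
      case (elim x)
      show ?case by (subst (2) elim) simp
    qed
  qed
  with fin show int: "integrable M (\<lambda>x. real_of_ereal (h x))" by (simp add: integrable_iff_bounded)
  have pos: "(\<integral>\<^sup>+x. e2ennreal (h x) \<partial>M) = (\<integral>\<^sup>+x. ennreal (real_of_ereal (h x)) \<partial>M)"
  proof (rule nn_integral_cong_AE)
    from ae show "AE x in M. e2ennreal (h x) = ennreal (real_of_ereal (h x))"
    proof eventually_elim
      case (elim x)
      show ?case by (subst elim) simp
    qed
  qed
  have neg: "(\<integral>\<^sup>+x. e2ennreal (- h x) \<partial>M) = (\<integral>\<^sup>+x. ennreal (- real_of_ereal (h x)) \<partial>M)"
  proof (rule nn_integral_cong_AE)
    from ae show "AE x in M. e2ennreal (- h x) = ennreal (- real_of_ereal (h x))"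
    proof eventually_elim
      case (elim x)
      show ?case by (subst elim) simp
    qed
  qed
  have finite: "enn2ereal A = ereal (enn2real A)" if "A < \<infinity>" for A
    using that by (cases A) auto
  have "(\<integral>\<^sup>+x. ennreal (real_of_ereal (h x)) \<partial>M) < \<infinity>" "(\<integral>\<^sup>+x. ennreal (- real_of_ereal (h x)) \<partial>M) < \<infinity>"
    using int unfolding real_integrable_def by (auto simp: less_top)
  then show "ereal_integral M h = ereal (LINT x|M. real_of_ereal (h x))"
    unfolding ereal_integral_def pos neg real_lebesgue_integral_def[OF int] by (simp add: finite)
qed

text \<open>The upper bound and the finite measure control the positive part. An infinite integral
  of the negative part would then make the value \<open>-\<infinity>\<close>.\<close>

lemma ereal_integral_bounded_above:
  assumes h [measurable]: "h \<in> borel_measurable M" and M: "emeasure M (space M) < \<infinity>"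
    and A: "\<And>x. x \<in> space M \<Longrightarrow> h x \<le> ereal A" and c: "ereal_integral M h \<noteq> -\<infinity>"
  shows "(\<integral>\<^sup>+x. e2ennreal \<bar>h x\<bar> \<partial>M) < \<infinity>"
proof -
  have "(\<integral>\<^sup>+x. e2ennreal (h x) \<partial>M) \<le> (\<integral>\<^sup>+x. ennreal \<bar>A\<bar> \<partial>M)"
  proof (rule nn_integral_mono)
    fix x assume "x \<in> space M"
    then have "h x \<le> ereal A" by (rule A)
    also have "\<dots> \<le> ereal \<bar>A\<bar>" by simp
    finally have "h x \<le> ereal \<bar>A\<bar>" .
    then show "e2ennreal (h x) \<le> ennreal \<bar>A\<bar>" by (metis e2ennreal_ereal e2ennreal_mono)
  qed
  also have "\<dots> < \<infinity>" using M by (simp add: ennreal_mult_less_top)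
  finally have pos: "(\<integral>\<^sup>+x. e2ennreal (h x) \<partial>M) < \<infinity>" .
  have neg: "(\<integral>\<^sup>+x. e2ennreal (- h x) \<partial>M) < \<infinity>"
  proof (rule ccontr)
    assume "\<not> ?thesis"
    then have "(\<integral>\<^sup>+x. e2ennreal (- h x) \<partial>M) = top" by (simp add: less_top[symmetric])
    then have "ereal_integral M h = -\<infinity>"
      unfolding ereal_integral_def using pos by (cases "\<integral>\<^sup>+x. e2ennreal (h x) \<partial>M") auto
    with c show False ..
  qed
  have "(\<integral>\<^sup>+x. e2ennreal \<bar>h x\<bar> \<partial>M) \<le> (\<integral>\<^sup>+x. e2ennreal (h x) + e2ennreal (- h x) \<partial>M)"
  proof (rule nn_integral_mono)
    show "e2ennreal \<bar>h x\<bar> \<le> e2ennreal (h x) + e2ennreal (- h x)" for x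
      by (cases "0 \<le> h x") (auto simp: add_increasing add_increasing2)
  qed
  also have "\<dots> = (\<integral>\<^sup>+x. e2ennreal (h x) \<partial>M) + (\<integral>\<^sup>+x. e2ennreal (- h x) \<partial>M)"
    by (rule nn_integral_add) auto
  also have "\<dots> < \<infinity>" using pos neg by simp
  finally show ?thesis .
qed

text \<open>Monotone convergence applied to the increasing nonnegative functions
  \<open>h 0 - h k\<close>. The common lower bound \<open>B\<close> on the integrals keeps the limit
  integrable even though it may be \<open>-\<infinity>\<close> at some points. It is used for
  integrals against a cutoff and for circle means.\<close>

lemma monotone_limit_integral:
  fixes h :: "nat \<Rightarrow> 'a \<Rightarrow> real" and H :: "'a \<Rightarrow> ereal"
  assumes int: "\<And>k. integrable M (h k)" and dec: "\<And>x. x \<in> space M \<Longrightarrow> decseq (\<lambda>k. h k x)"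
    and lim: "\<And>x. x \<in> space M \<Longrightarrow> (\<lambda>k. ereal (h k x)) \<longlonglongrightarrow> H x"
    and B: "\<And>k. B \<le> (LINT x|M. h k x)"
  shows "H \<in> borel_measurable M" "(\<integral>\<^sup>+x. e2ennreal \<bar>H x\<bar> \<partial>M) < \<infinity>" "B \<le> (LINT x|M. real_of_ereal (H x))"
proof -
  have [measurable]: "h k \<in> borel_measurable M" for k using int by auto
  show H [measurable]: "H \<in> borel_measurable M"
    using lim by (rule borel_measurable_LIMSEQ_order) auto
  have up: "H x \<le> ereal (h k x)" if "x \<in> space M" for x k
    using lim[OF that] by (rule LIMSEQ_le_const2) (use dec[OF that] in \<open>auto simp: decseq_def intro!: exI[of _ k]\<close>)
  have SUP_eq: "(SUP k. ennreal (h 0 x - h k x)) = e2ennreal (ereal (h 0 x) - H x)" if x: "x \<in> space M" for x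
  proof (rule LIMSEQ_unique[OF LIMSEQ_SUP])
    show "incseq (\<lambda>k. ennreal (h 0 x - h k x))"
      using dec[OF x] by (auto simp: incseq_def decseq_def intro!: ennreal_leI)
    have "(\<lambda>k. ereal (h 0 x) - ereal (h k x)) \<longlonglongrightarrow> ereal (h 0 x) - H x"
      using lim[OF x] by (intro tendsto_diff_ereal_general) auto
    then have "(\<lambda>k. e2ennreal (ereal (h 0 x) - ereal (h k x))) \<longlonglongrightarrow> e2ennreal (ereal (h 0 x) - H x)"
      by (rule tendsto_e2ennrealI)
    then show "(\<lambda>k. ennreal (h 0 x - h k x)) \<longlonglongrightarrow> e2ennreal (ereal (h 0 x) - H x)"
      by simp
  qed
  have "(\<integral>\<^sup>+x. e2ennreal (ereal (h 0 x) - H x) \<partial>M) = (\<integral>\<^sup>+x. (SUP k. ennreal (h 0 x - h k x)) \<partial>M)"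
    by (rule nn_integral_cong) (simp add: SUP_eq)
  also have "\<dots> = (SUP k. \<integral>\<^sup>+x. ennreal (h 0 x - h k x) \<partial>M)"
    using dec by (intro nn_integral_monotone_convergence_SUP_AE AE_I2) (auto simp: decseq_Suc_iff intro!: ennreal_leI)
  also have "\<dots> \<le> ennreal ((LINT x|M. h 0 x) - B)"
  proof (rule SUP_least)
    fix k
    have "(\<integral>\<^sup>+x. ennreal (h 0 x - h k x) \<partial>M) = ennreal (LINT x|M. h 0 x - h k x)"
      using dec by (intro nn_integral_eq_integral Bochner_Integration.integrable_diff int AE_I2) (auto simp: decseq_def)
    also have "\<dots> \<le> ennreal ((LINT x|M. h 0 x) - B)"
      using B[of k] int by (intro ennreal_leI) simp
    finally show "(\<integral>\<^sup>+x. ennreal (h 0 x - h k x) \<partial>M) \<le> ennreal ((LINT x|M. h 0 x) - B)" .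
  qed
  finally have le: "(\<integral>\<^sup>+x. e2ennreal (ereal (h 0 x) - H x) \<partial>M) \<le> ennreal ((LINT x|M. h 0 x) - B)" .
  have "(\<integral>\<^sup>+x. e2ennreal \<bar>H x\<bar> \<partial>M) \<le> (\<integral>\<^sup>+x. ennreal \<bar>h 0 x\<bar> + e2ennreal (ereal (h 0 x) - H x) \<partial>M)"
  proof (rule nn_integral_mono)
    fix x assume x: "x \<in> space M"
    show "e2ennreal \<bar>H x\<bar> \<le> ennreal \<bar>h 0 x\<bar> + e2ennreal (ereal (h 0 x) - H x)"
    proof (cases "H x")
      case (real r)
      have "r \<le> h 0 x" using up[OF x, of 0] real by simp
      then have "\<bar>r\<bar> \<le> \<bar>h 0 x\<bar> + (h 0 x - r)" by linarith
      then have "ennreal \<bar>r\<bar> \<le> ennreal (\<bar>h 0 x\<bar> + (h 0 x - r))" by (rule ennreal_leI)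
      also have "\<dots> = ennreal \<bar>h 0 x\<bar> + ennreal (h 0 x - r)" using \<open>r \<le> h 0 x\<close> by (intro ennreal_plus) auto
      finally show ?thesis by (simp add: real)
    next
      case PInf
      then show ?thesis using up[OF x, of 0] by simp
    next
      case MInf
      then show ?thesis by simp
    qed
  qed
  also have "\<dots> = (\<integral>\<^sup>+x. ennreal \<bar>h 0 x\<bar> \<partial>M) + (\<integral>\<^sup>+x. e2ennreal (ereal (h 0 x) - H x) \<partial>M)"
    by (rule nn_integral_add) auto
  also have "\<dots> < \<infinity>"
    using int[of 0] le by (simp add: integrable_iff_bounded order_le_less_trans)
  finally show fin: "(\<integral>\<^sup>+x. e2ennreal \<bar>H x\<bar> \<partial>M) < \<infinity>" .
  note E = ereal_integral_finite[OF H fin]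
  have ae: "AE x in M. real_of_ereal (H x) \<le> h 0 x"
    using E(1) AE_space
  proof eventually_elim
    case (elim x)
    then show ?case using up[of x 0] by (metis ereal_less_eq(3))
  qed
  have "ennreal (LINT x|M. h 0 x - real_of_ereal (H x)) = (\<integral>\<^sup>+x. ennreal (h 0 x - real_of_ereal (H x)) \<partial>M)"
    using ae int E(2) by (intro nn_integral_eq_integral[symmetric]) auto
  also have "\<dots> = (\<integral>\<^sup>+x. e2ennreal (ereal (h 0 x) - H x) \<partial>M)"
  proof (rule nn_integral_cong_AE)
    from E(1) show "AE x in M. ennreal (h 0 x - real_of_ereal (H x)) = e2ennreal (ereal (h 0 x) - H x)"
    proof eventually_elim
      case (elim x)
      show ?case by (subst (2) elim) simp
    qed
  qed
  also note le
  finally have "(LINT x|M. h 0 x - real_of_ereal (H x)) \<le> (LINT x|M. h 0 x) - B"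
    using B[of 0] by (subst (asm) ennreal_le_iff) auto
  then show "B \<le> (LINT x|M. real_of_ereal (H x))"
    using int E(2) by simp
qed

subsection \<open>Semicontinuity\<close>

lemma upper_semicontinuous_open:
  assumes "open U" "upper_semicontinuous_on U f"
  shows "open {x \<in> U. f x < c}"
  using assms by (simp add: upper_semicontinuous_on_def openin_open_eq)

lemma lower_semicontinuous_open:
  assumes "open U" "lower_semicontinuous_on U f"
  shows "open {x \<in> U. c < f x}"
  using assms by (simp add: lower_semicontinuous_on_def openin_open_eq)

text \<open>Values of \<open>f\<close> outside \<open>U\<close> are unspecified. Filling in
  \<open>-\<infinity>\<close> there only adds the complement of \<open>U\<close> to the open
  sublevel sets.\<close>

lemma upper_semicontinuous_measurable:
  fixes f :: "'a::euclidean_space \<Rightarrow> ereal"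
  assumes U: "open U" and f: "upper_semicontinuous_on U f"
  shows "(\<lambda>x. if x \<in> U then f x else -\<infinity>) \<in> borel_measurable borel"
    and "f \<in> borel_measurable (lebesgue_on U)"
proof -
  show 1: "(\<lambda>x. if x \<in> U then f x else -\<infinity>) \<in> borel_measurable borel"
  proof (rule borel_measurableI_less)
    fix c :: ereal
    have "{x \<in> space borel. (if x \<in> U then f x else -\<infinity>) < c} = {x \<in> U. f x < c} \<union> (if -\<infinity> < c then - U else {})"
      by (cases c) auto
    then show "{x \<in> space borel. (if x \<in> U then f x else -\<infinity>) < c} \<in> sets borel"
      using upper_semicontinuous_open[OF U f, of c] U by (auto intro!: sets.Un)
  qed
  have "(\<lambda>x. if x \<in> U then f x else -\<infinity>) \<in> borel_measurable (lebesgue_on U)"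
    by (intro measurable_restrict_space1 measurable_completion) (use 1 in simp)
  then show "f \<in> borel_measurable (lebesgue_on U)"
    by (rule measurable_cong[THEN iffD1, rotated]) (simp add: space_restrict_space)
qed

lemma compact_increasing_cover:
  fixes S :: "nat \<Rightarrow> 'a::topological_space set"
  assumes "compact K" "\<And>n. open (S n)" "incseq S" "K \<subseteq> (\<Union>n. S n)"
  shows "\<exists>n. K \<subseteq> S n"
proof -
  obtain I where I: "finite I" "K \<subseteq> (\<Union>n\<in>I. S n)"
    using assms(2,4) by (rule compactE_image[OF assms(1), of UNIV S])
  have "S n \<subseteq> S (Max (insert 0 I))" if "n \<in> I" for n
    using I(1) that by (intro incseqD[OF assms(3)] Max_ge) auto
  then show ?thesis using I(2) by blast
qed

lemma upper_semicontinuous_bounded_above: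
  fixes f :: "'a::topological_space \<Rightarrow> ereal"
  assumes U: "open U" and f: "upper_semicontinuous_on U f" "\<And>x. x \<in> U \<Longrightarrow> f x < \<infinity>"
    and K: "compact K" "K \<subseteq> U"
  shows "\<exists>A::real. \<forall>x\<in>K. f x \<le> ereal A"
proof -
  have "\<exists>n. K \<subseteq> {x \<in> U. f x < ereal (real n)}"
  proof (rule compact_increasing_cover[OF K(1) upper_semicontinuous_open[OF U f(1)]])
    show "incseq (\<lambda>n. {x \<in> U. f x < ereal (real n)})"
      unfolding incseq_def
    proof (intro allI impI subsetI)
      fix m n :: nat and x assume "m \<le> n" "x \<in> {x \<in> U. f x < ereal (real m)}"
      moreover from this have "ereal (real m) \<le> ereal (real n)" by simp
      ultimately show "x \<in> {x \<in> U. f x < ereal (real n)}" using order_less_le_trans by blast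
    qed
    show "K \<subseteq> (\<Union>n. {x \<in> U. f x < ereal (real n)})"
    proof
      fix x assume "x \<in> K"
      then have x: "x \<in> U" using K(2) by blast
      have "f x \<noteq> \<infinity>" using f(2)[OF x] by simp
      then obtain n where "f x < ereal (real n)"
        using less_PInf_Ex_of_nat by blast
      with x show "x \<in> (\<Union>n. {x \<in> U. f x < ereal (real n)})" by blast
    qed
  qed
  then obtain n where "K \<subseteq> {x \<in> U. f x < ereal (real n)}" by blast
  then have "f x \<le> ereal (real n)" if "x \<in> K" for x using that by auto
  then show ?thesis by blast
qed

lemma lower_semicontinuous_bounded_below:
  fixes \<delta> :: "'a::topological_space \<Rightarrow> real"
  assumes U: "open U" and \<delta>: "lower_semicontinuous_on U \<delta>" "\<And>x. x \<in> U \<Longrightarrow> 0 < \<delta> x"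
    and K: "compact K" "K \<subseteq> U"
  shows "\<exists>r>0. \<forall>x\<in>K. r < \<delta> x"
proof -
  have "\<exists>n. K \<subseteq> {x \<in> U. 1 / real (Suc n) < \<delta> x}"
  proof (rule compact_increasing_cover[OF K(1) lower_semicontinuous_open[OF U \<delta>(1)]])
    show "incseq (\<lambda>n. {x \<in> U. 1 / real (Suc n) < \<delta> x})"
      unfolding incseq_def
    proof (intro allI impI subsetI)
      fix m n :: nat and x assume "m \<le> n" "x \<in> {x \<in> U. 1 / real (Suc m) < \<delta> x}"
      moreover have "1 / real (Suc n) \<le> 1 / real (Suc m)" using \<open>m \<le> n\<close> by (intro divide_left_mono) auto
      ultimately show "x \<in> {x \<in> U. 1 / real (Suc n) < \<delta> x}" by auto
    qed
    show "K \<subseteq> (\<Union>n. {x \<in> U. 1 / real (Suc n) < \<delta> x})"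
    proof
      fix x assume "x \<in> K"
      then have x: "x \<in> U" using K(2) by blast
      obtain n where "inverse (real (Suc n)) < \<delta> x" using reals_Archimedean[OF \<delta>(2)[OF x]] by auto
      with x show "x \<in> (\<Union>n. {x \<in> U. 1 / real (Suc n) < \<delta> x})" by (auto simp: inverse_eq_divide)
    qed
  qed
  then obtain n where "K \<subseteq> {x \<in> U. 1 / real (Suc n) < \<delta> x}" by blast
  then show ?thesis by (intro exI[of _ "1 / real (Suc n)"]) auto
qed

text \<open>The radius at \<open>a\<close> is the supremum of all \<open>r \<le> 1\<close> that work
  uniformly on the ball of radius \<open>r\<close> around \<open>a\<close>. If \<open>r\<close>
  works at \<open>a\<close>, then \<open>r - dist x a\<close> works at \<open>x\<close>, which makes
  the supremum lower semicontinuous; the cap \<open>1\<close> makes it finite.\<close>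

lemma lower_semicontinuous_radius:
  fixes P :: "'a::metric_space \<Rightarrow> 'b::real_normed_vector \<Rightarrow> bool"
  assumes loc: "\<And>a. a \<in> U \<Longrightarrow> \<exists>r>0. \<forall>x\<in>ball a r \<inter> U. \<forall>b. norm b < r \<longrightarrow> P x b"
  shows "\<exists>\<delta>::'a \<Rightarrow> real. lower_semicontinuous_on U \<delta> \<and> (\<forall>x\<in>U. 0 < \<delta> x) \<and>
    (\<forall>a\<in>U. \<forall>b. norm b < \<delta> a \<longrightarrow> P a b)"
proof -
  define R where "R = (\<lambda>a. {r. 0 < r \<and> r \<le> 1 \<and> (\<forall>x\<in>ball a r \<inter> U. \<forall>b. norm b < r \<longrightarrow> P x b)})"
  define \<delta> where "\<delta> = (\<lambda>a. Sup (R a))"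
  have bdd: "bdd_above (R a)" for a unfolding R_def by (rule bdd_aboveI[of _ 1]) auto
  have ne: "R a \<noteq> {}" if a: "a \<in> U" for a
  proof -
    obtain r where r: "r > 0" "\<forall>x\<in>ball a r \<inter> U. \<forall>b. norm b < r \<longrightarrow> P x b" using loc[OF a] by blast
    then have "min r 1 \<in> R a" by (auto simp: R_def)
    then show ?thesis by blast
  qed
  have ex: "\<exists>r\<in>R a. c < r" if "a \<in> U" "c < \<delta> a" for a c
    using less_cSup_iff[OF ne[OF that(1)] bdd, of c] that(2) by (simp add: \<delta>_def)
  have ge: "r \<le> \<delta> a" if "r \<in> R a" for r a unfolding \<delta>_def by (rule cSup_upper[OF that bdd])
  have pos: "0 < \<delta> a" if a: "a \<in> U" for a
  proof -
    obtain r where r: "r \<in> R a" using ne[OF a] by blast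
    then have "0 < r" by (simp add: R_def)
    with ge[OF r] show ?thesis by linarith
  qed
  have lsc: "lower_semicontinuous_on U \<delta>"
    unfolding lower_semicontinuous_on_def
  proof
    fix c
    show "openin (top_of_set U) {x \<in> U. c < \<delta> x}"
      unfolding openin_euclidean_subtopology_iff
    proof (intro conjI ballI)
      fix a assume "a \<in> {x \<in> U. c < \<delta> x}"
      then have a: "a \<in> U" "max c 0 < \<delta> a" using pos by auto
      obtain r where r: "r \<in> R a" "max c 0 < r" using ex[OF a] by blast
      have "x \<in> {x \<in> U. c < \<delta> x}" if x: "x \<in> U" "dist x a < r - max c 0" for x
      proof -
        have "r - dist x a \<in> R x"
          unfolding R_def
        proof (intro CollectI conjI ballI allI impI)
          show "0 < r - dist x a" using x(2) by linarith
          show "r - dist x a \<le> 1" using r(1) zero_le_dist[of x a] unfolding R_def mem_Collect_eq by linarith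
          fix y and b :: 'b assume y: "y \<in> ball x (r - dist x a) \<inter> U" "norm b < r - dist x a"
          have "y \<in> ball a r \<inter> U" using y(1) dist_triangle[of a y x] by (auto simp: dist_commute)
          moreover have "norm b < r" using y(2) zero_le_dist[of x a] by linarith
          ultimately show "P y b" using r(1) unfolding R_def by blast
        qed
        from ge[OF this] have "c < \<delta> x" using x(2) by linarith
        then show ?thesis using x(1) by simp
      qed
      then show "\<exists>e>0. \<forall>x'\<in>U. dist x' a < e \<longrightarrow> x' \<in> {x \<in> U. c < \<delta> x}"
        using r(2) by (intro exI[of _ "r - max c 0"]) auto
    qed auto
  qed
  have "P a b" if a: "a \<in> U" "norm b < \<delta> a" for a b
  proof -
    obtain r where r: "r \<in> R a" "norm b < r" using ex[OF a] by blast
    then have "a \<in> ball a r \<inter> U" using a(1) by (simp add: R_def)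
    then show ?thesis using r unfolding R_def by blast
  qed
  with lsc pos show ?thesis by blast
qed

subsection \<open>Locally integrable functions\<close>

text \<open>All three statements come from one integrable real function, \<open>f\<close> cut off to
  the support of \<open>\<phi>\<close>. The last bounds the integral by the supremum norm, with a
  constant that depends only on this support.\<close>

lemma loc_integrable_test_function:
  fixes f :: "'a::euclidean_space \<Rightarrow> ereal"
  assumes U: "open U" and f: "loc_integrable_on U f" and \<phi>: "\<phi> \<in> test_functions U"
  shows "integrable lebesgue (\<lambda>x. indicator U x * (real_of_ereal (f x) * \<phi> x))"
    and "AE x in lebesgue. x \<in> supp \<phi> \<longrightarrow> f x = ereal (real_of_ereal (f x))"
    and "\<exists>C\<ge>0. \<forall>\<eta>\<in>test_functions U. supp \<eta> \<subseteq> supp \<phi> \<longrightarrow> (\<forall>M. (\<forall>x. \<bar>\<eta> x\<bar> \<le> M) \<longrightarrow>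
      \<bar>LINT x|lebesgue. indicator U x * (real_of_ereal (f x) * \<eta> x)\<bar> \<le> C * M)"
proof -
  define K where "K = supp \<phi>"
  have K: "compact K" "K \<subseteq> U" using test_functionsD[OF \<phi>] by (auto simp: K_def)
  have KU [measurable]: "K \<in> sets lebesgue" "U \<in> sets lebesgue"
    using K(1) U by (auto intro: lmeasurable_compact fmeasurableD)
  \<comment> \<open>Measurability of \<open>f\<close> is known on \<open>U\<close> only; the value
    \<open>0\<close> elsewhere makes \<open>h\<close> measurable on the whole space.\<close>
  define h where "h = (\<lambda>x. if x \<in> U then indicator K x * f x else 0)"
  have h [measurable]: "h \<in> borel_measurable lebesgue"
  proof -
    have "K \<in> sets (lebesgue_on U)" using K(2) KU by (simp add: sets_restrict_space_iff)
    then have "(\<lambda>x. indicator K x * f x) \<in> borel_measurable (lebesgue_on U)"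
      using f unfolding loc_integrable_on_def by (intro borel_measurable_ereal_times borel_measurable_indicator) auto
    then show ?thesis
      unfolding h_def by (intro measurable_If_restrict_space_iff[THEN iffD2]) (use KU(2) in simp_all)
  qed
  have "(\<integral>\<^sup>+x. e2ennreal \<bar>h x\<bar> \<partial>lebesgue) = set_nn_integral lebesgue K (\<lambda>x. e2ennreal \<bar>f x\<bar>)"
    by (rule nn_integral_cong) (use K(2) in \<open>auto simp: h_def indicator_def e2ennreal_neg\<close>)
  also have "\<dots> < \<infinity>" using f K unfolding loc_integrable_on_def by blast
  finally have fin: "(\<integral>\<^sup>+x. e2ennreal \<bar>h x\<bar> \<partial>lebesgue) < \<infinity>" .
  note E = ereal_integral_finite[OF h fin]
  from E(1) show "AE x in lebesgue. x \<in> supp \<phi> \<longrightarrow> f x = ereal (real_of_ereal (f x))"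
    by eventually_elim (use K(2) in \<open>auto simp: h_def K_def\<close>)
  define H where "H = (\<lambda>x. real_of_ereal (h x))"
  have H: "integrable lebesgue H" using E(2) by (simp add: H_def)
  then have [measurable]: "H \<in> borel_measurable lebesgue" by simp
  have hr: "H x = indicator K x * real_of_ereal (f x)" for x
    using K(2) by (auto simp: H_def h_def indicator_def)
  have eq: "indicator U x * (real_of_ereal (f x) * \<eta> x) = H x * \<eta> x" if "supp \<eta> \<subseteq> K" for \<eta> x
    unfolding hr using K(2) that not_in_supp[of x \<eta>] by (auto simp: indicator_def)
  have meas: "\<eta> \<in> borel_measurable lebesgue" if "\<eta> \<in> test_functions U" for \<eta>
    using smooth_measurable[OF test_functionsD(1)[OF that]] by (simp add: measurable_completion)
  have int: "integrable lebesgue (\<lambda>x. H x * \<eta> x)" and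
    bound: "\<bar>LINT x|lebesgue. H x * \<eta> x\<bar> \<le> (LINT x|lebesgue. \<bar>H x\<bar>) * M"
    if \<eta>: "\<eta> \<in> test_functions U" "\<And>x. \<bar>\<eta> x\<bar> \<le> M" for \<eta> M
  proof -
    have le: "\<bar>H x * \<eta> x\<bar> \<le> \<bar>H x\<bar> * M" for x
      unfolding abs_mult using \<eta>(2)[of x] by (rule mult_left_mono) (rule abs_ge_zero)
    show int: "integrable lebesgue (\<lambda>x. H x * \<eta> x)"
    proof (rule Bochner_Integration.integrable_bound)
      show "integrable lebesgue (\<lambda>x. \<bar>H x\<bar> * M)" using H by simp
      show "AE x in lebesgue. norm (H x * \<eta> x) \<le> norm (\<bar>H x\<bar> * M)"
        using le by (auto intro!: AE_I2 order.trans[OF le])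
    qed (use meas[OF \<eta>(1)] in measurable)
    have "\<bar>LINT x|lebesgue. H x * \<eta> x\<bar> \<le> (LINT x|lebesgue. \<bar>H x\<bar> * M)"
      by (rule order.trans[OF integral_abs_bound], rule integral_mono) (use int H le in auto)
    then show "\<bar>LINT x|lebesgue. H x * \<eta> x\<bar> \<le> (LINT x|lebesgue. \<bar>H x\<bar>) * M" by simp
  qed
  obtain B where B: "\<And>x. \<bar>\<phi> x\<bar> \<le> B" using test_functions_bounded[OF \<phi>] by blast
  have sub: "supp \<phi> \<subseteq> K" by (simp add: K_def)
  show "integrable lebesgue (\<lambda>x. indicator U x * (real_of_ereal (f x) * \<phi> x))"
    unfolding eq[OF sub] by (rule int[OF \<phi> B])
  show "\<exists>C\<ge>0. \<forall>\<eta>\<in>test_functions U. supp \<eta> \<subseteq> supp \<phi> \<longrightarrow> (\<forall>M. (\<forall>x. \<bar>\<eta> x\<bar> \<le> M) \<longrightarrow>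
      \<bar>LINT x|lebesgue. indicator U x * (real_of_ereal (f x) * \<eta> x)\<bar> \<le> C * M)"
  proof (intro exI[of _ "LINT x|lebesgue. \<bar>H x\<bar>"] conjI ballI impI allI)
    fix \<eta> M assume \<eta>: "\<eta> \<in> test_functions U" "supp \<eta> \<subseteq> supp \<phi>" "\<forall>x. \<bar>\<eta> x\<bar> \<le> M"
    show "\<bar>LINT x|lebesgue. indicator U x * (real_of_ereal (f x) * \<eta> x)\<bar> \<le> (LINT x|lebesgue. \<bar>H x\<bar>) * M"
      unfolding eq[OF \<eta>(2)[folded K_def]] using \<eta>(3) by (intro bound[OF \<eta>(1)]) blast
  qed simp
qed

lemma induced_dist_alt:
  "induced_dist U f \<phi> = (LINT x|lebesgue. indicator U x * (real_of_ereal (f x) * \<phi> x))"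
  by (simp add: induced_dist_def set_lebesgue_integral_def)

text \<open>The distribution has order \<open>0\<close>. The bound available is stated relative to
  the support of a test function, so \<open>K\<close> is first enclosed in the support of a
  cutoff.\<close>

lemma induced_dist_distribution:
  fixes f :: "'a::euclidean_space \<Rightarrow> ereal"
  assumes U: "open U" and f: "loc_integrable_on U f"
  shows "induced_dist U f \<in> distributions U"
  unfolding distributions_def
proof (intro CollectI conjI ballI allI impI)
  note int = loc_integrable_test_function(1)[OF U f]
  show "induced_dist U f (\<lambda>x. \<phi> x + \<eta> x) = induced_dist U f \<phi> + induced_dist U f \<eta>"
    if "\<phi> \<in> test_functions U" "\<eta> \<in> test_functions U" for \<phi> \<eta>
    unfolding induced_dist_alt
    by (subst Bochner_Integration.integral_add[OF int[OF that(1)] int[OF that(2)], symmetric]) (simp add: distrib_left)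
  show "induced_dist U f (\<lambda>x. c * \<phi> x) = c * induced_dist U f \<phi>" for c \<phi>
    unfolding induced_dist_alt by (subst integral_mult_right_zero[symmetric]) (simp add: mult_ac)
  fix K assume K: "compact K \<and> K \<subseteq> U"
  obtain \<kappa> where \<kappa>: "\<kappa> \<in> test_functions U" "\<And>x. x \<in> K \<Longrightarrow> 1 \<le> \<kappa> x"
    using cutoff_exists[OF U] K by meson
  have sub: "K \<subseteq> supp \<kappa>" using \<kappa>(2) not_in_supp[of _ \<kappa>] by fastforce
  obtain C where C: "C \<ge> 0" "\<And>\<eta> M. \<eta> \<in> test_functions U \<Longrightarrow> supp \<eta> \<subseteq> supp \<kappa> \<Longrightarrow> (\<And>x. \<bar>\<eta> x\<bar> \<le> M) \<Longrightarrow>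
      \<bar>induced_dist U f \<eta>\<bar> \<le> C * M"
    using loc_integrable_test_function(3)[OF U f \<kappa>(1)] unfolding induced_dist_alt by blast
  show "\<exists>C N. \<forall>\<phi>\<in>test_functions U. supp \<phi> \<subseteq> K \<longrightarrow> \<bar>induced_dist U f \<phi>\<bar> \<le> C * Ck_norm N \<phi>"
  proof (intro exI[of _ C] exI[of _ 0] ballI impI)
    fix \<phi> assume \<phi>: "\<phi> \<in> test_functions U" "supp \<phi> \<subseteq> K"
    obtain B where B: "\<And>x. \<bar>\<phi> x\<bar> \<le> B" using test_functions_bounded[OF \<phi>(1)] by blast
    have "{vs :: 'a list. set vs \<subseteq> Basis \<and> length vs \<le> 0} = {[]}" by auto
    then have norm: "Ck_norm 0 \<phi> = (SUP x. \<bar>\<phi> x\<bar>)" by (simp add: Ck_norm_def)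
    have "\<bar>\<phi> x\<bar> \<le> Ck_norm 0 \<phi>" for x
      unfolding norm using B by (intro cSUP_upper) (auto intro!: bdd_aboveI[of _ B])
    then show "\<bar>induced_dist U f \<phi>\<bar> \<le> C * Ck_norm 0 \<phi>" using C(2)[OF \<phi>(1)] \<phi>(2) sub by blast
  qed
qed

text \<open>\<open>\<psi>\<close> is controlled on \<open>U\<close> only, hence the indicator. The
  integrand is continuous on the compact support of \<open>\<phi>\<close>, so the completed measure
  can be replaced by Borel measure.\<close>

lemma weighted_test_integral:
  fixes \<psi> :: "'a::euclidean_space \<Rightarrow> real"
  assumes U: "open U" and \<psi>: "continuous_on U \<psi>" and \<phi>: "\<phi> \<in> test_functions U"
  shows "integrable lborel (\<lambda>x. indicator U x * (\<psi> x * \<phi> x))"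
    and "(LINT x:U|lebesgue. \<psi> x * \<phi> x) = (LINT x|lborel. indicator U x * (\<psi> x * \<phi> x))"
proof -
  note \<phi>' = test_functionsD[OF \<phi>]
  show int: "integrable lborel (\<lambda>x. indicator U x * (\<psi> x * \<phi> x))"
  proof (rule integrable_continuous_compact_support[OF _ \<phi>'(2)])
    have "continuous_on (supp \<phi>) (\<lambda>x. \<psi> x * \<phi> x)"
      by (intro continuous_intros continuous_on_subset[OF \<psi> \<phi>'(3)] smooth_continuous_on \<phi>'(1))
    moreover have "\<psi> x * \<phi> x = indicator U x * (\<psi> x * \<phi> x)" if "x \<in> supp \<phi>" for x
      using \<phi>'(3) that by auto
    ultimately show "continuous_on (supp \<phi>) (\<lambda>x. indicator U x * (\<psi> x * \<phi> x))"
      by (rule continuous_on_eq)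
  qed (use not_in_supp[of _ \<phi>] in auto)
  show "(LINT x:U|lebesgue. \<psi> x * \<phi> x) = (LINT x|lborel. indicator U x * (\<psi> x * \<phi> x))"
    unfolding set_lebesgue_integral_def using int by (simp add: integral_completion)
qed

subsection \<open>From distributions to functions\<close>

text \<open>It splits the real Laplacian into the Laplacians along the complex coordinate lines, so
  that positivity of the Levi form yields subharmonicity.\<close>

lemma sum_Basis_complex_vec:
  "(\<Sum>i\<in>(Basis :: (complex ^ 'n::finite) set). g i) = (\<Sum>j\<in>UNIV. g (axis j 1) + g (axis j \<i>))"
proof -
  have B: "(Basis :: (complex ^ 'n) set) = (\<lambda>(j, u). axis j u) ` (UNIV \<times> {1, \<i>})"
    by (auto simp: Basis_vec_def Basis_complex_def)
  have "inj_on (\<lambda>(j, u). axis j u :: complex ^ 'n) (UNIV \<times> {1, \<i>})"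
    by (auto simp: inj_on_def axis_eq_axis)
  then have "(\<Sum>i\<in>(Basis :: (complex ^ 'n) set). g i) = (\<Sum>(j, u)\<in>UNIV \<times> {1, \<i>}. g (axis j u))"
    unfolding B by (subst sum.reindex) (auto simp: case_prod_beta o_def)
  also have "\<dots> = (\<Sum>j\<in>UNIV. \<Sum>u\<in>{1, \<i>}. g (axis j u))"
    by (rule sum.cartesian_product[symmetric])
  finally show ?thesis by simp
qed

lemma i_scalar_axis: "\<i> *s axis j 1 = (axis j \<i> :: complex ^ 'n::finite)"
  by (simp add: vec_eq_iff axis_def)

lemma continuous_lebesgue_on_interval:
  fixes h :: "real \<Rightarrow> real"
  assumes "continuous_on {a..b} h"
  shows "integrable (lebesgue_on {a..b}) h" "(LINT x|lebesgue_on {a..b}. h x) = integral {a..b} h"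
proof -
  show int: "integrable (lebesgue_on {a..b}) h"
    using continuous_imp_integrable_real[OF assms] .
  show "(LINT x|lebesgue_on {a..b}. h x) = integral {a..b} h"
    by (rule lebesgue_integral_eq_integral[OF int]) simp
qed

lemma strictly_psh_distribution_induced:
  fixes U :: "(complex ^ 'n::finite) set"
  assumes U: "open U" and T: "T \<in> distributions U" and psh: "strictly_psh_dist U T"
  shows "\<exists>f :: complex ^ 'n \<Rightarrow> ereal. loc_integrable_on U f \<and> strictly_psh_on_average U f \<and> induces U f T"
proof -
  obtain \<psi> :: "complex ^ 'n \<Rightarrow> real" where \<psi>': "continuous_on U \<psi>" "\<forall>x\<in>U. 0 < \<psi> x"
    "\<forall>\<phi>\<in>test_functions U. (\<forall>x. 0 \<le> \<phi> x) \<longrightarrow>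
      (\<forall>w. 4 * (LINT x:U|lebesgue. \<psi> x * \<phi> x) * (norm w)\<^sup>2 \<le>
        T (dir_deriv w (dir_deriv w \<phi>)) + T (dir_deriv (\<i> *s w) (dir_deriv (\<i> *s w) \<phi>)))"
    using psh[unfolded strictly_psh_dist_iff[OF T]] by (elim exE conjE)
  then have \<psi>: "continuous_on U \<psi>" "\<And>x. x \<in> U \<Longrightarrow> 0 < \<psi> x" by simp_all
  have T\<psi>: "4 * (LINT x:U|lebesgue. \<psi> x * \<phi> x) * (norm w)\<^sup>2 \<le>
      T (dir_deriv w (dir_deriv w \<phi>)) + T (dir_deriv (\<i> *s w) (dir_deriv (\<i> *s w) \<phi>))"
    if "\<phi> \<in> test_functions U" "\<And>x. 0 \<le> \<phi> x" for \<phi> w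
    using bspec[OF \<psi>'(3) that(1)] that(2) by simp
  have weight_nonneg: "0 \<le> (LINT x:U|lebesgue. \<psi> x * \<phi> x)" if "\<And>x. 0 \<le> \<phi> x" for \<phi>
    unfolding set_lebesgue_integral_def
    by (rule Bochner_Integration.integral_nonneg) (use \<psi>(2) that in \<open>auto simp: indicator_def less_imp_le\<close>)
  have pos: "0 \<le> (\<Sum>i\<in>Basis. T (dir_deriv i (dir_deriv i \<phi>)))"
    if \<phi>: "\<phi> \<in> test_functions U" "\<And>x. 0 \<le> \<phi> x" for \<phi>
    unfolding sum_Basis_complex_vec
  proof (rule sum_nonneg)
    fix j :: 'n
    have "0 \<le> 4 * (LINT x:U|lebesgue. \<psi> x * \<phi> x) * (norm (axis j 1 :: complex ^ 'n))\<^sup>2"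
      using weight_nonneg[OF \<phi>(2)] by simp
    also note T\<psi>[OF \<phi>, of "axis j 1"]
    finally show "0 \<le> T (dir_deriv (axis j 1) (dir_deriv (axis j 1) \<phi>)) + T (dir_deriv (axis j \<i>) (dir_deriv (axis j \<i>) \<phi>))"
      by (simp add: i_scalar_axis)
  qed

  \<comment> \<open>The monotone limit of the mollifications\<close>
  define \<epsilon> where "\<epsilon> = (\<lambda>k. exp (- real k))"
  define u where "u = (\<lambda>k x. T (\<lambda>y. mollifier (- real k) (x - y)))"
  \<comment> \<open>The mollifier \<open>u k\<close> has radius \<open>\<epsilon> k\<close>. Asking
    for room \<open>2 * \<epsilon> k\<close> provides the strict inequalities between radii that
    monotonicity and continuity of mollifications demand.\<close>
  define adm where "adm = (\<lambda>k x. cball x (2 * \<epsilon> k) \<subseteq> U)"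
  \<comment> \<open>Which mollifications are available depends on \<open>x\<close>, so an infimum
    over the admissible indices replaces a limit; monotonicity makes it the limit of every
    admissible tail.\<close>
  define f where "f = (\<lambda>x. INF k\<in>{k. adm k x}. ereal (u k x))"
  have \<epsilon>: "0 < \<epsilon> k" "k \<le> l \<Longrightarrow> \<epsilon> l \<le> \<epsilon> k" for k l by (simp_all add: \<epsilon>_def)
  have \<epsilon>_ex: "\<exists>k. 2 * \<epsilon> k \<le> r" if r: "0 < r" for r
  proof -
    obtain k :: nat where "- ln (r / 2) < real k" using reals_Archimedean2 by blast
    then have "exp (- real k) \<le> exp (ln (r / 2))" by simp
    then show ?thesis using r by (intro exI[of _ k]) (simp add: \<epsilon>_def)
  qed
  have adm_U: "x \<in> U" if "adm k x" for k x
    using that \<epsilon>(1)[of k] by (auto simp: adm_def)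
  have adm_mono: "adm l x" if "adm k x" "k \<le> l" for k l x
  proof -
    have "cball x (2 * \<epsilon> l) \<subseteq> cball x (2 * \<epsilon> k)" using \<epsilon>(2)[OF that(2)] by (intro subset_cball) simp
    with that(1) show ?thesis unfolding adm_def by blast
  qed
  have u_mono: "u l x \<le> u k x" if "adm k x" "k \<le> l" for k l x
    unfolding u_def
  proof (rule mollification_mono[OF T pos])
    show "cball x (2 * \<epsilon> k) \<subseteq> U" using that(1) by (simp add: adm_def)
  qed (use that(2) in \<open>auto simp: \<epsilon>_def\<close>)
  have adm_ex: "\<exists>k. adm k x" if x: "x \<in> U" for x
  proof -
    obtain r where r: "r > 0" "cball x r \<subseteq> U" using U[unfolded open_contains_cball] x by blast
    obtain k where "2 * \<epsilon> k \<le> r" using \<epsilon>_ex[OF r(1)] by blast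
    then have "cball x (2 * \<epsilon> k) \<subseteq> cball x r" by (rule subset_cball)
    with r(2) show ?thesis unfolding adm_def by blast
  qed
  have f_le: "f x \<le> ereal (u k x)" if "adm k x" for k x
    unfolding f_def using that by (intro INF_lower) simp
  have u_decseq: "decseq (\<lambda>j. u (k + j) x)" if "adm k x" for k x
    unfolding decseq_def using u_mono adm_mono[OF that] by simp
  have f_lim: "(\<lambda>j. ereal (u (k + j) x)) \<longlonglongrightarrow> f x" if adm: "adm k x" for k x
  proof -
    have "f x = (INF j. ereal (u (k + j) x))"
    proof (rule antisym)
      show "f x \<le> (INF j. ereal (u (k + j) x))"
        by (intro INF_greatest f_le adm_mono[OF adm]) simp
      show "(INF j. ereal (u (k + j) x)) \<le> f x"
        unfolding f_def
      proof (rule INF_greatest)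
        fix l assume "l \<in> {k. adm k x}"
        then have "u (k + l) x \<le> u l x" by (intro u_mono) auto
        then show "(INF j. ereal (u (k + j) x)) \<le> ereal (u l x)" by (intro INF_lower2[of l]) auto
      qed
    qed
    moreover have "decseq (\<lambda>j. ereal (u (k + j) x))"
      using u_decseq[OF adm] by (simp add: decseq_def)
    ultimately show ?thesis using LIMSEQ_INF by simp
  qed
  have u_cont: "isCont (u k) x" if "adm k x" for k x
    unfolding u_def
  proof (rule mollification_continuous[OF T smooth_mollifier])
    show "norm z \<le> \<epsilon> k" if "mollifier (- real k) z \<noteq> 0" for z :: "complex ^ 'n"
      using mollifier_nonzeroD[OF that] by (simp add: \<epsilon>_def)
    show "cball x (2 * \<epsilon> k) \<subseteq> U" using that by (simp add: adm_def)
  qed (use \<epsilon>(1)[of k] in simp)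
  have u_cont_on: "continuous_on S (u k)" if "\<And>x. x \<in> S \<Longrightarrow> adm k x" for k S
    using that u_cont by (intro continuous_at_imp_continuous_on) blast
  have f_less: "f x < \<infinity>" if x: "x \<in> U" for x
  proof -
    obtain k where "adm k x" using adm_ex[OF x] by blast
    from f_le[OF this] show ?thesis by (rule order.strict_trans1) simp
  qed

  \<comment> \<open>Upper semicontinuity of the limit\<close>
  have usc: "upper_semicontinuous_on U f"
    unfolding upper_semicontinuous_on_def
  proof
    fix c
    show "openin (top_of_set U) {x \<in> U. f x < c}"
      unfolding openin_euclidean_subtopology_iff
    proof (intro conjI ballI)
      fix x assume "x \<in> {x \<in> U. f x < c}"
      then obtain k where k: "adm k x" "ereal (u k x) < c" unfolding f_def INF_less_iff by auto
      \<comment> \<open>Admissibility of \<open>k\<close> need not persist near \<open>x\<close>.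
        The smaller radius of \<open>Suc k\<close> leaves a gap, so \<open>Suc k\<close> is
        admissible at all nearby points, and its value at \<open>x\<close> is no larger.\<close>
      have "adm (Suc k) x" by (rule adm_mono[OF k(1)]) simp
      have less: "ereal (u (Suc k) x) < c"
        using u_mono[OF k(1), of "Suc k"] k(2) by (simp add: order.strict_trans1[of _ "ereal (u k x)"])
      have "((\<lambda>y. ereal (u (Suc k) y)) \<longlongrightarrow> ereal (u (Suc k) x)) (nhds x)"
        using u_cont[OF \<open>adm (Suc k) x\<close>] by (simp add: isCont_def tendsto_at_iff_tendsto_nhds)
      then have "\<forall>\<^sub>F y in nhds x. ereal (u (Suc k) y) < c" using less by (rule order_tendstoD(2))
      then obtain d where d: "d > 0" "\<And>y. dist y x < d \<Longrightarrow> ereal (u (Suc k) y) < c"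
        unfolding eventually_nhds_metric by blast
      have gap: "\<epsilon> (Suc k) < \<epsilon> k" by (simp add: \<epsilon>_def)
      have "y \<in> {x \<in> U. f x < c}" if "y \<in> U" "dist y x < min d (2 * \<epsilon> k - 2 * \<epsilon> (Suc k))" for y
      proof -
        have "cball y (2 * \<epsilon> (Suc k)) \<subseteq> cball x (2 * \<epsilon> k)"
          using that(2) by (intro cball_subset_cball_iff[THEN iffD2] disjI1) (simp add: dist_commute)
        then have "adm (Suc k) y" using k(1) unfolding adm_def by blast
        from f_le[OF this] have "f y < c" using d(2)[of y] that(2) by (simp add: order.strict_trans1)
        with that(1) show ?thesis by simp
      qed
      then show "\<exists>e>0. \<forall>x'\<in>U. dist x' x < e \<longrightarrow> x' \<in> {x \<in> U. f x < c}"
        using d(1) gap by (intro exI[of _ "min d (2 * \<epsilon> k - 2 * \<epsilon> (Suc k))"]) auto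
    qed auto
  qed
  have adm_compact: "\<exists>k. \<forall>x\<in>K. adm k x" if K: "compact K" "K \<subseteq> U" for K
  proof -
    obtain r where r: "r > 0" "(\<Union>x\<in>K. cball x r) \<subseteq> U"
      using compact_subset_open_imp_cball_epsilon_subset[OF K(1) U K(2)] by blast
    obtain k where k: "2 * \<epsilon> k \<le> r" using \<epsilon>_ex[OF r(1)] by blast
    have "adm k x" if "x \<in> K" for x
      using subset_cball[OF k, of x] r(2) that unfolding adm_def by blast
    then show ?thesis by blast
  qed
  have u_int: "integrable lborel (\<lambda>x. \<phi> x * u (k + j) x)"
    if \<phi>: "\<phi> \<in> test_functions U" "\<And>x. x \<in> supp \<phi> \<Longrightarrow> adm k x" for \<phi> k j
  proof (rule integrable_continuous_compact_support)
    show "continuous_on (supp \<phi>) (\<lambda>x. \<phi> x * u (k + j) x)"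
      using \<phi>(2) adm_mono
      by (intro continuous_intros smooth_continuous_on test_functionsD(1)[OF \<phi>(1)] u_cont_on) (meson le_add1)
  qed (use test_functionsD[OF \<phi>(1)] not_in_supp[of _ \<phi>] in auto)
  have u_tendsto: "(\<lambda>j. LINT x|lborel. \<phi> x * u (k + j) x) \<longlonglongrightarrow> T \<phi>" if \<phi>: "\<phi> \<in> test_functions U" for \<phi> k
  proof -
    have "filterlim (\<lambda>j. - real (k + j)) at_bot sequentially"
      unfolding filterlim_uminus_at_bot minus_minus
      by (rule filterlim_compose[OF filterlim_real_sequentially], rule filterlim_at_top_mono[OF filterlim_ident]) simp
    from filterlim_compose[OF mollification_tendsto[OF T U \<phi>] this]
    show ?thesis by (simp add: u_def)
  qed

  \<comment> \<open>Local integrability of the limit\<close>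
  have loc: "loc_integrable_on U f"
    unfolding loc_integrable_on_def
  proof (intro conjI allI impI)
    show "f \<in> borel_measurable (lebesgue_on U)" by (rule upper_semicontinuous_measurable(2)[OF U usc])
    fix K assume K: "compact K \<and> K \<subseteq> U"
    obtain \<kappa> where \<kappa>: "\<kappa> \<in> test_functions U" "\<And>x. 0 \<le> \<kappa> x" "\<And>x. x \<in> K \<Longrightarrow> 1 \<le> \<kappa> x"
      using cutoff_exists[OF U] K by meson
    obtain k where k: "\<And>x. x \<in> supp \<kappa> \<Longrightarrow> adm k x"
      using adm_compact test_functionsD(2,3)[OF \<kappa>(1)] by meson
    define H where "H = (\<lambda>x. if x \<in> supp \<kappa> then ereal (\<kappa> x) * f x else 0)"
    have dec: "decseq (\<lambda>j. \<kappa> x * u (k + j) x)" for x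
    proof (cases "x \<in> supp \<kappa>")
      case True
      then show ?thesis using u_decseq[OF k[OF True]] \<kappa>(2) by (auto simp: decseq_def intro: mult_left_mono)
    next
      case False
      then show ?thesis using not_in_supp[of x \<kappa>] by (simp add: decseq_def)
    qed
    have fin: "(\<integral>\<^sup>+x. e2ennreal \<bar>H x\<bar> \<partial>lborel) < \<infinity>"
    proof (rule monotone_limit_integral(2))
      show "integrable lborel (\<lambda>x. \<kappa> x * u (k + j) x)" for j by (rule u_int[OF \<kappa>(1) k])
      show "decseq (\<lambda>j. \<kappa> x * u (k + j) x)" for x by (rule dec)
      show "(\<lambda>j. ereal (\<kappa> x * u (k + j) x)) \<longlonglongrightarrow> H x" for x
      proof (cases "x \<in> supp \<kappa>")
        case True
        have "(\<lambda>j. ereal (\<kappa> x) * ereal (u (k + j) x)) \<longlonglongrightarrow> ereal (\<kappa> x) * f x"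
          by (rule tendsto_cmult_ereal[OF _ f_lim[OF k[OF True]]]) simp
        then show ?thesis using True by (simp add: H_def)
      next
        case False
        then show ?thesis using not_in_supp[of x \<kappa>] by (simp add: H_def zero_ereal_def)
      qed
      \<comment> \<open>The integrals against the nonnegative cutoff decrease, and their limit is
        \<open>T \<kappa>\<close>. This finite lower bound prevents the limit function from being
        \<open>-\<infinity>\<close> on too large a set.\<close>
      show "T \<kappa> \<le> (LINT x|lborel. \<kappa> x * u (k + j) x)" for j
      proof (rule decseq_ge[OF _ u_tendsto[OF \<kappa>(1)]])
        show "decseq (\<lambda>j. LINT x|lborel. \<kappa> x * u (k + j) x)"
          unfolding decseq_def using dec by (auto intro!: integral_mono u_int[OF \<kappa>(1) k] simp: decseq_def)
      qed
    qed
    have "set_nn_integral lebesgue K (\<lambda>x. e2ennreal \<bar>f x\<bar>) \<le> (\<integral>\<^sup>+x. e2ennreal \<bar>H x\<bar> \<partial>lebesgue)"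
    proof (rule nn_integral_mono)
      fix x
      show "e2ennreal \<bar>f x\<bar> * indicator K x \<le> e2ennreal \<bar>H x\<bar>"
      proof (cases "x \<in> K")
        case True
        have "x \<in> supp \<kappa>" using \<kappa>(3)[OF True] not_in_supp[of x \<kappa>] by fastforce
        have "1 * \<bar>f x\<bar> \<le> ereal (\<kappa> x) * \<bar>f x\<bar>"
          using \<kappa>(3)[OF True] by (intro ereal_mult_right_mono) (auto simp: one_ereal_def)
        also have "\<dots> = \<bar>H x\<bar>" using \<open>x \<in> supp \<kappa>\<close> \<kappa>(3)[OF True] by (cases "f x") (auto simp: H_def abs_mult)
        finally show ?thesis using True by (simp add: e2ennreal_mono)
      qed simp
    qed
    also have "\<dots> < \<infinity>" using fin by (simp only: nn_integral_completion)
    finally show "set_nn_integral lebesgue K (\<lambda>x. e2ennreal \<bar>f x\<bar>) < \<infinity>" .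
  qed

  \<comment> \<open>The limit induces the distribution\<close>
  have ind: "induces U f T"
    unfolding induces_def
  proof
    fix \<phi> assume \<phi>: "\<phi> \<in> test_functions U"
    obtain k where k: "\<And>x. x \<in> supp \<phi> \<Longrightarrow> adm k x"
      using adm_compact test_functionsD(2,3)[OF \<phi>] by meson
    note int_f = loc_integrable_test_function(1,2)[OF U loc \<phi>]
    define g where "g = (\<lambda>x. indicator U x * (real_of_ereal (f x) * \<phi> x))"
    have int_u: "integrable lebesgue (\<lambda>x. \<phi> x * u (k + j) x)" for j
      using u_int[OF \<phi> k, of j] integrable_completion[of "\<lambda>x. \<phi> x * u (k + j) x" lborel] by auto
    have "(\<lambda>j. LINT x|lebesgue. \<phi> x * u (k + j) x) \<longlonglongrightarrow> (LINT x|lebesgue. g x)"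
    proof (rule integral_dominated_convergence)
      show "g \<in> borel_measurable lebesgue" using int_f(1) by (simp add: g_def)
      show "(\<lambda>x. \<phi> x * u (k + j) x) \<in> borel_measurable lebesgue" for j using int_u[of j] by simp
      \<comment> \<open>Every later mollification lies between \<open>f\<close> and
        \<open>u k\<close>, which gives the majorant.\<close>
      show "integrable lebesgue (\<lambda>x. \<bar>\<phi> x * u (k + 0) x\<bar> + \<bar>g x\<bar>)"
        using int_u[of 0] int_f(1) unfolding g_def by (intro Bochner_Integration.integrable_add integrable_abs)
      have *: "f x = ereal (real_of_ereal (f x)) \<and> g x = real_of_ereal (f x) * \<phi> x"
        if "x \<in> supp \<phi> \<longrightarrow> f x = ereal (real_of_ereal (f x))" "x \<in> supp \<phi>" for x
        using that test_functionsD(3)[OF \<phi>] by (auto simp: g_def)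
      have zero: "\<phi> x = 0 \<and> g x = 0" if "x \<notin> supp \<phi>" for x
        using not_in_supp[OF that] by (simp add: g_def)
      from int_f(2) show "AE x in lebesgue. (\<lambda>j. \<phi> x * u (k + j) x) \<longlonglongrightarrow> g x"
      proof eventually_elim
        case (elim x)
        show ?case
        proof (cases "x \<in> supp \<phi>")
          case True
          note E = *[OF elim True]
          have "(\<lambda>j. ereal (u (k + j) x)) \<longlonglongrightarrow> ereal (real_of_ereal (f x))"
            using f_lim[OF k[OF True]] E by simp
          then have "(\<lambda>j. \<phi> x * u (k + j) x) \<longlonglongrightarrow> \<phi> x * real_of_ereal (f x)"
            by (intro tendsto_mult tendsto_const) simp
          then show ?thesis using E by (simp add: mult.commute)
        qed (use zero in simp)
      qed
      show "AE x in lebesgue. norm (\<phi> x * u (k + j) x) \<le> \<bar>\<phi> x * u (k + 0) x\<bar> + \<bar>g x\<bar>" for j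
        using int_f(2)
      proof eventually_elim
        case (elim x)
        show ?case
        proof (cases "x \<in> supp \<phi>")
          case True
          note E = *[OF elim True]
          have up: "u (k + j) x \<le> u (k + 0) x" using u_mono[OF k[OF True], of "k + j"] by simp
          have "f x \<le> ereal (u (k + j) x)" by (rule f_le[OF adm_mono[OF k[OF True]]]) simp
          then have lo: "real_of_ereal (f x) \<le> u (k + j) x" using E by (metis ereal_less_eq(3))
          have "\<bar>u (k + j) x\<bar> \<le> \<bar>u (k + 0) x\<bar> + \<bar>real_of_ereal (f x)\<bar>" using up lo by linarith
          then have "\<bar>\<phi> x\<bar> * \<bar>u (k + j) x\<bar> \<le> \<bar>\<phi> x\<bar> * (\<bar>u (k + 0) x\<bar> + \<bar>real_of_ereal (f x)\<bar>)"
            by (rule mult_left_mono) simp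
          then show ?thesis using E by (simp add: abs_mult distrib_left mult.commute)
        qed (use zero in simp)
      qed
    qed
    moreover have "(LINT x|lebesgue. \<phi> x * u (k + j) x) = (LINT x|lborel. \<phi> x * u (k + j) x)" for j
      using u_int[OF \<phi> k, of j] by (intro integral_completion) auto
    ultimately have "(\<lambda>j. LINT x|lborel. \<phi> x * u (k + j) x) \<longlonglongrightarrow> (LINT x|lebesgue. g x)" by simp
    from LIMSEQ_unique[OF u_tendsto[OF \<phi>] this]
    show "T \<phi> = induced_dist U f \<phi>" by (simp add: induced_dist_alt g_def)
  qed

  \<comment> \<open>The mean value inequality for the limit, uniformly near each point\<close>
  have mean: "\<exists>r>0. \<forall>x\<in>ball a0 r \<inter> U. \<forall>b. norm b < r \<longrightarrow>
      {x + \<zeta> *s b |\<zeta>. norm \<zeta> \<le> 1} \<subseteq> U \<and> ereal (\<psi> x / 2 * (norm b)\<^sup>2) + f x \<le> circle_mean f x b" if a0: "a0 \<in> U" for a0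
  proof -
    \<comment> \<open>A constant strictly between \<open>\<psi> a0 / 2\<close> and
      \<open>\<psi> a0\<close>. Near \<open>a0\<close> it is a lower bound for the weight
      \<open>\<psi>\<close> under the mollifier and an upper bound for the weight
      \<open>\<psi> / 2\<close> claimed at the centre.\<close>
    define m where "m = 3 / 4 * \<psi> a0"
    have m: "0 < m" using \<psi>(2)[OF a0] by (simp add: m_def)
    have "\<forall>\<^sub>F x in nhds a0. m < \<psi> x \<and> \<psi> x < 2 * m"
    proof -
      have "isCont \<psi> a0" using \<psi>(1) U a0 continuous_on_eq_continuous_at by blast
      then have "(\<psi> \<longlongrightarrow> \<psi> a0) (nhds a0)" by (simp add: isCont_def tendsto_at_iff_tendsto_nhds)
      then show ?thesis
        using \<psi>(2)[OF a0] by (intro eventually_conj order_tendstoD(1) order_tendstoD(2)) (auto simp: m_def)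
    qed
    moreover have "\<forall>\<^sub>F x in nhds a0. x \<in> U" using U a0 by (rule eventually_nhds_in_open)
    ultimately have "\<forall>\<^sub>F x in nhds a0. x \<in> U \<and> m < \<psi> x \<and> \<psi> x < 2 * m" by eventually_elim blast
    then obtain d where d: "d > 0" "\<And>x. dist x a0 < d \<Longrightarrow> x \<in> U \<and> m < \<psi> x \<and> \<psi> x < 2 * m"
      unfolding eventually_nhds_metric by blast
    \<comment> \<open>Centres lie within \<open>r\<close> of \<open>a0\<close>, discs have radius
      below \<open>r\<close>, and \<open>2 * \<epsilon> k\<close> is at most \<open>r\<close>.
      Everything stays within \<open>4 * r\<close>, which is less than \<open>d\<close>.\<close>
    define r where "r = d / 5"
    have r: "r > 0" using d(1) by (simp add: r_def)
    have near: "x \<in> U" "m \<le> \<psi> x" "\<psi> x / 2 \<le> m" if "dist a0 x \<le> 4 * r" for x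
      using d(2)[of x] that d(1) by (auto simp: r_def dist_commute)
    obtain k0 where k0: "2 * \<epsilon> k0 \<le> r" using \<epsilon>_ex[OF r] by blast
    have "{x + \<zeta> *s b |\<zeta>. norm \<zeta> \<le> 1} \<subseteq> U \<and> ereal (\<psi> x / 2 * (norm b)\<^sup>2) + f x \<le> circle_mean f x b"
      if x: "x \<in> ball a0 r \<inter> U" and b: "norm b < r" for x b
    proof
      have dx: "dist a0 x < r" using x by simp
      have disc: "dist a0 (x + \<zeta> *s b) \<le> 2 * r" if "norm \<zeta> \<le> 1" for \<zeta>
      proof -
        have "norm (\<zeta> *s b) \<le> r"
          using that b mult_mono[of "norm \<zeta>" 1 "norm b" r] by (simp add: norm_vector_scalar)
        then have "dist x (x + \<zeta> *s b) \<le> r" by (simp add: dist_norm)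
        then show ?thesis using dist_triangle[of a0 "x + \<zeta> *s b" x] dx by linarith
      qed
      show "{x + \<zeta> *s b |\<zeta>. norm \<zeta> \<le> 1} \<subseteq> U"
      proof
        fix z assume "z \<in> {x + \<zeta> *s b |\<zeta>. norm \<zeta> \<le> 1}"
        then have "dist a0 z \<le> 4 * r" using disc r by fastforce
        then show "z \<in> U" by (rule near(1))
      qed
      have adm: "adm k z" if z: "dist a0 z \<le> 2 * r" and k: "k0 \<le> k" for z k
        unfolding adm_def
      proof
        fix y assume "y \<in> cball z (2 * \<epsilon> k)"
        then have "dist z y \<le> r" using k0 \<epsilon>(2)[OF k] by simp
        then have "dist a0 y \<le> 4 * r" using z r dist_triangle[of a0 y z] by linarith
        then show "y \<in> U" by (rule near(1))
      qed
      have circ: "dist a0 (x + cis \<theta> *s b) \<le> 2 * r" for \<theta> using disc[of "cis \<theta>"] by simp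
      have mean_k: "2 * pi * (u k x + m * (norm b)\<^sup>2) \<le> integral {0..2 * pi} (\<lambda>\<theta>. u k (x + cis \<theta> *s b))"
        if k: "k0 \<le> k" for k
      proof -
        define g :: "complex ^ 'n \<Rightarrow> real" where "g = mollifier (- real k)"
        have g: "smooth g" unfolding g_def by (rule smooth_mollifier)
        have \<epsilon>k: "2 * \<epsilon> k \<le> r" using k0 \<epsilon>(2)[OF k] by linarith
        have "2 * pi * (T (\<lambda>y. g (x - y)) + (4 * (m * (norm b)\<^sup>2)) / 4) \<le>
          integral {0..2 * pi} (\<lambda>\<theta>. T (\<lambda>y. g (x + (cos \<theta> *\<^sub>R b + sin \<theta> *\<^sub>R (\<i> *s b)) - y)))"
        proof (rule distribution_mean_value[OF T g _ _ b])
          show "norm z \<le> \<epsilon> k" if "g z \<noteq> 0" for z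
            using that mollifier_nonzeroD[of "- real k" z] by (simp add: g_def \<epsilon>_def)
          show "cball x (r + \<epsilon> k) \<subseteq> U"
          proof
            fix y assume "y \<in> cball x (r + \<epsilon> k)"
            then have "dist a0 y \<le> 4 * r" using dx r \<epsilon>k \<epsilon>(1)[of k] dist_triangle[of a0 y x] by simp
            then show "y \<in> U" by (rule near(1))
          qed
          show "norm (cos \<theta> *\<^sub>R b + sin \<theta> *\<^sub>R (\<i> *s b)) \<le> norm b" for \<theta>
            unfolding cis_vector_scalar[symmetric] by (simp add: norm_vector_scalar)
          fix z assume z: "z \<in> cball x r"
          define h where "h = (\<lambda>y. g (z - y))"
          have supp_h: "dist a0 y \<le> 4 * r" if "h y \<noteq> 0" for y
          proof -
            have "dist z y < \<epsilon> k" using that mollifier_nonzeroD[of "- real k" "z - y"] by (simp add: h_def g_def \<epsilon>_def dist_norm)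
            then show ?thesis using z dx \<epsilon>k \<epsilon>(1)[of k] r dist_triangle[of a0 y z] dist_triangle[of a0 z x] by simp
          qed
          have h: "h \<in> test_functions U"
          proof (rule test_functionsI)
            show "smooth h" unfolding h_def by (rule smooth_reflect[OF g])
            show "cball a0 (4 * r) \<subseteq> U" using near(1) by auto
          qed (use supp_h in auto)
          have h0: "0 \<le> h y" for y by (simp add: h_def g_def)
          have hm: "integrable lborel h" "(LINT y|lborel. h y) = 1"
            unfolding h_def g_def by (rule mollifier_integral_shift)+
          \<comment> \<open>The mollifier has total mass \<open>1\<close> and its support lies where
            \<open>\<psi>\<close> is at least \<open>m\<close>, so the weight term of the Levi
            inequality is bounded below by \<open>m\<close>.\<close>
          have "m = (LINT y|lborel. m * h y)" using hm by simp
          also have "\<dots> \<le> (LINT y|lborel. indicator U y * (\<psi> y * h y))"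
          proof (rule integral_mono)
            show "integrable lborel (\<lambda>y. m * h y)" using hm by simp
            show "integrable lborel (\<lambda>y. indicator U y * (\<psi> y * h y))"
              by (rule weighted_test_integral(1)[OF U \<psi>(1) h])
            show "m * h y \<le> indicator U y * (\<psi> y * h y)" for y
              using near(1,2)[OF supp_h[of y]] h0[of y] by (cases "h y = 0") (auto intro: mult_right_mono)
          qed
          also have "\<dots> = (LINT y:U|lebesgue. \<psi> y * h y)"
            by (rule weighted_test_integral(2)[OF U \<psi>(1) h, symmetric])
          finally have "4 * m * (norm b)\<^sup>2 \<le> 4 * (LINT y:U|lebesgue. \<psi> y * h y) * (norm b)\<^sup>2"
            by (intro mult_right_mono) auto
          also have "\<dots> \<le> T (dir_deriv b (dir_deriv b h)) + T (dir_deriv (\<i> *s b) (dir_deriv (\<i> *s b) h))"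
            by (rule T\<psi>[OF h h0])
          finally have "4 * (m * (norm b)\<^sup>2) \<le>
              T (dir_deriv b (dir_deriv b h)) + T (dir_deriv (\<i> *s b) (dir_deriv (\<i> *s b) h))" by (simp add: mult.assoc)
          moreover have "dir_deriv w (dir_deriv w h) = (\<lambda>y. dir_deriv w (dir_deriv w g) (z - y))" for w
            using iter_deriv_reflect[OF g, of "[w, w]" z] by (simp add: iter_deriv_Cons h_def)
          ultimately show "4 * (m * (norm b)\<^sup>2) \<le> T (\<lambda>y. dir_deriv b (dir_deriv b g) (z - y)) +
              T (\<lambda>y. dir_deriv (\<i> *s b) (dir_deriv (\<i> *s b) g) (z - y))" by simp
        qed
        then show ?thesis by (simp add: u_def g_def cis_vector_scalar)
      qed
      show "ereal (\<psi> x / 2 * (norm b)\<^sup>2) + f x \<le> circle_mean f x b"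
      \<comment> \<open>Only a finite value needs an argument: \<open>\<infinity>\<close> does not
        occur on \<open>U\<close>, and for \<open>-\<infinity>\<close> the left side is
        \<open>-\<infinity>\<close>.\<close>
      proof (cases "f x")
        case (real c)
        have u_circ: "continuous_on {0..2 * pi} (\<lambda>\<theta>. u (k0 + j) (x + cis \<theta> *s b))" for j
        proof (rule continuous_on_compose2[of "(\<lambda>\<theta>. x + cis \<theta> *s b) ` {0..2 * pi}"])
          show "continuous_on ((\<lambda>\<theta>. x + cis \<theta> *s b) ` {0..2 * pi}) (u (k0 + j))"
            by (rule u_cont_on) (use adm circ in auto)
          show "continuous_on {0..2 * pi} (\<lambda>\<theta>. x + cis \<theta> *s b)"
            unfolding cis_vector_scalar by (intro continuous_intros)
        qed auto
        let ?M = "lebesgue_on {0..2 * pi}"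
        have prems: "integrable ?M (\<lambda>\<theta>. u (k0 + j) (x + cis \<theta> *s b))"
          "decseq (\<lambda>j. u (k0 + j) (x + cis \<theta> *s b))"
          "(\<lambda>j. ereal (u (k0 + j) (x + cis \<theta> *s b))) \<longlonglongrightarrow> f (x + cis \<theta> *s b)" for j \<theta>
          using continuous_lebesgue_on_interval(1)[OF u_circ[of j]] u_decseq[OF adm[OF circ[of \<theta>] order_refl]]
            f_lim[OF adm[OF circ[of \<theta>] order_refl]] by auto
        \<comment> \<open>The gain does not depend on the mollification index and \<open>u\<close>
          dominates \<open>f\<close> at the centre. Hence one lower bound serves the whole
          decreasing sequence on the circle.\<close>
        have B: "2 * pi * (c + m * (norm b)\<^sup>2) \<le> (LINT \<theta>|?M. u (k0 + j) (x + cis \<theta> *s b))" for j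
        proof -
          have "f x \<le> ereal (u (k0 + j) x)"
            using dx r by (intro f_le adm) auto
          then have "c \<le> u (k0 + j) x" using real by simp
          then have "2 * pi * (c + m * (norm b)\<^sup>2) \<le> 2 * pi * (u (k0 + j) x + m * (norm b)\<^sup>2)"
            by (intro mult_left_mono) auto
          also have "\<dots> \<le> integral {0..2 * pi} (\<lambda>\<theta>. u (k0 + j) (x + cis \<theta> *s b))" by (rule mean_k) simp
          finally show ?thesis using continuous_lebesgue_on_interval(2)[OF u_circ[of j]] by simp
        qed
        note lim = monotone_limit_integral[where M="?M" and h="\<lambda>j \<theta>. u (k0 + j) (x + cis \<theta> *s b)"
            and H="\<lambda>\<theta>. f (x + cis \<theta> *s b)", OF prems(1) prems(2) prems(3) B]
        have "circle_mean f x b = ereal (1 / (2 * pi) * (LINT \<theta>|?M. real_of_ereal (f (x + cis \<theta> *s b))))"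
          unfolding circle_mean_def ereal_integral_finite(3)[OF lim(1,2)] by simp
        moreover have "\<psi> x / 2 * (norm b)\<^sup>2 + c \<le> 1 / (2 * pi) * (LINT \<theta>|?M. real_of_ereal (f (x + cis \<theta> *s b)))"
        proof -
          have "\<psi> x / 2 * (norm b)\<^sup>2 \<le> m * (norm b)\<^sup>2"
            using near(3)[of x] dx r by (intro mult_right_mono) auto
          moreover have "1 / (2 * pi) * (2 * pi * (c + m * (norm b)\<^sup>2)) \<le> 1 / (2 * pi) * (LINT \<theta>|?M. real_of_ereal (f (x + cis \<theta> *s b)))"
            by (intro mult_left_mono lim(3)) auto
          ultimately show ?thesis by simp
        qed
        ultimately show ?thesis using real by simp
      next
        case PInf
        then show ?thesis using f_less[of x] x by simp
      next
        case MInf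
        then show ?thesis by simp
      qed
    qed
    then show ?thesis using r by blast
  qed
  obtain \<delta> :: "complex ^ 'n \<Rightarrow> real" where "lower_semicontinuous_on U \<delta>" "\<forall>x\<in>U. 0 < \<delta> x"
    "\<forall>a\<in>U. \<forall>b. norm b < \<delta> a \<longrightarrow> {a + \<zeta> *s b |\<zeta>. norm \<zeta> \<le> 1} \<subseteq> U \<and>
      ereal (\<psi> a / 2 * (norm b)\<^sup>2) + f a \<le> circle_mean f a b"
    using lower_semicontinuous_radius[of U "\<lambda>a b. {a + \<zeta> *s b |\<zeta>. norm \<zeta> \<le> 1} \<subseteq> U \<and>
      ereal (\<psi> a / 2 * (norm b)\<^sup>2) + f a \<le> circle_mean f a b", OF mean] by blast
  moreover have "continuous_on U (\<lambda>x. \<psi> x / 2)" "\<forall>x\<in>U. 0 < \<psi> x / 2"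
    using \<psi> by (auto intro!: continuous_intros)
  ultimately have "strictly_psh_on_average U f"
    unfolding strictly_psh_on_average_def using usc f_less
    by (intro conjI ballI exI[of _ "\<lambda>x. \<psi> x / 2"] exI[of _ \<delta>]) auto
  with loc ind show ?thesis by blast
qed

subsection \<open>Local integrability of functions that are subharmonic on average\<close>

abbreviation circle :: "real measure" where
  "circle \<equiv> lebesgue_on {0..2 * pi}"

lemma finite_measure_circle: "finite_measure circle"
  by (rule finite_measure_lebesgue_on) (metis cbox_interval lmeasurable_cbox)

lemma emeasure_circle: "emeasure circle (space circle) = ennreal (2 * pi)"
  by (simp add: emeasure_restrict_space space_restrict_space)

lemma measurable_circle_ident: "(\<lambda>\<theta>. \<theta>) \<in> measurable circle borel"
  by (rule measurable_restrict_space1) (simp add: measurable_completion)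

lemma continuous_rotate: "continuous_on S (\<lambda>\<theta>. x + cis \<theta> *s (b :: complex ^ 'n::finite))"
  unfolding cis_vector_scalar by (intro continuous_intros)

lemma measurable_circle_compose:
  fixes g :: "complex ^ 'n::finite \<Rightarrow> 'c::topological_space"
  assumes "g \<in> borel_measurable borel"
  shows "(\<lambda>\<theta>. g (x + cis \<theta> *s b)) \<in> borel_measurable circle"
proof -
  have "(\<lambda>\<theta>. x + cis \<theta> *s b) \<in> borel_measurable borel"
    by (intro borel_measurable_continuous_onI continuous_rotate)
  from measurable_compose[OF measurable_circle_ident measurable_compose[OF this assms]] show ?thesis .
qed

text \<open>Joint measurability for Fubini's theorem: in the first form the centre varies and the
  radius vector is fixed, as when means are shifted to a test function; in the second the centre is
  fixed and the radius vector varies over a ball.\<close>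

lemma measurable_circle_product:
  fixes g :: "complex ^ 'n::finite \<Rightarrow> 'c::topological_space"
  assumes "g \<in> borel_measurable borel"
  shows "(\<lambda>(\<theta>, x). g (c + x + cis \<theta> *s b)) \<in> borel_measurable (circle \<Otimes>\<^sub>M lborel)"
    and "(\<lambda>(\<theta>, x). g (c + cis \<theta> *s x)) \<in> borel_measurable (circle \<Otimes>\<^sub>M lborel)"
proof -
  have id: "(\<lambda>p. (fst p, snd p)) \<in> measurable (circle \<Otimes>\<^sub>M (lborel :: (complex ^ 'n) measure)) (borel \<Otimes>\<^sub>M borel)"
    by (intro measurable_Pair measurable_compose[OF measurable_fst measurable_circle_ident])
       (simp add: measurable_compose[OF measurable_snd])
  have 1: "(\<lambda>p. g (c + snd p + cis (fst p) *s b)) \<in> borel_measurable ((borel :: real measure) \<Otimes>\<^sub>M borel)"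
    unfolding borel_prod cis_vector_scalar
    by (intro measurable_compose[OF _ assms] borel_measurable_continuous_onI continuous_intros)
  have 2: "(\<lambda>p. g (c + cis (fst p) *s snd p)) \<in> borel_measurable ((borel :: real measure) \<Otimes>\<^sub>M borel)"
    unfolding borel_prod cis_vector_scalar
    by (intro measurable_compose[OF _ assms] borel_measurable_continuous_onI continuous_intros
        bounded_linear.continuous_on[OF bounded_linear_vector_scalar])
  show "(\<lambda>(\<theta>, x). g (c + x + cis \<theta> *s b)) \<in> borel_measurable (circle \<Otimes>\<^sub>M lborel)"
    "(\<lambda>(\<theta>, x). g (c + cis \<theta> *s x)) \<in> borel_measurable (circle \<Otimes>\<^sub>M lborel)"
    using measurable_compose[OF id 1] measurable_compose[OF id 2] by (simp_all add: case_prod_beta')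
qed

lemma pair_sigma_finite_circle: "pair_sigma_finite circle (lborel :: 'a::euclidean_space measure)"
proof -
  interpret finite_measure circle by (rule finite_measure_circle)
  show ?thesis by unfold_locales
qed

text \<open>A finite value at the centre keeps the circle mean away from
  \<open>-\<infinity>\<close>, and upper semicontinuity bounds \<open>f\<close> above on the compact
  circle. Together they make \<open>f\<close> integrable over the circle, so the inequality becomes
  one between real numbers.\<close>

lemma psh_average_real_mean:
  fixes U :: "(complex ^ 'n::finite) set"
  assumes U: "open U" and usc: "upper_semicontinuous_on U f" "\<forall>x\<in>U. f x < \<infinity>"
    and disc: "{a + \<zeta> *s b |\<zeta>. norm \<zeta> \<le> 1} \<subseteq> U"
    and mean: "ereal c + f a \<le> circle_mean f a b" and fa: "f a \<noteq> -\<infinity>"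
  shows "(\<lambda>\<theta>. f (a + cis \<theta> *s b)) \<in> borel_measurable circle"
    and "(\<integral>\<^sup>+\<theta>. e2ennreal \<bar>f (a + cis \<theta> *s b)\<bar> \<partial>circle) < \<infinity>"
    and "2 * pi * (c + real_of_ereal (f a)) \<le> (LINT \<theta>|circle. real_of_ereal (f (a + cis \<theta> *s b)))"
proof -
  let ?h = "\<lambda>\<theta>. f (a + cis \<theta> *s b)"
  have inU: "a + cis \<theta> *s b \<in> U" for \<theta>
  proof -
    have "a + cis \<theta> *s b \<in> {a + \<zeta> *s b |\<zeta>. norm \<zeta> \<le> 1}" by (rule CollectI, rule exI[of _ "cis \<theta>"]) simp
    then show ?thesis using disc by blast
  qed
  have "a \<in> {a + \<zeta> *s b |\<zeta>. norm \<zeta> \<le> 1}" by (rule CollectI, rule exI[of _ 0]) simp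
  then have aU: "a \<in> U" using disc by blast
  show h: "?h \<in> borel_measurable circle"
    using measurable_circle_compose[OF upper_semicontinuous_measurable(1)[OF U usc(1)], of a b] inU by simp
  have "compact ((\<lambda>\<theta>. a + cis \<theta> *s b) ` {0..2 * pi})"
    by (intro compact_continuous_image continuous_rotate) simp
  then obtain A where A: "\<And>\<theta>. \<theta> \<in> {0..2 * pi} \<Longrightarrow> f (a + cis \<theta> *s b) \<le> ereal A"
    using upper_semicontinuous_bounded_above[OF U usc(1), of "(\<lambda>\<theta>. a + cis \<theta> *s b) ` {0..2 * pi}"] usc(2) inU by blast
  obtain r where r: "f a = ereal r" using fa bspec[OF usc(2) aU] by (cases "f a") auto
  have "ereal_integral circle ?h \<noteq> -\<infinity>"
  proof
    assume "ereal_integral circle ?h = -\<infinity>"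
    then have "circle_mean f a b = -\<infinity>" by (simp add: circle_mean_def)
    with mean r show False by simp
  qed
  then show fin: "(\<integral>\<^sup>+\<theta>. e2ennreal \<bar>?h \<theta>\<bar> \<partial>circle) < \<infinity>"
  proof (rule ereal_integral_bounded_above[OF h, rotated 2])
    show "emeasure circle (space circle) < \<infinity>" unfolding emeasure_circle by simp
    show "f (a + cis \<theta> *s b) \<le> ereal A" if "\<theta> \<in> space circle" for \<theta>
      using A that by (simp add: space_restrict_space)
  qed
  have "ereal (c + r) \<le> ereal (1 / (2 * pi) * (LINT \<theta>|circle. real_of_ereal (?h \<theta>)))"
    using mean ereal_integral_finite(3)[OF h fin] by (simp add: circle_mean_def r)
  then have "c + r \<le> 1 / (2 * pi) * (LINT \<theta>|circle. real_of_ereal (?h \<theta>))"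
    by (simp only: ereal_less_eq)
  then have "2 * pi * (c + r) \<le> 2 * pi * (1 / (2 * pi) * (LINT \<theta>|circle. real_of_ereal (?h \<theta>)))"
    by (rule mult_left_mono) simp
  then show "2 * pi * (c + real_of_ereal (f a)) \<le> (LINT \<theta>|circle. real_of_ereal (?h \<theta>))"
    by (simp add: r)
qed

lemma psh_average_ball_integrable:
  fixes U :: "(complex ^ 'n::finite) set"
  assumes U: "open U" and usc: "upper_semicontinuous_on U f" "\<forall>x\<in>U. f x < \<infinity>"
    and r: "cball a r \<subseteq> U" and fa: "f a \<noteq> -\<infinity>"
    and mean: "\<And>b. norm b < r \<Longrightarrow> f a \<le> circle_mean f a b"
  shows "set_nn_integral lborel (ball a r) (\<lambda>x. e2ennreal \<bar>f x\<bar>) < \<infinity>"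
proof (cases "r > 0")
  case False
  then show ?thesis by (simp add: ball_empty)
next
  case True
  define f' where "f' = (\<lambda>x. if x \<in> U then f x else -\<infinity>)"
  have f' [measurable]: "f' \<in> borel_measurable borel"
    unfolding f'_def by (rule upper_semicontinuous_measurable(1)[OF U usc(1)])
  have aU: "a \<in> U" using r True by (meson centre_in_cball less_imp_le subsetD)
  obtain A where A: "\<And>x. x \<in> cball a r \<Longrightarrow> f x \<le> ereal A"
    using upper_semicontinuous_bounded_above[OF U usc(1) bspec[OF usc(2)] compact_cball r] by blast
  \<comment> \<open>Nonnegative on the ball, with value \<open>\<infinity>\<close> where
    \<open>f\<close> is \<open>-\<infinity>\<close>: Tonelli applies before any integrability is
    known.\<close>
  define F where "F = (\<lambda>x. e2ennreal (ereal A - f' x) * indicator (ball a r) x)"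
  have [measurable]: "ball a r \<in> sets borel" by simp
  have F [measurable]: "F \<in> borel_measurable borel" unfolding F_def by measurable
  interpret pair_sigma_finite circle "lborel :: (complex ^ 'n) measure" by (rule pair_sigma_finite_circle)
  define c where "c = real_of_ereal (f a)"
  have inner: "(\<integral>\<^sup>+\<theta>. F (a + cis \<theta> *s b) \<partial>circle) \<le> ennreal (2 * pi * (A - c)) * indicator (ball 0 r) b" for b
  proof (cases "norm b < r")
    case False
    then have "F (a + cis \<theta> *s b) = 0" for \<theta> by (simp add: F_def dist_norm norm_vector_scalar)
    then show ?thesis by simp
  next
    case b: True
    have ball: "a + \<zeta> *s b \<in> ball a r" if "norm \<zeta> \<le> 1" for \<zeta>
    proof -
      have "norm \<zeta> * norm b \<le> 1 * norm b" using that by (intro mult_right_mono) auto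
      then show ?thesis using b by (simp add: dist_norm norm_vector_scalar)
    qed
    have disc: "{a + \<zeta> *s b |\<zeta>. norm \<zeta> \<le> 1} \<subseteq> U" using ball r ball_subset_cball[of a r] by blast
    have "ereal 0 + f a \<le> circle_mean f a b" using mean[OF b] by simp
    note M = psh_average_real_mean[OF U usc disc this fa]
    note E = ereal_integral_finite[OF M(1,2)]
    have le: "f (a + cis \<theta> *s b) \<le> ereal A" for \<theta>
      using ball[of "cis \<theta>"] by (intro A) auto
    have "(\<integral>\<^sup>+\<theta>. F (a + cis \<theta> *s b) \<partial>circle) = (\<integral>\<^sup>+\<theta>. ennreal (A - real_of_ereal (f (a + cis \<theta> *s b))) \<partial>circle)"
    proof (rule nn_integral_cong_AE)
      from E(1) show "AE \<theta> in circle. F (a + cis \<theta> *s b) = ennreal (A - real_of_ereal (f (a + cis \<theta> *s b)))"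
      proof eventually_elim
        case (elim \<theta>)
        have "a + cis \<theta> *s b \<in> ball a r" using ball[of "cis \<theta>"] by simp
        moreover have "a + cis \<theta> *s b \<in> U" using calculation r by auto
        ultimately have "F (a + cis \<theta> *s b) = e2ennreal (ereal A - f (a + cis \<theta> *s b))" by (simp add: F_def f'_def)
        also have "\<dots> = e2ennreal (ereal A - ereal (real_of_ereal (f (a + cis \<theta> *s b))))" using elim by simp
        finally show ?case by simp
      qed
    qed
    also have "\<dots> = ennreal (LINT \<theta>|circle. A - real_of_ereal (f (a + cis \<theta> *s b)))"
    proof (rule nn_integral_eq_integral)
      interpret finite_measure circle by (rule finite_measure_circle)
      show "integrable circle (\<lambda>\<theta>. A - real_of_ereal (f (a + cis \<theta> *s b)))" using E(2) by simp
      from E(1) show "AE \<theta> in circle. 0 \<le> A - real_of_ereal (f (a + cis \<theta> *s b))"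
        by eventually_elim (use le in \<open>metis diff_ge_0_iff_ge ereal_less_eq(3)\<close>)
    qed
    also have "(LINT \<theta>|circle. A - real_of_ereal (f (a + cis \<theta> *s b))) =
        2 * pi * A - (LINT \<theta>|circle. real_of_ereal (f (a + cis \<theta> *s b)))"
    proof -
      interpret finite_measure circle by (rule finite_measure_circle)
      have "measure circle (space circle) = 2 * pi" using emeasure_circle by (simp add: measure_def)
      then show ?thesis using E(2) by simp
    qed
    also have "\<dots> \<le> 2 * pi * (A - c)"
      using M(3) by (simp add: c_def algebra_simps)
    finally show ?thesis using b by (simp add: ennreal_leI)
  qed
  \<comment> \<open>Each rotation about \<open>a\<close> preserves the integral of \<open>F\<close>.
    Averaging over all rotations replaces \<open>F\<close> by its circle integrals, which the mean
    value inequality bounds by \<open>2 * pi * (A - c)\<close>.\<close>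
  have "ennreal (2 * pi) * (\<integral>\<^sup>+x. F x \<partial>lborel) = (\<integral>\<^sup>+\<theta>. \<integral>\<^sup>+b. F (a + cis \<theta> *s b) \<partial>lborel \<partial>circle)"
    unfolding nn_integral_rotate[OF F] nn_integral_const emeasure_circle by (rule mult.commute)
  also have "\<dots> = (\<integral>\<^sup>+b. \<integral>\<^sup>+\<theta>. F (a + cis \<theta> *s b) \<partial>circle \<partial>lborel)"
    by (rule Fubini'[symmetric]) (rule measurable_circle_product(2)[OF F])
  also have "\<dots> \<le> (\<integral>\<^sup>+b. ennreal (2 * pi * (A - c)) * indicator (ball (0 :: complex ^ 'n) r) b \<partial>lborel)"
    by (rule nn_integral_mono) (rule inner)
  also have "\<dots> = ennreal (2 * pi * (A - c)) * emeasure lborel (ball (0 :: complex ^ 'n) r)"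
    by (rule nn_integral_cmult_indicator) simp
  also have "\<dots> < \<infinity>"
  proof -
    have "emeasure lborel (ball (0 :: complex ^ 'n) r) \<le> emeasure lborel (cball (0 :: complex ^ 'n) r)"
      by (intro emeasure_mono) auto
    also have "\<dots> < \<infinity>" by (rule emeasure_compact_finite) simp
    finally show ?thesis by (simp add: ennreal_mult_less_top)
  qed
  finally have "ennreal (2 * pi) * (\<integral>\<^sup>+x. F x \<partial>lborel) < \<infinity>" .
  then have F_fin: "(\<integral>\<^sup>+x. F x \<partial>lborel) < \<infinity>"
    using pi_gt_zero by (auto simp: ennreal_mult_less_top)
  have "set_nn_integral lborel (ball a r) (\<lambda>x. e2ennreal \<bar>f x\<bar>) \<le> (\<integral>\<^sup>+x. ennreal \<bar>A\<bar> * indicator (ball a r) x + F x \<partial>lborel)"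
  proof (rule nn_integral_mono)
    fix x
    show "e2ennreal \<bar>f x\<bar> * indicator (ball a r) x \<le> ennreal \<bar>A\<bar> * indicator (ball a r) x + F x"
    proof (cases "x \<in> ball a r")
      case True
      then have x: "x \<in> U" "f x \<le> ereal A" using r A[of x] by auto
      have "e2ennreal \<bar>f x\<bar> \<le> ennreal \<bar>A\<bar> + e2ennreal (ereal A - f x)"
      proof (cases "f x")
        case (real s)
        have "s \<le> A" using x(2) real by simp
        then have "\<bar>s\<bar> \<le> \<bar>A\<bar> + (A - s)" by linarith
        then have "ennreal \<bar>s\<bar> \<le> ennreal (\<bar>A\<bar> + (A - s))" by (rule ennreal_leI)
        also have "\<dots> = ennreal \<bar>A\<bar> + ennreal (A - s)" using \<open>s \<le> A\<close> by (intro ennreal_plus) auto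
        finally show ?thesis by (simp add: real)
      qed (use x in auto)
      then show ?thesis using True x(1) by (simp add: F_def f'_def)
    qed simp
  qed
  also have "\<dots> = ennreal \<bar>A\<bar> * emeasure lborel (ball a r) + (\<integral>\<^sup>+x. F x \<partial>lborel)"
    by (subst nn_integral_add) (auto simp: nn_integral_cmult_indicator)
  also have "\<dots> < \<infinity>"
  proof -
    have "emeasure lborel (ball a r) \<le> emeasure lborel (cball a r)"
      by (intro emeasure_mono) auto
    also have "\<dots> < \<infinity>" by (rule emeasure_compact_finite) simp
    finally show ?thesis using F_fin by (simp add: ennreal_mult_less_top)
  qed
  finally show ?thesis .
qed

lemma psh_average_loc_integrable:
  fixes U :: "(complex ^ 'n::finite) set"
  assumes U: "open U" "connected U" and f: "strictly_psh_on_average U f" and x0: "x0 \<in> U" "f x0 \<noteq> -\<infinity>"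
  shows "loc_integrable_on U f"
proof -
  obtain \<phi> \<delta> :: "complex ^ 'n \<Rightarrow> real" where usc: "upper_semicontinuous_on U f" "\<forall>x\<in>U. f x < \<infinity>"
    and \<phi>: "continuous_on U \<phi>" "\<forall>x\<in>U. 0 < \<phi> x"
    and \<delta>: "lower_semicontinuous_on U \<delta>" "\<forall>x\<in>U. 0 < \<delta> x"
    and mean: "\<forall>a\<in>U. \<forall>b. norm b < \<delta> a \<longrightarrow> {a + \<zeta> *s b |\<zeta>. norm \<zeta> \<le> 1} \<subseteq> U \<and>
       ereal (\<phi> a * (norm b)\<^sup>2) + f a \<le> circle_mean f a b"
    using f unfolding strictly_psh_on_average_def by (elim exE conjE)
  define I where "I = (\<lambda>S. set_nn_integral lborel S (\<lambda>x. e2ennreal \<bar>f x\<bar>))"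
  have I_mono: "I S \<le> I S'" if "S \<subseteq> S'" for S S'
    unfolding I_def by (rule nn_integral_mono) (use that in \<open>auto simp: indicator_def\<close>)
  have dichotomy: "\<exists>\<rho>>0. ball x \<rho> \<subseteq> U \<and> ((\<exists>a\<in>ball x \<rho>. f a \<noteq> -\<infinity>) \<longrightarrow> I (ball x \<rho>) < \<infinity>)" if x: "x \<in> U" for x
  proof -
    obtain R where R: "R > 0" "cball x R \<subseteq> U" using U(1)[unfolded open_contains_cball] x by blast
    obtain r where r: "r > 0" "\<forall>y\<in>cball x R. r < \<delta> y"
      using lower_semicontinuous_bounded_below[OF U(1) \<delta>(1) _ compact_cball R(2)] \<delta>(2) by blast
    \<comment> \<open>Any \<open>a\<close> in the small ball can serve as centre: the ball of radius
      \<open>2 * \<rho>\<close> around it covers the ball of radius \<open>\<rho>\<close> around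
      \<open>x\<close>, stays within \<open>R\<close> of \<open>x\<close>, and its radius is below
      the value of \<open>\<delta>\<close> at \<open>a\<close>.\<close>
    define \<rho> where "\<rho> = min R r / 4"
    have \<rho>: "\<rho> > 0" "4 * \<rho> \<le> R" "4 * \<rho> \<le> r" using R(1) r(1) by (auto simp: \<rho>_def)
    have "I (ball x \<rho>) < \<infinity>" if a: "a \<in> ball x \<rho>" "f a \<noteq> -\<infinity>" for a
    proof -
      have aR: "cball a (2 * \<rho>) \<subseteq> cball x R"
      proof
        fix y assume "y \<in> cball a (2 * \<rho>)"
        then show "y \<in> cball x R" using a(1) \<rho> dist_triangle[of x y a] by simp
      qed
      have aR': "a \<in> cball x R" using a(1) \<rho> by simp
      have "I (ball a (2 * \<rho>)) < \<infinity>"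
        unfolding I_def
      proof (rule psh_average_ball_integrable[OF U(1) usc _ a(2)])
        show "cball a (2 * \<rho>) \<subseteq> U" using aR R(2) by blast
        fix b :: "complex ^ 'n" assume "norm b < 2 * \<rho>"
        then have "norm b < \<delta> a" using r(2) aR' \<rho>(1,3) by fastforce
        then have "ereal (\<phi> a * (norm b)\<^sup>2) + f a \<le> circle_mean f a b" using mean aR' R(2) by blast
        moreover have "f a \<le> ereal (\<phi> a * (norm b)\<^sup>2) + f a"
          using \<phi>(2) aR' R(2) by (intro ereal_le_add_self2) (auto simp: less_imp_le)
        ultimately show "f a \<le> circle_mean f a b" by (rule order.trans[rotated])
      qed
      moreover have "ball x \<rho> \<subseteq> ball a (2 * \<rho>)"
      proof
        fix y assume "y \<in> ball x \<rho>"
        then show "y \<in> ball a (2 * \<rho>)" using a(1) dist_triangle[of a y x] by (simp add: dist_commute)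
      qed
      ultimately show ?thesis using I_mono order.strict_trans1 by blast
    qed
    moreover have "ball x \<rho> \<subseteq> cball x R" using \<rho> by (auto simp: dist_commute)
    with R(2) have "ball x \<rho> \<subseteq> U" by blast
    ultimately show ?thesis using \<rho>(1) by blast
  qed
  \<comment> \<open>Points with an integrable neighbourhood, as opposed to points near which
    \<open>f\<close> is identically \<open>-\<infinity>\<close>. Both sets are open, and by the
    dichotomy they cover \<open>U\<close>.\<close>
  define G where "G = {x \<in> U. \<exists>\<rho>>0. ball x \<rho> \<subseteq> U \<and> I (ball x \<rho>) < \<infinity>}"
  define B where "B = {x \<in> U. \<exists>\<rho>>0. ball x \<rho> \<subseteq> U \<and> (\<forall>a\<in>ball x \<rho>. f a = -\<infinity>)}"
  have sub: "ball y (\<rho> - dist x y) \<subseteq> ball x \<rho>" for x y :: "complex ^ 'n" and \<rho>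
  proof
    fix z assume "z \<in> ball y (\<rho> - dist x y)"
    then show "z \<in> ball x \<rho>" using dist_triangle[of x z y] by simp
  qed
  have openG: "open G"
    unfolding open_contains_ball
  proof
    fix x assume "x \<in> G"
    then obtain \<rho> where \<rho>: "\<rho> > 0" "ball x \<rho> \<subseteq> U" "I (ball x \<rho>) < \<infinity>" unfolding G_def by blast
    have "y \<in> G" if y: "y \<in> ball x \<rho>" for y
      unfolding G_def using y \<rho> sub[of y \<rho> x] I_mono[OF sub[of y \<rho> x]]
      by (intro CollectI conjI exI[of _ "\<rho> - dist x y"]) (auto intro: order.strict_trans1)
    then show "\<exists>e>0. ball x e \<subseteq> G" using \<rho>(1) by blast
  qed
  have openB: "open B"
    unfolding open_contains_ball
  proof
    fix x assume "x \<in> B"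
    then obtain \<rho> where \<rho>: "\<rho> > 0" "ball x \<rho> \<subseteq> U" "\<forall>a\<in>ball x \<rho>. f a = -\<infinity>" unfolding B_def by blast
    have "y \<in> B" if y: "y \<in> ball x \<rho>" for y
      unfolding B_def
    proof (intro CollectI conjI exI[of _ "\<rho> - dist x y"] ballI)
      show "f z = -\<infinity>" if "z \<in> ball y (\<rho> - dist x y)" for z using \<rho>(3) sub[of y \<rho> x] that by blast
    qed (use y \<rho>(2) sub[of y \<rho> x] in auto)
    then show "\<exists>e>0. ball x e \<subseteq> B" using \<rho>(1) by blast
  qed
  \<comment> \<open>On a common ball the absolute value of \<open>f\<close> would be
    \<open>\<infinity>\<close> throughout and yet have a finite integral, although balls have
    positive measure.\<close>
  have disjoint: "G \<inter> B = {}"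
  proof (rule ccontr)
    assume "G \<inter> B \<noteq> {}"
    then obtain x \<rho> \<sigma> where x: "\<rho> > 0" "I (ball x \<rho>) < \<infinity>" "\<sigma> > 0" "\<forall>a\<in>ball x \<sigma>. f a = -\<infinity>"
      unfolding G_def B_def by blast
    define \<tau> where "\<tau> = min \<rho> \<sigma>"
    have \<tau>: "\<tau> > 0" "ball x \<tau> \<subseteq> ball x \<rho>" "ball x \<tau> \<subseteq> ball x \<sigma>" using x by (auto simp: \<tau>_def)
    have "I (ball x \<tau>) = (\<integral>\<^sup>+y. top * indicator (ball x \<tau>) y \<partial>lborel)"
      unfolding I_def by (rule nn_integral_cong) (use x(4) \<tau>(3) in \<open>auto simp: indicator_def\<close>)
    also have "\<dots> = top * emeasure lborel (ball x \<tau>)" by (rule nn_integral_cmult_indicator) simp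
    finally have "top * emeasure lborel (ball x \<tau>) < \<infinity>"
      using I_mono[OF \<tau>(2)] x(2) by (simp add: order.strict_trans1)
    then have "emeasure lborel (ball x \<tau>) = 0" by (auto simp: ennreal_top_mult split: if_splits)
    then have "ball x \<tau> \<in> null_sets lborel" by auto
    then have "negligible (ball x \<tau>)"
      by (simp add: negligible_iff_null_sets null_sets_completionI)
    then show False using open_not_negligible[of "ball x \<tau>"] \<tau>(1) by simp
  qed
  have cover: "U \<subseteq> G \<union> B"
  proof
    fix x assume x: "x \<in> U"
    then obtain \<rho> where "\<rho> > 0" "ball x \<rho> \<subseteq> U" "(\<exists>a\<in>ball x \<rho>. f a \<noteq> -\<infinity>) \<longrightarrow> I (ball x \<rho>) < \<infinity>"
      using dichotomy by blast
    then show "x \<in> G \<union> B" unfolding G_def B_def using x by blast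
  qed
  have x0B: "x0 \<notin> B"
    unfolding B_def using x0(2) by auto
  have "B \<inter> U = {}"
    using connectedD[OF U(2) openG openB] disjoint cover x0B x0(1) by blast
  then have UG: "U \<subseteq> G" using cover by blast
  show ?thesis
    unfolding loc_integrable_on_def
  proof (intro conjI allI impI)
    show "f \<in> borel_measurable (lebesgue_on U)" by (rule upper_semicontinuous_measurable(2)[OF U(1) usc(1)])
    fix K assume K: "compact K \<and> K \<subseteq> U"
    define \<rho> where "\<rho> = (\<lambda>x. SOME \<rho>. \<rho> > 0 \<and> ball x \<rho> \<subseteq> U \<and> I (ball x \<rho>) < \<infinity>)"
    have \<rho>: "\<rho> x > 0" "ball x (\<rho> x) \<subseteq> U" "I (ball x (\<rho> x)) < \<infinity>" if "x \<in> K" for x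
    proof -
      have "\<exists>\<rho>>0. ball x \<rho> \<subseteq> U \<and> I (ball x \<rho>) < \<infinity>" using that K UG unfolding G_def by blast
      from someI_ex[OF this] show "\<rho> x > 0" "ball x (\<rho> x) \<subseteq> U" "I (ball x (\<rho> x)) < \<infinity>" unfolding \<rho>_def by auto
    qed
    obtain X where X: "finite X" "X \<subseteq> K" "K \<subseteq> (\<Union>x\<in>X. ball x (\<rho> x))"
    proof (rule compactE_image[of K K "\<lambda>x. ball x (\<rho> x)"])
      show "K \<subseteq> (\<Union>x\<in>K. ball x (\<rho> x))" using \<rho>(1) by force
    qed (use K in auto)
    have [measurable]: "ball y (\<rho> y) \<in> sets borel" for y by simp
    have f'm [measurable]: "(\<lambda>x. e2ennreal \<bar>if x \<in> U then f x else -\<infinity>\<bar>) \<in> borel_measurable borel"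
      using upper_semicontinuous_measurable(1)[OF U(1) usc(1)] by measurable
    have "set_nn_integral lebesgue K (\<lambda>x. e2ennreal \<bar>f x\<bar>) = I K"
      unfolding I_def by (rule nn_integral_completion)
    also have "I K \<le> (\<integral>\<^sup>+x. (\<Sum>y\<in>X. e2ennreal \<bar>if x \<in> U then f x else -\<infinity>\<bar> * indicator (ball y (\<rho> y)) x) \<partial>lborel)"
      unfolding I_def
    proof (rule nn_integral_mono)
      fix x
      show "e2ennreal \<bar>f x\<bar> * indicator K x \<le> (\<Sum>y\<in>X. e2ennreal \<bar>if x \<in> U then f x else -\<infinity>\<bar> * indicator (ball y (\<rho> y)) x)"
      proof (cases "x \<in> K")
        case True
        then obtain y where y: "y \<in> X" "x \<in> ball y (\<rho> y)" using X(3) by blast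
        have "e2ennreal \<bar>f x\<bar> * indicator K x = e2ennreal \<bar>if x \<in> U then f x else -\<infinity>\<bar> * indicator (ball y (\<rho> y)) x"
          using True y K by auto
        also have "\<dots> \<le> (\<Sum>y\<in>X. e2ennreal \<bar>if x \<in> U then f x else -\<infinity>\<bar> * indicator (ball y (\<rho> y)) x)"
          using y(1) X(1) by (intro member_le_sum) auto
        finally show ?thesis .
      qed simp
    qed
    also have "\<dots> = (\<Sum>y\<in>X. \<integral>\<^sup>+x. e2ennreal \<bar>if x \<in> U then f x else -\<infinity>\<bar> * indicator (ball y (\<rho> y)) x \<partial>lborel)"
      by (rule nn_integral_sum) measurable
    also have "\<dots> = (\<Sum>y\<in>X. I (ball y (\<rho> y)))"
      unfolding I_def using X(2) \<rho>(2) by (intro sum.cong refl nn_integral_cong) (force simp: indicator_def)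
    also have "\<dots> < \<infinity>" using X(1,2) \<rho>(3) by (auto simp: less_top[symmetric] subset_eq)
    finally show "set_nn_integral lebesgue K (\<lambda>x. e2ennreal \<bar>f x\<bar>) < \<infinity>" .
  qed
qed

subsection \<open>From functions to distributions\<close>

text \<open>The linear terms and the product of sine and cosine average to zero over a period, and
  both squares integrate to \<open>pi\<close>. An explicit antiderivative gives this in one
  evaluation.\<close>

lemma trigonometric_integral:
  fixes c0 c1 c2 a b d t :: real
  shows "((\<lambda>\<theta>. c0 - t * (cos \<theta> * c1 + sin \<theta> * c2) +
      t\<^sup>2 / 2 * ((cos \<theta>)\<^sup>2 * a + cos \<theta> * sin \<theta> * b + (sin \<theta>)\<^sup>2 * d))
    has_integral (2 * pi * c0 + t\<^sup>2 * (pi / 2) * (a + d))) {0..2 * pi}"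
proof -
  define P where "P = (\<lambda>\<theta>::real. c0 * \<theta> - t * (sin \<theta> * c1 - cos \<theta> * c2) + t\<^sup>2 / 2 *
    ((\<theta> + sin \<theta> * cos \<theta>) / 2 * a + (sin \<theta>)\<^sup>2 / 2 * b + (\<theta> - sin \<theta> * cos \<theta>) / 2 * d))"
  have "(P has_real_derivative c0 - t * (cos \<theta> * c1 + sin \<theta> * c2) +
      t\<^sup>2 / 2 * ((cos \<theta>)\<^sup>2 * a + cos \<theta> * sin \<theta> * b + (sin \<theta>)\<^sup>2 * d)) (at \<theta>)" for \<theta>
  proof -
    have s: "(sin \<theta>)\<^sup>2 = 1 - (cos \<theta>)\<^sup>2" by (simp add: sin_squared_eq)
    have "(P has_real_derivative c0 - t * (cos \<theta> * c1 + sin \<theta> * c2) + t\<^sup>2 / 2 *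
      ((1 + (cos \<theta> * cos \<theta> - sin \<theta> * sin \<theta>)) / 2 * a + (2 * sin \<theta> * cos \<theta>) / 2 * b +
       (1 - (cos \<theta> * cos \<theta> - sin \<theta> * sin \<theta>)) / 2 * d)) (at \<theta>)"
      unfolding P_def by (auto intro!: derivative_eq_intros simp: field_simps)
    also have "(1 + (cos \<theta> * cos \<theta> - sin \<theta> * sin \<theta>)) / 2 = (cos \<theta>)\<^sup>2"
      using s by (simp add: power2_eq_square)
    also have "(1 - (cos \<theta> * cos \<theta> - sin \<theta> * sin \<theta>)) / 2 = (sin \<theta>)\<^sup>2"
      using s by (simp add: power2_eq_square)
    finally show ?thesis by (simp add: mult.commute[of "sin \<theta>"])
  qed
  then have "((\<lambda>\<theta>. c0 - t * (cos \<theta> * c1 + sin \<theta> * c2) +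
      t\<^sup>2 / 2 * ((cos \<theta>)\<^sup>2 * a + cos \<theta> * sin \<theta> * b + (sin \<theta>)\<^sup>2 * d))
    has_integral (P (2 * pi) - P 0)) {0..2 * pi}"
    by (intro fundamental_theorem_of_calculus)
       (auto simp: has_real_derivative_iff_has_vector_derivative[symmetric] intro: has_field_derivative_at_within)
  moreover have "P (2 * pi) - P 0 = 2 * pi * c0 + t\<^sup>2 * (pi / 2) * (a + d)"
    by (simp add: P_def algebra_simps)
  ultimately show ?thesis by simp
qed

lemma second_order_Taylor:
  assumes f: "smooth f"
  shows "\<exists>\<xi>. \<bar>\<xi>\<bar> \<le> \<bar>t\<bar> \<and> f (x + t *\<^sub>R v) =
    f x + t * dir_deriv v f x + t\<^sup>2 / 2 * dir_deriv v (dir_deriv v f) (x + \<xi> *\<^sub>R v)"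
proof -
  define diff where "diff = (\<lambda>m::nat. if m = 0 then (\<lambda>s. f (x + s *\<^sub>R v)) else if m = 1 then (\<lambda>s. dir_deriv v f (x + s *\<^sub>R v))
    else (\<lambda>s. dir_deriv v (dir_deriv v f) (x + s *\<^sub>R v)))"
  have "\<forall>m s. m < 2 \<and> \<bar>s\<bar> \<le> \<bar>t\<bar> \<longrightarrow> (diff m has_real_derivative diff (Suc m) s) (at s)"
  proof (intro allI impI)
    fix m :: nat and s assume "m < 2 \<and> \<bar>s\<bar> \<le> \<bar>t\<bar>"
    then have "m = 0 \<or> m = 1" by auto
    then show "(diff m has_real_derivative diff (Suc m) s) (at s)"
      using has_derivative_along_line[OF smooth_differentiable[OF f], where x=x and s=s and v=v]
        has_derivative_along_line[OF smooth_differentiable[OF smooth_dir_deriv[OF f]], where x=x and s=s and v=v]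
      by (auto simp: diff_def)
  qed
  moreover have "diff 0 = (\<lambda>s. f (x + s *\<^sub>R v))" by (simp add: diff_def)
  ultimately obtain \<xi> where "\<bar>\<xi>\<bar> \<le> \<bar>t\<bar>"
      "f (x + t *\<^sub>R v) = (\<Sum>m<2. diff m 0 / fact m * t ^ m) + diff 2 \<xi> / fact 2 * t ^ 2"
    using Maclaurin_bi_le[of diff "\<lambda>s. f (x + s *\<^sub>R v)" 2 t] by blast
  then show ?thesis by (intro exI[of _ \<xi>]) (simp add: diff_def numeral_2_eq_2 mult.commute)
qed

text \<open>The second derivatives of a test function are uniformly continuous, so the error in the
  second-order Taylor formula is \<open>t ^ 2\<close> times a quantity small uniformly in
  \<open>x\<close> and in the angle.\<close>

lemma circle_mean_expansion:
  fixes \<phi> :: "'a::euclidean_space \<Rightarrow> real"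
  assumes \<phi>: "\<phi> \<in> test_functions U" and e: "0 < e"
  shows "\<exists>t0>0. \<forall>t x. 0 < t \<and> t < t0 \<longrightarrow>
    \<bar>(LINT \<theta>|circle. \<phi> (x - t *\<^sub>R (cos \<theta> *\<^sub>R w + sin \<theta> *\<^sub>R w'))) -
      (2 * pi * \<phi> x + t\<^sup>2 * (pi / 2) * (dir_deriv w (dir_deriv w \<phi>) x + dir_deriv w' (dir_deriv w' \<phi>) x))\<bar> \<le> t\<^sup>2 * e"
proof -
  note sm = test_functionsD(1)[OF \<phi>]
  note sm1 = smooth_dir_deriv[OF sm]
  note sm2 = smooth_dir_deriv[OF sm1]
  define D where "D = (\<lambda>u v. dir_deriv u (dir_deriv v \<phi>))"
  \<comment> \<open>Four second derivatives vary by at most \<open>\<eta>\<close> each. With the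
    Taylor factor \<open>1 / 2\<close> and the length \<open>2 * pi\<close> of the interval this
    gives \<open>4 * pi * \<eta> = e\<close>.\<close>
  define \<eta> where "\<eta> = e / (4 * pi)"
  have \<eta>: "\<eta> > 0" using e by (simp add: \<eta>_def)
  have "\<exists>d>0. \<forall>x y. dist x y < d \<longrightarrow> \<bar>D u v x - D u v y\<bar> \<le> \<eta>" for u v
    unfolding D_def by (rule test_function_uniformly_continuous[OF test_functions_dir_deriv[OF test_functions_dir_deriv[OF \<phi>]] \<eta>])
  then obtain d where d: "\<And>u v. d u v > 0" "\<And>u v x y. dist x y < d u v \<Longrightarrow> \<bar>D u v x - D u v y\<bar> \<le> \<eta>"
    by metis
  define d0 where "d0 = Min {d w w, d w w', d w' w, d w' w'}"
  have d0: "d0 > 0" "d0 \<le> d w w" "d0 \<le> d w w'" "d0 \<le> d w' w" "d0 \<le> d w' w'"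
    using d(1) by (auto simp: d0_def)
  define N where "N = norm w + norm w' + 1"
  have N: "N > 0" by (simp add: N_def add_nonneg_pos)
  define t0 where "t0 = d0 / N"
  have t0: "t0 > 0" using d0 N by (simp add: t0_def)
  show ?thesis
  proof (intro exI[of _ t0] conjI t0 allI impI)
    fix t x assume t: "0 < t \<and> t < t0"
    \<comment> \<open>The sign reflects that the circle mean will have been shifted from the
      function to the test function.\<close>
    define v where "v = (\<lambda>\<theta>. - (cos \<theta> *\<^sub>R w + sin \<theta> *\<^sub>R w'))"
    define Q where "Q = (\<lambda>y \<theta>. (cos \<theta>)\<^sup>2 * D w w y + cos \<theta> * sin \<theta> * (D w w' y + D w' w y) + (sin \<theta>)\<^sup>2 * D w' w' y)"
    have norm_v: "norm (v \<theta>) \<le> N" for \<theta>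
    proof -
      have "norm (v \<theta>) \<le> \<bar>cos \<theta>\<bar> * norm w + \<bar>sin \<theta>\<bar> * norm w'"
        unfolding v_def norm_minus_cancel by (rule order.trans[OF norm_triangle_ineq]) simp
      also have "\<dots> \<le> 1 * norm w + 1 * norm w'" by (intro add_mono mult_right_mono) auto
      finally show ?thesis by (simp add: N_def)
    qed
    have dv1: "dir_deriv (v \<theta>) g y = - (cos \<theta> * dir_deriv w g y + sin \<theta> * dir_deriv w' g y)" if "smooth g" for g \<theta> y
    proof -
      have v: "v \<theta> = (- cos \<theta>) *\<^sub>R w + (- sin \<theta>) *\<^sub>R w'" by (simp add: v_def)
      show ?thesis unfolding v using smooth_differentiable[OF that]
        by (simp only: dir_deriv_add_direction dir_deriv_scale_direction)
    qed
    have dv2: "dir_deriv (v \<theta>) (dir_deriv (v \<theta>) \<phi>) y = Q y \<theta>" for \<theta> y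
    proof -
      have "dir_deriv (v \<theta>) \<phi> = (\<lambda>y. (- cos \<theta>) * dir_deriv w \<phi> y + (- sin \<theta>) * dir_deriv w' \<phi> y)"
        using dv1[OF sm] by auto
      moreover have "dir_deriv u (\<lambda>y. (- cos \<theta>) * dir_deriv w \<phi> y + (- sin \<theta>) * dir_deriv w' \<phi> y) y =
          (- cos \<theta>) * D u w y + (- sin \<theta>) * D u w' y" for u
        unfolding D_def
        by (simp only: dir_deriv_add[OF smooth_differentiable[OF smooth_cmult[OF sm1]] smooth_differentiable[OF smooth_cmult[OF sm1]]]
            dir_deriv_cmult[OF smooth_differentiable[OF sm1]])
      ultimately have "dir_deriv (v \<theta>) (dir_deriv (v \<theta>) \<phi>) y =
          - (cos \<theta> * ((- cos \<theta>) * D w w y + (- sin \<theta>) * D w w' y) + sin \<theta> * ((- cos \<theta>) * D w' w y + (- sin \<theta>) * D w' w' y))"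
        using dv1[OF sm1[of "v \<theta>"], of \<theta> y] by simp
      then show ?thesis by (simp add: Q_def power2_eq_square algebra_simps)
    qed
    have Q_close: "\<bar>Q y \<theta> - Q x \<theta>\<bar> \<le> 4 * \<eta>" if "dist y x < d0" for y \<theta>
    proof -
      have c: "\<bar>\<alpha> * (D u u' y - D u u' x)\<bar> \<le> \<eta>" if "\<bar>\<alpha>\<bar> \<le> 1" "d0 \<le> d u u'" for \<alpha> u u'
      proof -
        have "\<bar>D u u' y - D u u' x\<bar> \<le> \<eta>" using d(2)[of y x u u'] \<open>dist y x < d0\<close> that(2) by simp
        then have "\<bar>\<alpha>\<bar> * \<bar>D u u' y - D u u' x\<bar> \<le> 1 * \<eta>" using that(1) by (intro mult_mono) auto
        then show ?thesis by (simp add: abs_mult)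
      qed
      have b: "\<bar>(cos \<theta>)\<^sup>2\<bar> \<le> 1" "\<bar>(sin \<theta>)\<^sup>2\<bar> \<le> 1" "\<bar>cos \<theta> * sin \<theta>\<bar> \<le> 1"
        by (auto simp: abs_square_le_1 abs_mult intro!: mult_le_one)
      have "Q y \<theta> - Q x \<theta> = (cos \<theta>)\<^sup>2 * (D w w y - D w w x) + cos \<theta> * sin \<theta> * (D w w' y - D w w' x) +
          cos \<theta> * sin \<theta> * (D w' w y - D w' w x) + (sin \<theta>)\<^sup>2 * (D w' w' y - D w' w' x)"
        by (simp add: Q_def algebra_simps)
      then show ?thesis
        using c[OF b(1) d0(2)] c[OF b(3) d0(3)] c[OF b(3) d0(4)] c[OF b(2) d0(5)] by linarith
    qed
    define P where "P = (\<lambda>\<theta>. \<phi> x - t * (cos \<theta> * dir_deriv w \<phi> x + sin \<theta> * dir_deriv w' \<phi> x) + t\<^sup>2 / 2 *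
      ((cos \<theta>)\<^sup>2 * D w w x + cos \<theta> * sin \<theta> * (D w w' x + D w' w x) + (sin \<theta>)\<^sup>2 * D w' w' x))"
    have point: "\<bar>\<phi> (x + t *\<^sub>R v \<theta>) - P \<theta>\<bar> \<le> 2 * \<eta> * t\<^sup>2" for \<theta>
    proof -
      obtain \<xi> where \<xi>: "\<bar>\<xi>\<bar> \<le> \<bar>t\<bar>" "\<phi> (x + t *\<^sub>R v \<theta>) = \<phi> x + t * dir_deriv (v \<theta>) \<phi> x +
          t\<^sup>2 / 2 * dir_deriv (v \<theta>) (dir_deriv (v \<theta>) \<phi>) (x + \<xi> *\<^sub>R v \<theta>)"
        using second_order_Taylor[OF sm] by blast
      have "norm (\<xi> *\<^sub>R v \<theta>) \<le> t * N" using \<xi>(1) t norm_v[of \<theta>] by (simp add: mult_mono)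
      also have "\<dots> < t0 * N" using t N by simp
      also have "t0 * N = d0" using N by (simp add: t0_def)
      finally have "\<bar>Q (x + \<xi> *\<^sub>R v \<theta>) \<theta> - Q x \<theta>\<bar> \<le> 4 * \<eta>" by (intro Q_close) (simp add: dist_norm)
      then have "t\<^sup>2 / 2 * \<bar>Q (x + \<xi> *\<^sub>R v \<theta>) \<theta> - Q x \<theta>\<bar> \<le> t\<^sup>2 / 2 * (4 * \<eta>)" by (rule mult_left_mono) simp
      moreover have eq: "\<phi> (x + t *\<^sub>R v \<theta>) - P \<theta> = t\<^sup>2 / 2 * (Q (x + \<xi> *\<^sub>R v \<theta>) \<theta> - Q x \<theta>)"
        unfolding \<xi>(2) dv2 dv1[OF sm] P_def Q_def by (simp add: algebra_simps)
      moreover have "\<bar>\<phi> (x + t *\<^sub>R v \<theta>) - P \<theta>\<bar> = t\<^sup>2 / 2 * \<bar>Q (x + \<xi> *\<^sub>R v \<theta>) \<theta> - Q x \<theta>\<bar>"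
        unfolding eq abs_mult by simp
      ultimately show ?thesis by simp
    qed
    have P: "integrable circle P" "(LINT \<theta>|circle. P \<theta>) = 2 * pi * \<phi> x + t\<^sup>2 * (pi / 2) * (D w w x + D w' w' x)"
    proof -
      have c: "continuous_on {0..2 * pi} P" unfolding P_def by (intro continuous_intros)
      show "integrable circle P" by (rule continuous_lebesgue_on_interval(1)[OF c])
      have "integral {0..2 * pi} P = 2 * pi * \<phi> x + t\<^sup>2 * (pi / 2) * (D w w x + D w' w' x)"
        unfolding P_def by (rule integral_unique[OF trigonometric_integral])
      then show "(LINT \<theta>|circle. P \<theta>) = 2 * pi * \<phi> x + t\<^sup>2 * (pi / 2) * (D w w x + D w' w' x)"
        by (simp add: continuous_lebesgue_on_interval(2)[OF c])
    qed
    have int: "integrable circle (\<lambda>\<theta>. \<phi> (x + t *\<^sub>R v \<theta>))"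
      unfolding v_def
      by (intro continuous_lebesgue_on_interval(1) continuous_on_compose2[OF smooth_continuous_on[OF sm, of UNIV]] continuous_intros) auto
    interpret finite_measure circle by (rule finite_measure_circle)
    have "\<bar>(LINT \<theta>|circle. \<phi> (x + t *\<^sub>R v \<theta>)) - (LINT \<theta>|circle. P \<theta>)\<bar> = \<bar>LINT \<theta>|circle. \<phi> (x + t *\<^sub>R v \<theta>) - P \<theta>\<bar>"
      using int P(1) by simp
    also have "\<dots> \<le> (LINT \<theta>|circle. 2 * \<eta> * t\<^sup>2)"
      by (rule order.trans[OF integral_abs_bound], rule integral_mono) (use int P(1) point in auto)
    also have "\<dots> = measure circle (space circle) * (2 * \<eta> * t\<^sup>2)" by simp
    also have "measure circle (space circle) = 2 * pi" unfolding measure_def emeasure_circle by simp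
    also have "2 * pi * (2 * \<eta> * t\<^sup>2) = t\<^sup>2 * e" by (simp add: \<eta>_def)
    finally show "\<bar>(LINT \<theta>|circle. \<phi> (x - t *\<^sub>R (cos \<theta> *\<^sub>R w + sin \<theta> *\<^sub>R w'))) -
      (2 * pi * \<phi> x + t\<^sup>2 * (pi / 2) * (dir_deriv w (dir_deriv w \<phi>) x + dir_deriv w' (dir_deriv w' \<phi>) x))\<bar> \<le> t\<^sup>2 * e"
      unfolding P(2) v_def D_def scaleR_minus_right add_uminus_conv_diff .
  qed
qed

text \<open>The weight on average serves unchanged as the distributional weight. On a circle of
  radius proportional to \<open>t\<close> both the gain and the quadratic Taylor term carry
  \<open>t ^ 2\<close>, which is divided out before the error tends to zero.\<close>

lemma psh_average_strictly_psh_in_distribution: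
  fixes U :: "(complex ^ 'n::finite) set"
  assumes U: "open U" and f: "strictly_psh_on_average U f" and loc: "loc_integrable_on U f"
  shows "strictly_psh_in_distribution U f"
proof -
  obtain \<psi> \<delta> :: "complex ^ 'n \<Rightarrow> real" where usc: "upper_semicontinuous_on U f" "\<forall>x\<in>U. f x < \<infinity>"
    and \<psi>: "continuous_on U \<psi>" "\<forall>x\<in>U. 0 < \<psi> x"
    and \<delta>: "lower_semicontinuous_on U \<delta>" "\<forall>x\<in>U. 0 < \<delta> x"
    and mean: "\<forall>a\<in>U. \<forall>b. norm b < \<delta> a \<longrightarrow> {a + \<zeta> *s b |\<zeta>. norm \<zeta> \<le> 1} \<subseteq> U \<and>
       ereal (\<psi> a * (norm b)\<^sup>2) + f a \<le> circle_mean f a b"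
    using f unfolding strictly_psh_on_average_def by (elim exE conjE)
  define T where "T = induced_dist U f"
  have T: "T \<in> distributions U" unfolding T_def by (rule induced_dist_distribution[OF U loc])
  have "4 * (LINT x:U|lebesgue. \<psi> x * \<phi> x) * (norm w)\<^sup>2 \<le>
      T (dir_deriv w (dir_deriv w \<phi>)) + T (dir_deriv (\<i> *s w) (dir_deriv (\<i> *s w) \<phi>))"
    if \<phi>: "\<phi> \<in> test_functions U" and \<phi>0: "\<forall>x. 0 \<le> \<phi> x" for \<phi> w
  proof -
    define K where "K = supp \<phi>"
    have K: "compact K" "K \<subseteq> U" using test_functionsD[OF \<phi>] by (auto simp: K_def)
    have \<phi>K: "\<phi> x = 0" if "x \<notin> K" for x using that not_in_supp[of x \<phi>] by (simp add: K_def)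
    obtain r where r: "r > 0" "\<forall>x\<in>K. r < \<delta> x"
      using lower_semicontinuous_bounded_below[OF U \<delta>(1) bspec[OF \<delta>(2)] K] by blast
    \<comment> \<open>It contains every circle used, with centre in the support of
      \<open>\<phi>\<close> and radius below \<open>r\<close>. It lies in \<open>U\<close> because
      the mean value hypothesis includes that the corresponding discs do.\<close>
    define K1 where "K1 = {x + z |x z. x \<in> K \<and> z \<in> cball 0 r}"
    have K1: "compact K1" unfolding K1_def by (intro compact_sums K compact_cball)
    have K1I: "x + z \<in> K1" if "x \<in> K" "norm z \<le> r" for x z using that unfolding K1_def by auto
    have K1U: "K1 \<subseteq> U"
    proof
      fix y assume "y \<in> K1"
      then obtain x z where y: "y = x + z" "x \<in> K" "norm z \<le> r" by (auto simp: K1_def)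
      then have "norm z < \<delta> x" using r(2) by fastforce
      then have "{x + \<zeta> *s z |\<zeta>. norm \<zeta> \<le> 1} \<subseteq> U" using mean y(2) K(2) by blast
      moreover have "x + 1 *s z \<in> {x + \<zeta> *s z |\<zeta>. norm \<zeta> \<le> 1}" by (rule CollectI, rule exI[of _ 1]) simp
      ultimately show "y \<in> U" using y(1) by auto
    qed
    have KK1: "K \<subseteq> K1" using K1I[of _ 0] r(1) by auto
    have [measurable]: "K1 \<in> sets borel" "U \<in> sets borel" using K1 U by (auto intro: borel_compact)
    define f' where "f' = (\<lambda>x. if x \<in> U then f x else -\<infinity>)"
    have [measurable]: "f' \<in> borel_measurable borel"
      unfolding f'_def by (rule upper_semicontinuous_measurable(1)[OF U usc(1)])
    \<comment> \<open>A Borel measurable, integrable real function on the whole space that stands in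
      for \<open>f\<close> on the circles in question; points where \<open>f\<close> is infinite
      form a null set.\<close>
    define G where "G = (\<lambda>x. indicator K1 x * real_of_ereal (f' x))"
    have Gm [measurable]: "G \<in> borel_measurable borel" unfolding G_def by measurable
    have G_eq: "G x = real_of_ereal (f x)" if "x \<in> K1" for x
      using that K1U by (auto simp: G_def f'_def)
    have finK1: "set_nn_integral lborel K1 (\<lambda>x. e2ennreal \<bar>f' x\<bar>) < \<infinity>"
    proof -
      have "set_nn_integral lebesgue K1 (\<lambda>x. e2ennreal \<bar>f x\<bar>) < \<infinity>"
        using loc K1 K1U unfolding loc_integrable_on_def by blast
      moreover have "set_nn_integral lborel K1 (\<lambda>x. e2ennreal \<bar>f' x\<bar>) = set_nn_integral lborel K1 (\<lambda>x. e2ennreal \<bar>f x\<bar>)"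
        by (rule nn_integral_cong) (use K1U in \<open>auto simp: f'_def indicator_def\<close>)
      ultimately show ?thesis by (simp only: nn_integral_completion)
    qed
    have fin_f: "AE x in lborel. x \<in> K1 \<longrightarrow> f x \<noteq> -\<infinity>"
    proof -
      have "AE x in lborel. e2ennreal \<bar>f' x\<bar> * indicator K1 x \<noteq> \<infinity>"
        using finK1 by (intro nn_integral_PInf_AE) (auto simp: less_top)
      then show ?thesis
        by eventually_elim (use K1U in \<open>auto simp: f'_def\<close>)
    qed
    have G: "integrable lborel G"
    proof (rule integrableI_bounded)
      have "(\<integral>\<^sup>+x. ennreal (norm (G x)) \<partial>lborel) \<le> set_nn_integral lborel K1 (\<lambda>x. e2ennreal \<bar>f' x\<bar>)"
      proof (rule nn_integral_mono)
        fix x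
        show "ennreal (norm (G x)) \<le> e2ennreal \<bar>f' x\<bar> * indicator K1 x"
          by (cases "f' x") (auto simp: G_def indicator_def)
      qed
      with finK1 show "(\<integral>\<^sup>+x. ennreal (norm (G x)) \<partial>lborel) < \<infinity>" by (rule order.strict_trans1[rotated])
    qed simp
    have T_eq: "T \<eta> = (LINT x|lborel. G x * \<eta> x)" if \<eta>: "\<eta> \<in> test_functions U" "supp \<eta> \<subseteq> K" for \<eta>
    proof -
      have \<eta>m [measurable]: "\<eta> \<in> borel_measurable borel" by (rule smooth_measurable[OF test_functionsD(1)[OF \<eta>(1)]])
      have eq: "indicator U x * (real_of_ereal (f x) * \<eta> x) = G x * \<eta> x" for x
      proof (cases "x \<in> K")
        case True
        then have "x \<in> K1" "x \<in> U" using KK1 K(2) by auto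
        then show ?thesis by (simp add: G_eq)
      next
        case False
        then have "\<eta> x = 0" using \<eta>(2) not_in_supp[of x \<eta>] by blast
        then show ?thesis by simp
      qed
      have "T \<eta> = (LINT x|lebesgue. G x * \<eta> x)" unfolding T_def induced_dist_alt eq ..
      also have "\<dots> = (LINT x|lborel. G x * \<eta> x)" by (rule integral_completion) measurable
      finally show ?thesis .
    qed
    define L where "L = (\<lambda>x. dir_deriv w (dir_deriv w \<phi>) x + dir_deriv (\<i> *s w) (dir_deriv (\<i> *s w) \<phi>) x)"
    have dd: "dir_deriv v (dir_deriv v \<phi>) \<in> test_functions U" "supp (dir_deriv v (dir_deriv v \<phi>)) \<subseteq> K" for v
      using \<phi> supp_dir_deriv[of v \<phi>] supp_dir_deriv[of v "dir_deriv v \<phi>"]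
      by (auto intro!: test_functions_dir_deriv simp: K_def)
    have bounded_G: "integrable lborel (\<lambda>x. G x * \<eta> x)" if \<eta>: "\<eta> \<in> test_functions U" for \<eta>
    proof -
      obtain B where B: "B > 0" "\<And>x. \<bar>\<eta> x\<bar> \<le> B" using test_functions_bounded[OF \<eta>] by blast
      have [measurable]: "\<eta> \<in> borel_measurable borel" by (rule smooth_measurable[OF test_functionsD(1)[OF \<eta>]])
      show ?thesis
      proof (rule Bochner_Integration.integrable_bound)
        show "integrable lborel (\<lambda>x. \<bar>G x\<bar> * B)" using G by simp
        show "AE x in lborel. norm (G x * \<eta> x) \<le> norm (\<bar>G x\<bar> * B)"
          using B by (auto intro!: AE_I2 mult_left_mono simp: abs_mult)
      qed measurable
    qed
    have L: "L \<in> test_functions U" unfolding L_def by (intro test_functions_add dd)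
    have TL: "T (dir_deriv w (dir_deriv w \<phi>)) + T (dir_deriv (\<i> *s w) (dir_deriv (\<i> *s w) \<phi>)) = (LINT x|lborel. G x * L x)"
      unfolding T_eq[OF dd] L_def distrib_left using bounded_G[OF dd(1)] by simp
    define W where "W = (LINT x|lborel. indicator U x * (\<psi> x * \<phi> x))"
    note W_int = weighted_test_integral[OF U \<psi>(1) \<phi>]
    note \<phi>m [measurable] = smooth_measurable[OF test_functionsD(1)[OF \<phi>]]
    obtain B where B: "B > 0" "\<And>x. \<bar>\<phi> x\<bar> \<le> B" using test_functions_bounded[OF \<phi>] by blast
    interpret pair_sigma_finite circle "lborel :: (complex ^ 'n) measure" by (rule pair_sigma_finite_circle)
    \<comment> \<open>The mean value inequality multiplied by \<open>\<phi>\<close> and integrated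
      over the centre, with the circle mean on the test function.\<close>
    have key: "2 * pi * t\<^sup>2 * (norm w)\<^sup>2 * W + 2 * pi * (LINT x|lborel. G x * \<phi> x) \<le>
        (LINT x|lborel. G x * (LINT \<theta>|circle. \<phi> (x - t *\<^sub>R (cos \<theta> *\<^sub>R w + sin \<theta> *\<^sub>R (\<i> *s w)))))"
      and key_int: "integrable lborel (\<lambda>x. G x * (LINT \<theta>|circle. \<phi> (x - t *\<^sub>R (cos \<theta> *\<^sub>R w + sin \<theta> *\<^sub>R (\<i> *s w)))))"
      if t: "0 < t" "t * norm w < r" for t
    proof -
      define b where "b = t *\<^sub>R w"
      have b: "norm b < r" using t by (simp add: b_def)
      have rot: "t *\<^sub>R (cos \<theta> *\<^sub>R w + sin \<theta> *\<^sub>R (\<i> *s w)) = cis \<theta> *s b" for \<theta>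
        unfolding b_def cis_vector_scalar by (simp add: scaleR_add_right vec_eq_iff mult.commute)
      \<comment> \<open>For a fixed angle \<open>F2\<close> is the translate of \<open>F1\<close> by
        a point of the circle, so the two have the same integral in \<open>x\<close>. Integrating
        over the angle as well transfers the circle mean from \<open>G\<close> to
        \<open>\<phi>\<close>.\<close>
      define F1 where "F1 = (\<lambda>\<theta> x. \<phi> x * G (x + cis \<theta> *s b))"
      define F2 where "F2 = (\<lambda>\<theta> x. \<phi> (x - cis \<theta> *s b) * G x)"
      have m1: "(\<lambda>(\<theta>, x). g (x + cis \<theta> *s b')) \<in> borel_measurable (circle \<Otimes>\<^sub>M lborel)"
        if "g \<in> borel_measurable borel" for g :: "complex ^ 'n \<Rightarrow> real" and b'
        using measurable_circle_product(1)[OF that, of 0 b'] by simp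
      have [measurable]: "(\<lambda>(\<theta>, x). \<phi> (x - cis \<theta> *s b)) \<in> borel_measurable (circle \<Otimes>\<^sub>M lborel)"
      proof -
        have "cis \<theta> *s (- b) = - (cis \<theta> *s b)" for \<theta> by (simp add: vec_eq_iff)
        then show ?thesis using m1[OF \<phi>m, of "- b"] by simp
      qed
      have [measurable]: "(\<lambda>(\<theta>, x). G (x + cis \<theta> *s b)) \<in> borel_measurable (circle \<Otimes>\<^sub>M lborel)"
        by (rule m1[OF Gm])
      have F12m [measurable]: "case_prod F1 \<in> borel_measurable (circle \<Otimes>\<^sub>M lborel)"
          "case_prod F2 \<in> borel_measurable (circle \<Otimes>\<^sub>M lborel)"
        unfolding F1_def F2_def case_prod_beta' by measurable
      have shift: "F1 \<theta> (- (cis \<theta> *s b) + x) = F2 \<theta> x" for \<theta> x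
        by (simp add: F1_def F2_def)
      have F1x: "F1 \<theta> \<in> borel_measurable borel" for \<theta>
        unfolding F1_def by measurable
      have slices: "(LINT x|lborel. F1 \<theta> x) = (LINT x|lborel. F2 \<theta> x)" for \<theta>
        using integral_translate(1)[OF F1x[of \<theta>], where c="- (cis \<theta> *s b)"] by (simp only: shift)
      have bound: "(\<integral>\<^sup>+p. ennreal (norm (case_prod F p)) \<partial>(circle \<Otimes>\<^sub>M lborel)) < \<infinity>"
        if Fm: "case_prod F \<in> borel_measurable (circle \<Otimes>\<^sub>M lborel)"
          and le: "\<And>\<theta>. (\<integral>\<^sup>+x. ennreal (norm (F \<theta> x)) \<partial>lborel) \<le> (\<integral>\<^sup>+x. ennreal (B * norm (G x)) \<partial>lborel)"
        for F :: "real \<Rightarrow> complex ^ 'n \<Rightarrow> real"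
      proof -
        have "(\<integral>\<^sup>+p. ennreal (norm (case_prod F p)) \<partial>(circle \<Otimes>\<^sub>M lborel)) = (\<integral>\<^sup>+\<theta>. \<integral>\<^sup>+x. ennreal (norm (F \<theta> x)) \<partial>lborel \<partial>circle)"
          using lborel.nn_integral_fst[of "\<lambda>p. ennreal (norm (case_prod F p))" circle] Fm by simp
        also have "\<dots> \<le> (\<integral>\<^sup>+\<theta>. (\<integral>\<^sup>+x. ennreal (B * norm (G x)) \<partial>lborel) \<partial>circle)"
          by (rule nn_integral_mono) (rule le)
        also have "\<dots> = (\<integral>\<^sup>+x. ennreal (B * norm (G x)) \<partial>lborel) * ennreal (2 * pi)"
          unfolding nn_integral_const emeasure_circle ..
        also have "\<dots> < \<infinity>"
        proof -
          have "integrable lborel (\<lambda>x. B * norm (G x))" using G by simp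
          then have "(\<integral>\<^sup>+x. ennreal (norm (B * norm (G x))) \<partial>lborel) < \<infinity>"
            by (simp only: integrable_iff_bounded)
          moreover have "norm (B * norm (G x)) = B * norm (G x)" for x using B(1) by (simp add: abs_mult)
          ultimately have "(\<integral>\<^sup>+x. ennreal (B * norm (G x)) \<partial>lborel) < \<infinity>" by (simp only:)
          then show ?thesis by (simp add: ennreal_mult_less_top)
        qed
        finally show ?thesis .
      qed
      have le2: "(\<integral>\<^sup>+x. ennreal (norm (F2 \<theta> x)) \<partial>lborel) \<le> (\<integral>\<^sup>+x. ennreal (B * norm (G x)) \<partial>lborel)" for \<theta>
        using B(2) by (intro nn_integral_mono ennreal_leI) (auto simp: F2_def abs_mult intro: mult_right_mono)
      have le1: "(\<integral>\<^sup>+x. ennreal (norm (F1 \<theta> x)) \<partial>lborel) \<le> (\<integral>\<^sup>+x. ennreal (B * norm (G x)) \<partial>lborel)" for \<theta>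
      proof -
        have "(\<integral>\<^sup>+x. ennreal (norm (F1 \<theta> x)) \<partial>lborel) = (\<integral>\<^sup>+x. ennreal (norm (F2 \<theta> x)) \<partial>lborel)"
          using nn_integral_translate_reflect(1)[of "\<lambda>x. ennreal (norm (F1 \<theta> x))" "- (cis \<theta> *s b)"] F1x[of \<theta>]
          by (simp add: F1_def F2_def)
        with le2 show ?thesis by simp
      qed
      have I1: "integrable (circle \<Otimes>\<^sub>M lborel) (case_prod F1)" and I2: "integrable (circle \<Otimes>\<^sub>M lborel) (case_prod F2)"
        using bound[OF F12m(1) le1] bound[OF F12m(2) le2] F12m by (auto simp: integrable_iff_bounded)
      have S2: "(LINT \<theta>|circle. F2 \<theta> x) = G x * (LINT \<theta>|circle. \<phi> (x - cis \<theta> *s b))" for x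
        unfolding F2_def by (subst integral_mult_left_zero) (rule mult.commute)
      have S1: "(LINT \<theta>|circle. F1 \<theta> x) = \<phi> x * (LINT \<theta>|circle. G (x + cis \<theta> *s b))" for x
        unfolding F1_def by (rule integral_mult_right_zero)
      show int: "integrable lborel (\<lambda>x. G x * (LINT \<theta>|circle. \<phi> (x - t *\<^sub>R (cos \<theta> *\<^sub>R w + sin \<theta> *\<^sub>R (\<i> *s w)))))"
        using integrable_snd[OF I2] unfolding S2 rot .
      have int1: "integrable lborel (\<lambda>x. \<phi> x * (LINT \<theta>|circle. G (x + cis \<theta> *s b)))"
        using integrable_snd[OF I1] unfolding S1 .
      have "(LINT x|lborel. \<phi> x * (LINT \<theta>|circle. G (x + cis \<theta> *s b))) =
          (LINT x|lborel. G x * (LINT \<theta>|circle. \<phi> (x - cis \<theta> *s b)))"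
        using Fubini_integral[OF I1] Fubini_integral[OF I2] unfolding S1 S2 slices by simp
      moreover have "2 * pi * t\<^sup>2 * (norm w)\<^sup>2 * W + 2 * pi * (LINT x|lborel. G x * \<phi> x) \<le>
          (LINT x|lborel. \<phi> x * (LINT \<theta>|circle. G (x + cis \<theta> *s b)))"
      proof -
        have "2 * pi * t\<^sup>2 * (norm w)\<^sup>2 * W + 2 * pi * (LINT x|lborel. G x * \<phi> x) =
            (LINT x|lborel. 2 * pi * t\<^sup>2 * (norm w)\<^sup>2 * (indicator U x * (\<psi> x * \<phi> x)) + 2 * pi * (G x * \<phi> x))"
          unfolding W_def using W_int(1) bounded_G[OF \<phi>] by simp
        also have "\<dots> \<le> (LINT x|lborel. \<phi> x * (LINT \<theta>|circle. G (x + cis \<theta> *s b)))"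
        proof (rule integral_mono_AE)
          show "integrable lborel (\<lambda>x. 2 * pi * t\<^sup>2 * (norm w)\<^sup>2 * (indicator U x * (\<psi> x * \<phi> x)) + 2 * pi * (G x * \<phi> x))"
            using W_int(1) bounded_G[OF \<phi>] by (intro Bochner_Integration.integrable_add integrable_mult_right)
          show "AE x in lborel. 2 * pi * t\<^sup>2 * (norm w)\<^sup>2 * (indicator U x * (\<psi> x * \<phi> x)) + 2 * pi * (G x * \<phi> x) \<le>
              \<phi> x * (LINT \<theta>|circle. G (x + cis \<theta> *s b))"
            using fin_f
          proof eventually_elim
            case (elim x)
            show ?case
            proof (cases "x \<in> K")
              case False
              then show ?thesis by (simp add: \<phi>K)
            next
              case True
              have x: "x \<in> U" "x \<in> K1" "f x \<noteq> -\<infinity>" using True K(2) KK1 elim by auto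
              have "norm b < \<delta> x" using b r(2) True by fastforce
              then have "{x + \<zeta> *s b |\<zeta>. norm \<zeta> \<le> 1} \<subseteq> U" "ereal (\<psi> x * (norm b)\<^sup>2) + f x \<le> circle_mean f x b"
                using mean x(1) by blast+
              from psh_average_real_mean(3)[OF U usc this x(3)]
              have "2 * pi * (\<psi> x * (norm b)\<^sup>2 + G x) \<le> (LINT \<theta>|circle. G (x + cis \<theta> *s b))"
                using b by (simp add: G_eq x(2) K1I[OF True] norm_vector_scalar)
              then have "\<phi> x * (2 * pi * (\<psi> x * (norm b)\<^sup>2 + G x)) \<le> \<phi> x * (LINT \<theta>|circle. G (x + cis \<theta> *s b))"
                using \<phi>0 by (intro mult_left_mono) auto
              moreover have "(norm b)\<^sup>2 = t\<^sup>2 * (norm w)\<^sup>2" by (simp add: b_def power_mult_distrib)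
              ultimately show ?thesis using x(1) by (simp add: algebra_simps)
            qed
          qed
        qed (rule int1)
        finally show ?thesis .
      qed
      ultimately show "2 * pi * t\<^sup>2 * (norm w)\<^sup>2 * W + 2 * pi * (LINT x|lborel. G x * \<phi> x) \<le>
        (LINT x|lborel. G x * (LINT \<theta>|circle. \<phi> (x - t *\<^sub>R (cos \<theta> *\<^sub>R w + sin \<theta> *\<^sub>R (\<i> *s w)))))"
        unfolding rot by simp
    qed
    define IG where "IG = (LINT x|lborel. \<bar>G x\<bar>)"
    have IG: "IG \<ge> 0" by (simp add: IG_def)
    have approx: "2 * pi * (norm w)\<^sup>2 * W \<le> pi / 2 * (LINT x|lborel. G x * L x) + e * IG" if e: "0 < e" for e
    proof -
      obtain t0 where t0: "t0 > 0" "\<And>t x. 0 < t \<Longrightarrow> t < t0 \<Longrightarrow>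
          \<bar>(LINT \<theta>|circle. \<phi> (x - t *\<^sub>R (cos \<theta> *\<^sub>R w + sin \<theta> *\<^sub>R (\<i> *s w)))) - (2 * pi * \<phi> x + t\<^sup>2 * (pi / 2) * L x)\<bar> \<le> t\<^sup>2 * e"
        using circle_mean_expansion[OF \<phi> e, of w "\<i> *s w"] unfolding L_def by blast
      \<comment> \<open>Small enough for the Taylor estimate and for the circles to have radius
        below \<open>r\<close>; adding \<open>1\<close> covers \<open>w = 0\<close>.\<close>
      define t where "t = min t0 (r / (norm w + 1)) / 2"
      have wp: "norm w + 1 > 0" by (simp add: add_nonneg_pos)
      have t: "0 < t" "t < t0" using t0(1) r(1) wp by (auto simp: t_def min_def)
      have "t < r / (norm w + 1)" proof -
        have "min u q / 2 < q" if "0 < q" for u q :: real using that min.cobounded2[of u q] by linarith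
        from this[OF divide_pos_pos[OF r(1) wp]] show ?thesis unfolding t_def .
      qed
      then have "t * (norm w + 1) < r" using wp by (simp add: pos_less_divide_eq)
      then have tr: "t * norm w < r" using t(1) by (simp add: distrib_left)
      define S where "S = (\<lambda>x. LINT \<theta>|circle. \<phi> (x - t *\<^sub>R (cos \<theta> *\<^sub>R w + sin \<theta> *\<^sub>R (\<i> *s w))))"
      have S: "integrable lborel (\<lambda>x. G x * S x)" unfolding S_def by (rule key_int[OF t(1) tr])
      have "(LINT x|lborel. G x * S x) \<le> (LINT x|lborel. 2 * pi * (G x * \<phi> x) + t\<^sup>2 * (pi / 2) * (G x * L x) + t\<^sup>2 * e * \<bar>G x\<bar>)"
      proof (rule integral_mono[OF S])
        show "integrable lborel (\<lambda>x. 2 * pi * (G x * \<phi> x) + t\<^sup>2 * (pi / 2) * (G x * L x) + t\<^sup>2 * e * \<bar>G x\<bar>)"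
          by (intro Bochner_Integration.integrable_add integrable_mult_right bounded_G[OF \<phi>] bounded_G[OF L] integrable_abs G)
        fix x
        have "\<bar>S x - (2 * pi * \<phi> x + t\<^sup>2 * (pi / 2) * L x)\<bar> \<le> t\<^sup>2 * e" unfolding S_def by (rule t0(2)[OF t])
        then have "\<bar>G x\<bar> * \<bar>S x - (2 * pi * \<phi> x + t\<^sup>2 * (pi / 2) * L x)\<bar> \<le> \<bar>G x\<bar> * (t\<^sup>2 * e)" by (rule mult_left_mono) simp
        then have "G x * (S x - (2 * pi * \<phi> x + t\<^sup>2 * (pi / 2) * L x)) \<le> \<bar>G x\<bar> * (t\<^sup>2 * e)"
          unfolding abs_mult[symmetric] by linarith
        then show "G x * S x \<le> 2 * pi * (G x * \<phi> x) + t\<^sup>2 * (pi / 2) * (G x * L x) + t\<^sup>2 * e * \<bar>G x\<bar>"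
          by (simp add: algebra_simps)
      qed
      also have "\<dots> = 2 * pi * (LINT x|lborel. G x * \<phi> x) + t\<^sup>2 * (pi / 2) * (LINT x|lborel. G x * L x) + t\<^sup>2 * e * IG"
        unfolding IG_def using bounded_G[OF \<phi>] bounded_G[OF L] G by simp
      finally have "2 * pi * t\<^sup>2 * (norm w)\<^sup>2 * W \<le> t\<^sup>2 * (pi / 2) * (LINT x|lborel. G x * L x) + t\<^sup>2 * e * IG"
        using key[OF t(1) tr] unfolding S_def by linarith
      then have "t\<^sup>2 * (2 * pi * (norm w)\<^sup>2 * W) \<le> t\<^sup>2 * (pi / 2 * (LINT x|lborel. G x * L x) + e * IG)"
        by (simp add: algebra_simps)
      then show ?thesis using t(1) by (simp add: mult_le_cancel_left)
    qed
    have "2 * pi * (norm w)\<^sup>2 * W \<le> pi / 2 * (LINT x|lborel. G x * L x)"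
    proof (rule field_le_epsilon)
      fix e :: real assume e: "0 < e"
      have "2 * pi * (norm w)\<^sup>2 * W \<le> pi / 2 * (LINT x|lborel. G x * L x) + e / (IG + 1) * IG"
        using e IG by (intro approx) auto
      also have "e / (IG + 1) * IG \<le> e" using e IG by (simp add: field_simps)
      finally show "2 * pi * (norm w)\<^sup>2 * W \<le> pi / 2 * (LINT x|lborel. G x * L x) + e" by simp
    qed
    \<comment> \<open>Dividing \<open>2 * pi\<close> by the factor \<open>pi / 2\<close> of the
      expansion yields the \<open>4\<close> that matches the quarter in the Levi form.\<close>
    then have "pi / 2 * (4 * W * (norm w)\<^sup>2) \<le> pi / 2 * (LINT x|lborel. G x * L x)"
      by (simp add: algebra_simps)
    then have "4 * W * (norm w)\<^sup>2 \<le> (LINT x|lborel. G x * L x)"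
      by (simp add: mult_le_cancel_left)
    then show ?thesis unfolding TL W_int(2) W_def .
  qed
  then have "strictly_psh_dist U T"
    unfolding strictly_psh_dist_iff[OF T] using \<psi> by blast
  then show ?thesis by (simp add: strictly_psh_in_distribution_def T_def)
qed

subsection \<open>Functions are determined by the distributions they induce\<close>

text \<open>Each factor vanishes on the wrong side of a face of the box and tends to
  \<open>1\<close> on the right side as \<open>n\<close> grows. The products are smooth and converge
  pointwise to the indicator of the open box.\<close>

definition box_bump :: "'a::euclidean_space \<Rightarrow> 'a \<Rightarrow> nat \<Rightarrow> 'a \<Rightarrow> real" where
  "box_bump a b n x = (\<Prod>i\<in>Basis. bump 0 (real n * (x \<bullet> i - a \<bullet> i)) * bump 0 (real n * (b \<bullet> i - x \<bullet> i)))"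

lemma smooth_box_approximation:
  fixes a b :: "'a::euclidean_space"
  shows "smooth (box_bump a b n)" "0 \<le> box_bump a b n x" "box_bump a b n x \<le> 1"
    "(\<lambda>n. box_bump a b n x) \<longlonglongrightarrow> indicator (box a b) x"
proof -
  show "smooth (box_bump a b n)" unfolding box_bump_def
    by (intro smooth_prod smooth_mult smooth_compose_real[OF smooth_bump] smooth_cmult smooth_diff
        smooth_const smooth_inner_right)
  show "0 \<le> box_bump a b n x" unfolding box_bump_def by (intro prod_nonneg mult_nonneg_nonneg) auto
  show "box_bump a b n x \<le> 1" unfolding box_bump_def by (intro prod_le_1 conjI mult_nonneg_nonneg mult_le_one bump_le_1) auto
  have lim: "(\<lambda>n. bump 0 (real n * t)) \<longlonglongrightarrow> (if 0 < t then 1 else 0)" for t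
  proof (cases "0 < t")
    case True
    then show ?thesis using bump_lim_1 by simp
  next
    case False
    then have "bump 0 (real n * t) = 0" for n by (intro bump_eq_0) (simp add: mult_nonneg_nonpos)
    then show ?thesis using False by simp
  qed
  have "(\<lambda>n. box_bump a b n x) \<longlonglongrightarrow> (\<Prod>i\<in>Basis. (if 0 < x \<bullet> i - a \<bullet> i then 1 else 0) * (if 0 < b \<bullet> i - x \<bullet> i then 1 else 0))"
    unfolding box_bump_def by (intro tendsto_prod tendsto_mult lim)
  also have "(\<Prod>i\<in>Basis. (if 0 < x \<bullet> i - a \<bullet> i then 1 else 0) * (if 0 < b \<bullet> i - x \<bullet> i then 1 else 0 :: real)) = indicator (box a b) x"
  proof (cases "x \<in> box a b")
    case True
    then show ?thesis by (simp add: mem_box)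
  next
    case False
    then obtain i where "i \<in> Basis" "\<not> (a \<bullet> i < x \<bullet> i \<and> x \<bullet> i < b \<bullet> i)" by (auto simp: mem_box)
    then show ?thesis using False by (auto intro!: prod_zero bexI[of _ i])
  qed
  finally show "(\<lambda>n. box_bump a b n x) \<longlonglongrightarrow> indicator (box a b) x" .
qed

text \<open>Smooth approximation gives zero integrals over boxes, which form an intersection-stable
  generator of the Borel sets; hence all Borel sets follow, in particular those where
  \<open>D\<close> is positive or negative. All smooth functions may be tested, since in the
  application \<open>D\<close> already carries a cutoff.\<close>

lemma AE_zero_if_test_integrals_zero:
  fixes D :: "'a::euclidean_space \<Rightarrow> real"
  assumes D: "integrable lborel D" and zero: "\<And>\<eta>. smooth \<eta> \<Longrightarrow> (LINT x|lborel. D x * \<eta> x) = 0"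
  shows "AE x in lborel. D x = 0"
proof -
  have [measurable]: "D \<in> borel_measurable borel" using D by auto
  have box: "(LINT x:box a b|lborel. D x) = 0" for a b
  proof -
    define \<eta> where "\<eta> = box_bump a b"
    note \<eta> = smooth_box_approximation[where a=a and b=b, folded \<eta>_def]
    have [measurable]: "\<eta> n \<in> borel_measurable borel" for n by (rule smooth_measurable[OF \<eta>(1)])
    have "(\<lambda>n. LINT x|lborel. D x * \<eta> n x) \<longlonglongrightarrow> (LINT x|lborel. D x * indicator (box a b) x)"
    proof (rule integral_dominated_convergence)
      show "integrable lborel (\<lambda>x. \<bar>D x\<bar>)" using D by simp
      show "(\<lambda>x. D x * \<eta> n x) \<in> borel_measurable lborel" for n
        unfolding measurable_lborel1 by (rule borel_measurable_times) measurable
      show "AE x in lborel. (\<lambda>n. D x * \<eta> n x) \<longlonglongrightarrow> D x * indicator (box a b) x"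
        by (intro AE_I2 tendsto_mult tendsto_const \<eta>(4))
      show "AE x in lborel. norm (D x * \<eta> n x) \<le> \<bar>D x\<bar>" for n
      proof (rule AE_I2)
        fix x
        have "\<bar>D x\<bar> * \<eta> n x \<le> \<bar>D x\<bar> * 1" using \<eta>(3)[of n x] by (rule mult_left_mono) simp
        then show "norm (D x * \<eta> n x) \<le> \<bar>D x\<bar>" using \<eta>(2)[of n x] by (simp add: abs_mult)
      qed
    qed simp
    then have "(LINT x|lborel. D x * indicator (box a b) x) = 0"
      unfolding zero[OF \<eta>(1)] by (simp add: LIMSEQ_const_iff)
    then show ?thesis by (simp add: set_lebesgue_integral_def mult.commute)
  qed
  have set: "(LINT x:A|lborel. D x) = 0" if A: "A \<in> sets borel" for A
  proof -
    let ?G = "range (\<lambda>(a, b). box a b :: 'a set)"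
    have borel: "sets borel = sigma_sets UNIV ?G" by (simp add: borel_eq_box)
    have "Int_stable ?G" by (auto simp: Int_stable_def box_Int_box)
    moreover have "?G \<subseteq> Pow UNIV" by simp
    moreover have "A \<in> sigma_sets UNIV ?G" using A borel by blast
    ultimately show ?thesis
    proof (induction rule: sigma_sets_induct_disjoint)
      case (basic A)
      then show ?case using box by auto
    next
      case empty
      show ?case by (simp add: set_lebesgue_integral_def)
    next
      case (compl A)
      have A': "A \<in> sets borel" using compl(1) borel by blast
      have "indicator (UNIV - A) x *\<^sub>R D x = D x - indicator A x *\<^sub>R D x" for x by (simp add: indicator_def)
      moreover have "integrable lborel (\<lambda>x. indicator A x *\<^sub>R D x)"
        using integrable_mult_indicator[OF _ D, of A] A' by simp
      \<comment> \<open>The complement step needs the integral over the whole space, obtained by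
        testing with the constant \<open>1\<close>.\<close>
      moreover have "(LINT x|lborel. D x) = 0" using zero[OF smooth_const[of 1]] by simp
      ultimately show ?case using compl(2) D by (simp add: set_lebesgue_integral_def)
    next
      case (union A)
      have A': "A i \<in> sets borel" for i using union(2) borel by blast
      have "(LINT x:(\<Union>i. A i)|lborel. D x) = (\<Sum>i. (LINT x:(A i)|lborel. D x))"
      proof (rule lebesgue_integral_countable_add)
        show "A i \<inter> A j = {}" if "i \<noteq> j" for i j using union(1) that by (auto simp: disjoint_family_on_def)
        have "(\<Union>i. A i) \<in> sets lborel" using A' by auto
        then show "set_integrable lborel (\<Union>i. A i) D"
          unfolding set_integrable_def by (rule integrable_mult_indicator[OF _ D])
      qed (use A' in simp)
      then show ?case using union(3) by simp
    qed
  qed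
  have half: "AE x in lborel. s * D x \<le> 0" if s: "s = 1 \<or> s = -1" for s
  proof -
    define A where "A = {x. 0 < s * D x}"
    have A [measurable]: "A \<in> sets borel" unfolding A_def by measurable
    have int: "integrable lborel (\<lambda>x. s * (indicator A x *\<^sub>R D x))"
      using integrable_mult_indicator[OF _ D, of A] A by simp
    have "(LINT x|lborel. s * (indicator A x *\<^sub>R D x)) = 0"
      using set[OF A] unfolding set_lebesgue_integral_def integral_mult_right_zero by simp
    moreover have nn: "0 \<le> s * (indicator A x *\<^sub>R D x)" for x by (simp add: A_def indicator_def)
    ultimately have "AE x in lborel. s * (indicator A x *\<^sub>R D x) = 0"
      using integral_nonneg_eq_0_iff_AE[OF int] by simp
    then show ?thesis by eventually_elim (auto simp: A_def indicator_def split: if_splits)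
  qed
  from half[of 1] half[of "-1"] show ?thesis by auto
qed

text \<open>Multiplying by a test function \<open>\<kappa>\<close> makes the difference of
  \<open>f\<close> and \<open>g\<close> globally integrable, and the product of
  \<open>\<kappa>\<close> with any smooth function is again a test function. Countably many cutoffs,
  one for each set of a compact exhaustion, reach all of \<open>U\<close>.\<close>

lemma induced_dist_inj:
  fixes f g :: "'a::euclidean_space \<Rightarrow> ereal"
  assumes U: "open U" and f: "loc_integrable_on U f" and g: "loc_integrable_on U g"
    and eq: "\<And>\<phi>. \<phi> \<in> test_functions U \<Longrightarrow> induced_dist U f \<phi> = induced_dist U g \<phi>"
  shows "AE x in lebesgue_on U. f x = g x"
proof -
  have local: "AE x in lebesgue. x \<in> U \<and> \<kappa> x \<noteq> 0 \<longrightarrow> f x = g x" if \<kappa>: "\<kappa> \<in> test_functions U" for \<kappa>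
  proof -
    note F = loc_integrable_test_function(1,2)[OF U f]
    note G = loc_integrable_test_function(1,2)[OF U g]
    define d where "d = (\<lambda>x. indicator U x * (real_of_ereal (f x) * \<kappa> x) - indicator U x * (real_of_ereal (g x) * \<kappa> x))"
    have d: "integrable lebesgue d" unfolding d_def using F(1)[OF \<kappa>] G(1)[OF \<kappa>] by (rule Bochner_Integration.integrable_diff)
    then have "d \<in> borel_measurable lebesgue" by simp
    \<comment> \<open>A Borel version of the Lebesgue measurable \<open>d\<close>, so that the
      criterion for Borel measure applies.\<close>
    then obtain D where D [measurable]: "D \<in> borel_measurable lborel" and ae: "AE x in lborel. d x = D x"
      using completion_ex_borel_measurable_real by blast
    have ae': "AE x in lebesgue. d x = D x" by (rule AE_completion[OF ae])
    have Dm: "D \<in> borel_measurable lebesgue" by (rule measurable_completion[OF D])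
    have "integrable lebesgue D" using d ae' Dm by (subst integrable_cong_AE[where g=d]) auto
    then have Dint: "integrable lborel D" using integrable_completion[OF D] by simp
    have "AE x in lborel. D x = 0"
    proof (rule AE_zero_if_test_integrals_zero[OF Dint])
      fix \<eta> :: "'a \<Rightarrow> real" assume \<eta>: "smooth \<eta>"
      have [measurable]: "\<eta> \<in> borel_measurable borel" by (rule smooth_measurable[OF \<eta>])
      have \<kappa>\<eta>: "(\<lambda>x. \<kappa> x * \<eta> x) \<in> test_functions U" by (rule test_functions_mult_smooth[OF \<kappa> \<eta>])
      have \<eta>m: "\<eta> \<in> borel_measurable lebesgue" by (rule measurable_completion) simp
      have "(LINT x|lborel. D x * \<eta> x) = (LINT x|lebesgue. D x * \<eta> x)"
        by (rule integral_completion[symmetric]) measurable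
      also have "\<dots> = (LINT x|lebesgue. d x * \<eta> x)"
        using ae' Dm d \<eta>m by (intro integral_cong_AE) auto
      also have "\<dots> = (LINT x|lebesgue. indicator U x * (real_of_ereal (f x) * (\<kappa> x * \<eta> x)) -
          indicator U x * (real_of_ereal (g x) * (\<kappa> x * \<eta> x)))"
        by (rule Bochner_Integration.integral_cong) (simp_all add: d_def algebra_simps)
      also have "\<dots> = induced_dist U f (\<lambda>x. \<kappa> x * \<eta> x) - induced_dist U g (\<lambda>x. \<kappa> x * \<eta> x)"
        unfolding induced_dist_alt by (rule Bochner_Integration.integral_diff[OF F(1)[OF \<kappa>\<eta>] G(1)[OF \<kappa>\<eta>]])
      also have "\<dots> = 0" using eq[OF \<kappa>\<eta>] by simp
      finally show "(LINT x|lborel. D x * \<eta> x) = 0" .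
    qed
    then have "AE x in lebesgue. D x = 0" by (rule AE_completion)
    with ae' F(2)[OF \<kappa>] G(2)[OF \<kappa>] show ?thesis
    proof eventually_elim
      case (elim x)
      show ?case
      proof
        assume x: "x \<in> U \<and> \<kappa> x \<noteq> 0"
        then have "x \<in> supp \<kappa>" using not_in_supp[of x \<kappa>] by blast
        then have fg: "f x = ereal (real_of_ereal (f x))" "g x = ereal (real_of_ereal (g x))" using elim by blast+
        have "real_of_ereal (f x) = real_of_ereal (g x)" using elim(1,4) x by (simp add: d_def)
        with fg show "f x = g x" by metis
      qed
    qed
  qed
  obtain C :: "nat \<Rightarrow> 'a set" where C: "\<And>n. compact (C n)" "\<And>n. C n \<subseteq> U" "\<Union>(range C) = U"
    proof (rule open_Union_compact_subsets[OF U])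
    fix C :: "nat \<Rightarrow> 'a set"
    assume "\<And>n. compact (C n)" "\<And>n. C n \<subseteq> U" "\<Union>(range C) = U"
    show thesis by (rule that[of C]) fact+
  qed
  have "\<exists>\<kappa>. \<kappa> \<in> test_functions U \<and> (\<forall>x\<in>C n. 1 \<le> \<kappa> x)" for n :: nat
    using cutoff_exists[OF U C(1,2)[of n]] by blast
  then obtain \<kappa> :: "nat \<Rightarrow> 'a \<Rightarrow> real" where \<kappa>: "\<And>n. \<kappa> n \<in> test_functions U" "\<And>n x. x \<in> C n \<Longrightarrow> 1 \<le> \<kappa> n x"
    by metis
  have "AE x in lebesgue. \<forall>n. x \<in> U \<and> \<kappa> n x \<noteq> 0 \<longrightarrow> f x = g x"
    unfolding AE_all_countable using local[OF \<kappa>(1)] by blast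
  then have "AE x in lebesgue. x \<in> U \<longrightarrow> f x = g x"
  proof eventually_elim
    case (elim x)
    show ?case
    proof
      assume x: "x \<in> U"
      then obtain n where "x \<in> C n" using C(3) by blast
      then have "\<kappa> n x \<noteq> 0" using \<kappa>(2)[of x n] by auto
      with elim x show "f x = g x" by blast
    qed
  qed
  moreover have "U \<in> sets lebesgue" using U by (simp add: borel_open)
  ultimately show ?thesis by (simp add: AE_restrict_space_iff)
qed

theorem proposition2p6:
  fixes U :: "(complex ^ 'n::finite) set"
  assumes "open U" and "connected U" and "bounded U" and "U \<noteq> {}"
  shows
    "(\<forall>f :: complex ^ 'n \<Rightarrow> ereal.
        strictly_psh_on_average U f \<and> (\<exists>x\<in>U. f x \<noteq> -\<infinity>) \<longrightarrow>
        loc_integrable_on U f \<and> strictly_psh_in_distribution U f) \<and>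
     (\<forall>T \<in> distributions U. strictly_psh_dist U T \<longrightarrow>
        (\<exists>f :: complex ^ 'n \<Rightarrow> ereal.
           loc_integrable_on U f \<and> strictly_psh_on_average U f \<and> induces U f T)) \<and>
     (\<forall>f :: complex ^ 'n \<Rightarrow> ereal.
        loc_integrable_on U f \<and> strictly_psh_in_distribution U f \<longrightarrow>
        (\<exists>g :: complex ^ 'n \<Rightarrow> ereal.
           loc_integrable_on U g \<and> strictly_psh_on_average U g \<and>
           (AE x in lebesgue_on U. f x = g x)))"
proof (intro conjI allI impI ballI)
  fix f :: "complex ^ 'n \<Rightarrow> ereal"
  assume f: "strictly_psh_on_average U f \<and> (\<exists>x\<in>U. f x \<noteq> -\<infinity>)"
  then show "loc_integrable_on U f"
    using psh_average_loc_integrable[OF assms(1,2)] by blast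
  with f show "strictly_psh_in_distribution U f"
    using psh_average_strictly_psh_in_distribution[OF assms(1)] by blast
next
  fix T assume "T \<in> distributions U" "strictly_psh_dist U T"
  then show "\<exists>f :: complex ^ 'n \<Rightarrow> ereal.
      loc_integrable_on U f \<and> strictly_psh_on_average U f \<and> induces U f T"
    by (rule strictly_psh_distribution_induced[OF assms(1)])
next
  fix f :: "complex ^ 'n \<Rightarrow> ereal"
  assume f: "loc_integrable_on U f \<and> strictly_psh_in_distribution U f"
  then have "strictly_psh_dist U (induced_dist U f)" by (simp add: strictly_psh_in_distribution_def)
  then obtain g :: "complex ^ 'n \<Rightarrow> ereal" where g: "loc_integrable_on U g" "strictly_psh_on_average U g"
      "induces U g (induced_dist U f)"
    using strictly_psh_distribution_induced[OF assms(1) induced_dist_distribution[OF assms(1)]] f by blast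
  have "AE x in lebesgue_on U. f x = g x"
    using f g(1,3) by (intro induced_dist_inj[OF assms(1)]) (auto simp: induces_def)
  with g show "\<exists>g :: complex ^ 'n \<Rightarrow> ereal. loc_integrable_on U g \<and> strictly_psh_on_average U g \<and>
      (AE x in lebesgue_on U. f x = g x)" by blast
qed

end
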